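(* For every $\mu\in\overline{\mathcal M}$ and every $P\in\mathbb R^n$ there exists a unique weak solution $\nu\in\Lambda_\mu$ of $F(\mu,P)$. Moreover, for this $\nu$, $$F(\mu,P)=-\int_{\mathbb T^n\times\mathbb R^n}\Big[\frac{|p|^2}{2}-p\cdot P\Big]\,d\nu(x,p),$$ and for every $J\in\mathbb R^n$ $$F^*(\mu,J)=\frac12\inf_{\nu\in\Lambda_\mu^{J}}\int_{\mathbb T^n\times\mathbb R^n}|p|^2\,d\nu(x,p),$$ where the infimum on the right-hand side is attained by the weak solution of $F(\mu,P)$ whenever $J\in\partial_P F(\mu,P)$ (the subgradient of $F(\mu,\cdot)$ at $P$). If in addition $\mu(dx)=\rho(x)\,dx$ with $\rho\in C^1(\mathbb T^n)$ and $\rho>0$ on $\mathbb T^n$, then the weak solution $\nu$ of $F(\mu,P)$ has the form $\nu(dx\,dp)=\delta_{P+\nabla\phi(x)}(dp)\otimes\rho(x)\,dx$, where $\phi$ is the classical solution (unique up to an additive constant) of the elliptic equation $\nabla\cdot[\rho(\nabla\phi+P)]=0$ on $\mathbb T^n$.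
   Context: $\mathbb T^n=\mathbb R^n/\mathbb Z^n$ is the flat torus and $\overline{\mathcal M}$ is the set of Borel probability measures on $\mathbb T^n$. For $\mu\in\overline{\mathcal M}$, $P,J\in\mathbb R^n$: $$F(\mu,P)=\frac12\inf_{\phi\in C^1(\mathbb T^n)}\int_{\mathbb T^n}|\nabla\phi+P|^2\,d\mu,\qquad F^*(\mu,J)=\sup_{P\in\mathbb R^n}\,[P\cdot J-F(\mu,P)]\in\mathbb R\cup\{+\infty\}.$$ $\Lambda$ is the set of Borel probability measures $\nu$ on $\mathbb T^n\times\mathbb R^n$ (points $(x,p)$) with $\int|p|^2d\nu<\infty$ and $\int p\cdot\nabla\theta(x)\,d\nu(x,p)=0$ for all $\theta\in C^1(\mathbb T^n)$. $\Lambda_\mu$ is the set of $\nu\in\Lambda$ whose marginal on $\mathbb T^n$ is $\mu$. $\Lambda_\mu^J$ is the set of $\nu\in\Lambda_\mu$ with $\int p\,d\nu=J$ (it may be empty; the infimum over the empty set is $+\infty$). A measure $\nu\in\Lambda_\mu$ is a weak solution of $F(\mu,P)$ if $\int[\frac{|p|^2}{2}-p\cdot P]\,d\nu\le\int[\frac{|p|^2}{2}-p\cdot P]\,d\xi$ for all $\xi\in\Lambda_\mu$.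
   Formalization: For ρ only C¹ a C² classical solution need not exist; "classical solution" is read as a C¹ function φ solving ∇·[ρ(∇φ+P)]=0 in the sense of distributions. This φ exists, is unique up to constants, and for φ in C² the notion agrees with the pointwise equation. *)

theory Defs
  imports "HOL-Analysis.Analysis" "HOL-Probability.Giry_Monad"
begin

text \<open>
  The flat torus of dimension \<open>CARD('n)\<close>: the quotient of \<open>real^'n\<close> by the integer lattice, with the
  quotient topology. Borel measures on it and on its product with \<open>real^'n\<close> are measures \<open>M\<close> with
  \<open>sets M = sets borel\<close>.
\<close>

definition lattice_rel :: "real^'n \<Rightarrow> real^'n \<Rightarrow> bool" where
  "lattice_rel x y \<longleftrightarrow> (\<forall>i. x $ i - y $ i \<in> \<int>)"

lemma equivp_lattice_rel: "equivp lattice_rel"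
proof (rule equivpI)
  show "reflp lattice_rel"
    by (auto simp: reflp_def lattice_rel_def)
  show "symp lattice_rel"
    unfolding symp_def lattice_rel_def by (metis Ints_minus minus_diff_eq)
  show "transp lattice_rel"
  proof (rule transpI)
    fix x y z :: "real^'n"
    assume "lattice_rel x y" "lattice_rel y z"
    then have "(x $ i - y $ i) + (y $ i - z $ i) \<in> \<int>" for i
      unfolding lattice_rel_def by (intro Ints_add) auto
    then show "lattice_rel x z"
      by (simp add: lattice_rel_def)
  qed
qed

quotient_type (overloaded) 'n torus = "real^'n" / lattice_rel
  morphisms rep_torus torus_proj
  by (rule equivp_lattice_rel)

lemma torus_proj_eq_iff: "torus_proj x = torus_proj y \<longleftrightarrow> (\<forall>i. x $ i - y $ i \<in> \<int>)"
  by (simp add: torus.abs_eq_iff lattice_rel_def)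

lemma surj_torus_proj: "surj torus_proj"
  using Quotient_torus by (metis Quotient_abs_rep surj_def)

instantiation torus :: (finite) topological_space
begin

definition open_torus :: "'a torus set \<Rightarrow> bool" where
  "open_torus U \<longleftrightarrow> open (torus_proj -` U)"

instance
  by standard (auto simp: open_torus_def vimage_Int vimage_Union)

end

lemma continuous_torus_proj: "continuous_on UNIV torus_proj"
  by (simp add: continuous_on_open_vimage open_torus_def)

text \<open>
  Differentiability on the torus is differentiability of the lift to \<open>real^'n\<close>.
\<close>

definition has_torus_grad :: "(('n::finite) torus \<Rightarrow> real) \<Rightarrow> 'n torus \<Rightarrow> real^'n \<Rightarrow> bool" where
  "has_torus_grad f x v \<longleftrightarrow> (\<forall>y. torus_proj y = x \<longrightarrow> GDERIV (f \<circ> torus_proj) y :> v)"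

definition torus_grad :: "(('n::finite) torus \<Rightarrow> real) \<Rightarrow> 'n torus \<Rightarrow> real^'n" where
  "torus_grad f x = (THE v. has_torus_grad f x v)"

lemma torus_grad_eq:
  assumes "has_torus_grad f x v"
  shows "torus_grad f x = v"
  unfolding torus_grad_def
proof (rule the_equality)
  show "has_torus_grad f x v" by fact
next
  fix w assume w: "has_torus_grad f x w"
  obtain y where "torus_proj y = x"
    using surj_torus_proj by (metis surj_def)
  then have "(\<lambda>h. h \<bullet> w) = (\<lambda>h. h \<bullet> v)"
    using w assms unfolding has_torus_grad_def gderiv_def
    by (blast intro: has_derivative_unique)
  then show "w = v"
    by (metis vector_eq_ldot)
qed

definition torus_C1 :: "(('n::finite) torus \<Rightarrow> real) \<Rightarrow> bool" where
  "torus_C1 f \<longleftrightarrow> (\<exists>g. continuous_on UNIV g \<and> (\<forall>x. has_torus_grad f x (g x)))"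

definition torus_C2 :: "(('n::finite) torus \<Rightarrow> real) \<Rightarrow> bool" where
  "torus_C2 f \<longleftrightarrow> torus_C1 f \<and> (\<forall>i. torus_C1 (\<lambda>x. torus_grad f x $ i))"

definition torus_div :: "(('n::finite) torus \<Rightarrow> real^'n) \<Rightarrow> 'n torus \<Rightarrow> real" where
  "torus_div V x = (\<Sum>i\<in>UNIV. torus_grad (\<lambda>y. V y $ i) x $ i)"

definition torus_lborel :: "('n::finite) torus measure" where
  "torus_lborel =
     distr (restrict_space lborel {x :: real^'n. \<forall>i. 0 \<le> x $ i \<and> x $ i < 1}) borel torus_proj"

definition borel_prob :: "'a::topological_space measure set" where
  "borel_prob = {M. prob_space M \<and> sets M = sets borel}"

definition F :: "('n::finite) torus measure \<Rightarrow> real^'n \<Rightarrow> real" where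
  "F \<mu> P = 1 / 2 * (INF \<phi>\<in>{\<phi>. torus_C1 \<phi>}. LINT x|\<mu>. (norm (torus_grad \<phi> x + P))\<^sup>2)"

definition Fstar :: "('n::finite) torus measure \<Rightarrow> real^'n \<Rightarrow> ereal" where
  "Fstar \<mu> J = (SUP P. ereal (P \<bullet> J - F \<mu> P))"

definition \<Lambda> :: "(('n::finite) torus \<times> (real^'n)) measure set" where
  "\<Lambda> = {\<nu> \<in> borel_prob. integrable \<nu> (\<lambda>(x, p). (norm p)\<^sup>2) \<and>
        (\<forall>\<theta>. torus_C1 \<theta> \<longrightarrow> (LINT (x, p)|\<nu>. p \<bullet> torus_grad \<theta> x) = 0)}"

definition \<Lambda>_marg :: "('n::finite) torus measure \<Rightarrow> ('n torus \<times> (real^'n)) measure set" where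
  "\<Lambda>_marg \<mu> = {\<nu> \<in> \<Lambda>. distr \<nu> borel fst = \<mu>}"

definition \<Lambda>_mean :: "('n::finite) torus measure \<Rightarrow> real^'n \<Rightarrow> ('n torus \<times> (real^'n)) measure set" where
  "\<Lambda>_mean \<mu> J = {\<nu> \<in> \<Lambda>_marg \<mu>. (LINT (x, p)|\<nu>. p) = J}"

definition weak_solution ::
    "'n torus measure \<Rightarrow> real^'n \<Rightarrow> ('n torus \<times> (real^'n)) measure \<Rightarrow> bool" where
  "weak_solution \<mu> P \<nu> \<longleftrightarrow> \<nu> \<in> \<Lambda>_marg \<mu> \<and>
     (\<forall>\<xi>\<in>\<Lambda>_marg \<mu>. (LINT (x, p)|\<nu>. (norm p)\<^sup>2 / 2 - p \<bullet> P)
                    \<le> (LINT (x, p)|\<xi>. (norm p)\<^sup>2 / 2 - p \<bullet> P))"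

definition subgradient :: "('a::real_inner \<Rightarrow> real) \<Rightarrow> 'a \<Rightarrow> 'a set" where
  "subgradient f P = {J. \<forall>Q. f Q \<ge> f P + J \<bullet> (Q - P)}"

text \<open>The measure \<open>K x (dp) \<otimes> M (dx)\<close> with base \<open>M\<close> and fibres \<open>K x\<close>.\<close>

definition fibred_measure ::
    "'a::topological_space measure \<Rightarrow> ('a \<Rightarrow> 'b::topological_space measure) \<Rightarrow> ('a \<times> 'b) measure" where
  "fibred_measure M K = M \<bind> (\<lambda>x. K x \<bind> (\<lambda>p. return borel (x, p)))"

text \<open>
  The elliptic equation \<open>div (\<rho> (grad \<phi> + P)) = 0\<close> for \<open>\<phi>\<close> of class \<open>C\<^sup>1\<close>. When \<open>\<rho>\<close> is only \<open>C\<^sup>1\<close> and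
  \<open>CARD('n) \<ge> 2\<close>, the solution is \<open>C\<^sup>1\<close> but its second derivatives need not exist everywhere (the
  equation reads \<open>laplacian \<phi> = - grad (ln \<rho>) \<bullet> (grad \<phi> + P)\<close>, with a right-hand side that is merely
  continuous). Hence the divergence of the continuous field \<open>\<rho> (grad \<phi> + P)\<close> is taken in the sense
  of distributions. The pointwise equation for \<open>\<phi>\<close> of class \<open>C\<^sup>2\<close> is \<open>elliptic_C2\<close>.
\<close>

definition torus_div_free :: "(('n::finite) torus \<Rightarrow> real^'n) \<Rightarrow> bool" where
  "torus_div_free V \<longleftrightarrow> (\<forall>\<theta>. torus_C1 \<theta> \<longrightarrow> (LINT x|torus_lborel. V x \<bullet> torus_grad \<theta> x) = 0)"

definition elliptic_C1 :: "(('n::finite) torus \<Rightarrow> real) \<Rightarrow> real^'n \<Rightarrow> ('n torus \<Rightarrow> real) \<Rightarrow> bool" where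
  "elliptic_C1 \<rho> P \<phi> \<longleftrightarrow>
     torus_C1 \<phi> \<and> torus_div_free (\<lambda>x. \<rho> x *\<^sub>R (torus_grad \<phi> x + P))"

definition elliptic_C2 :: "(('n::finite) torus \<Rightarrow> real) \<Rightarrow> real^'n \<Rightarrow> ('n torus \<Rightarrow> real) \<Rightarrow> bool" where
  "elliptic_C2 \<rho> P \<phi> \<longleftrightarrow>
     torus_C2 \<phi> \<and> (\<forall>x. torus_div (\<lambda>y. \<rho> y *\<^sub>R (torus_grad \<phi> y + P)) x = 0)"

end

theory Submission
  imports Defs "HOL-Probability.Probability" "HOL-Complex_Analysis.Great_Picard"
begin

text \<open>
  Fix \<open>P\<close> and let \<open>v\<close> be the \<open>L\<^sup>2(\<mu>)\<close> limit of \<open>P + grad \<phi>\<^sub>j\<close> along a minimising sequence of \<open>F \<mu> P\<close>. The field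
  \<open>v\<close> is orthogonal to all gradients and \<open>v - P\<close> is a limit of gradients, so every \<open>\<xi>\<close> with marginal \<open>\<mu>\<close> in
  \<open>\<Lambda>\<close> satisfies
  \<open>\<integral> (|p|\<^sup>2 / 2 - p \<bullet> P) d\<xi> = 1/2 \<integral> |p - v(x)|\<^sup>2 d\<xi> - 1/2 \<integral> |v|\<^sup>2 d\<mu>\<close>.
  Hence the unique weak solution is the graph of \<open>v\<close>. The mean of \<open>v\<close> depends on \<open>P\<close> through a symmetric
  linear map \<open>A\<close> with \<open>F \<mu> P = 1/2 P \<bullet> A P\<close>, and the formula for \<open>Fstar\<close> follows by splitting \<open>J\<close> along the
  range and the kernel of \<open>A\<close>.

  For the elliptic equation put \<open>b = grad (ln \<rho>)\<close> and \<open>\<phi> = R g\<close> with \<open>R = (1 - laplacian)\<^sup>-\<^sup>1\<close> acting on continuous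
  functions. The equation becomes \<open>g - R g - b \<bullet> grad (R g) = b \<bullet> P\<close>, a compact perturbation of the identity.
  Adding the scalar \<open>(R g)(0)\<close> on the left makes it injective, so the Fredholm alternative applies, and testing
  with \<open>\<rho>\<close> shows that this scalar vanishes. With a standard Gaussian vector \<open>Z\<close>,
  \<open>R g(x) = \<integral>\<^sub>0\<^sup>\<infinity> s exp (- s\<^sup>2 / 2) E[g(x + s Z)] ds\<close> and
  \<open>grad (R g)(x) = \<integral>\<^sub>0\<^sup>\<infinity> exp (- s\<^sup>2 / 2) E[g(x + s Z) Z] ds\<close>;
  the properties of these operators are checked on trigonometric polynomials and pass to all continuous
  functions by density.
\<close>

text \<open>Since \<rho> is only of class C1, the coefficient \<open>b\<close> is merely continuous
  and second derivatives of \<phi> need not exist. Hence the work takes place in the space of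
  continuous functions, with the equation in weak form and with an explicit kernel for
  \<open>R\<close>. The kernel comes from \<open>R\<close> = \<integral> exp(-t) exp(t laplacian) dt
  with t = s^2 / 2, whence the factor s in the weight. Gaussian integration by parts gives the
  average at scale s the gradient E[g(x + s Z) Z] / s, and this division cancels that factor.
  Neither formula differentiates g, so both are bounded in the sup norm. Compactness needs more:
  E[g(x + s Z) Z] is Lipschitz in x with a constant of order 1 / s, which is not integrable near 0.
  So grad (R g) is shown to be equicontinuous rather than Lipschitz. The scalar is forced by the
  constants: \<open>R\<close> fixes them, so g - R g - b \<bullet> grad (R g) vanishes on them.
  Dually, \<rho> is orthogonal to the range of this operator and to b \<bullet> P, because \<rho> b
  = grad \<rho>; this is why testing with \<rho> isolates the scalar.\<close>

section \<open>Fredholm alternative\<close>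

text \<open>If \<open>S = id - T\<close> is not onto, the ranges of the powers of \<open>S\<close> decrease strictly, and Riesz's lemma yields
  unit vectors whose images under \<open>T\<close> are mutually at distance at least \<open>1/2\<close>.\<close>

lemma fredholm_injective_imp_surjective:
  fixes T :: "'a::real_normed_vector \<Rightarrow> 'a"
  assumes lin: "bounded_linear T"
    and compact: "\<And>x::nat \<Rightarrow> 'a. (\<And>n. norm (x n) \<le> 1) \<Longrightarrow>
          \<exists>l r. strict_mono (r::nat \<Rightarrow> nat) \<and> (\<lambda>n. T (x (r n))) \<longlonglongrightarrow> l"
    and inj: "\<And>x. T x = x \<Longrightarrow> x = 0"
  shows "\<exists>x. x - T x = y"
proof (rule ccontr)
  assume not_surj: "\<nexists>x. x - T x = y"
  interpret T: bounded_linear T by (fact lin)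
  define S where "S x = x - T x" for x
  have S: "bounded_linear S"
    unfolding S_def by (intro bounded_linear_sub bounded_linear_ident lin)
  interpret S: bounded_linear S by (fact S)
  have S0: "x = 0" if "S x = 0" for x using inj[of x] that by (simp add: S_def)
  have injS: "x = z" if "S x = S z" for x z
    using S0[of "x - z"] that by (simp add: S.diff)

  \<comment> \<open>Otherwise there are unit vectors \<open>u n\<close> with \<open>S (u n)\<close>
    tending to 0. Along a subsequence \<open>T (u n)\<close> converges, hence so does
    \<open>u n = S (u n) + T (u n)\<close>, and its limit is a unit vector in the kernel of
    \<open>S\<close>.\<close>
  have "\<exists>c>0. \<forall>x. c * norm x \<le> norm (S x)"
  proof (rule ccontr)
    assume "\<not> ?thesis"
    then have "\<exists>x. norm (S x) < inverse (Suc n) * norm x" for n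
      by (metis inverse_positive_iff_positive not_le of_nat_0_less_iff zero_less_Suc)
    then obtain x where x: "norm (S (x n)) < inverse (Suc n) * norm (x n)" for n by metis
    define u where "u n = x n /\<^sub>R norm (x n)" for n
    have nz: "norm (x n) > 0" for n using x[of n] by (cases "x n = 0") (auto simp: S.zero)
    have u1: "norm (u n) = 1" for n using nz[of n] by (simp add: u_def)
    have Su: "norm (S (u n)) \<le> inverse (Suc n)" for n
      using x[of n] nz[of n] by (simp add: u_def S.scaleR field_simps)
    have Su0: "(\<lambda>n. S (u n)) \<longlonglongrightarrow> 0"
      by (rule Lim_null_comparison[OF _ LIMSEQ_inverse_real_of_nat]) (use Su in auto)
    obtain l r where r: "strict_mono (r::nat\<Rightarrow>nat)" and l: "(\<lambda>n. T (u (r n))) \<longlonglongrightarrow> l"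
      using compact[of u] u1 by auto
    have "(\<lambda>n. S (u (r n)) + T (u (r n))) \<longlonglongrightarrow> 0 + l"
      using LIMSEQ_subseq_LIMSEQ[OF Su0 r] l by (intro tendsto_add) (auto simp: o_def)
    then have ul: "(\<lambda>n. u (r n)) \<longlonglongrightarrow> l" by (simp add: S_def)
    then have "(\<lambda>n. norm (u (r n))) \<longlonglongrightarrow> norm l" by (rule tendsto_norm)
    then have "norm l = 1" using u1 by (simp add: LIMSEQ_const_iff)
    moreover have "(\<lambda>n. S (u (r n))) \<longlonglongrightarrow> S l" by (rule S.tendsto[OF ul])
    then have "S l = 0"
      using LIMSEQ_subseq_LIMSEQ[OF Su0 r] by (auto simp: o_def intro: LIMSEQ_unique)
    ultimately show False using S0[of l] by simp
  qed
  then obtain c where c: "c > 0" "\<And>x. c * norm x \<le> norm (S x)" by blast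

  \<comment> \<open>The lower bound keeps the preimages of a convergent sequence bounded, so
    compactness of \<open>T\<close> and \<open>x = S x + T x\<close> make them converge along a
    subsequence.\<close>
  have closed_image: "closed (S ` Y)" if Y: "closed Y" for Y
    unfolding closed_sequential_limits
  proof (intro allI impI, elim conjE)
    fix f z assume f: "\<forall>n. f n \<in> S ` Y" and fz: "f \<longlonglongrightarrow> z"
    from f obtain x where x: "\<And>n. x n \<in> Y" "\<And>n. f n = S (x n)" 
      unfolding image_iff by metis
    obtain B where B: "B > 0" "\<And>n. norm (f n) \<le> B"
      using convergent_imp_Bseq[OF convergentI[OF fz]] by (auto elim: BseqE)
    define M where "M = B / c"
    have M: "M > 0" "norm (x n) \<le> M" for n
      using c(1) B(1) order_trans[OF c(2)[of "x n"] B(2)[of n, unfolded x(2)]]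
      by (auto simp: M_def field_simps)
    obtain l r where r: "strict_mono (r::nat\<Rightarrow>nat)"
      and l: "(\<lambda>n. T (x (r n) /\<^sub>R M)) \<longlonglongrightarrow> l"
      using compact[of "\<lambda>n. x n /\<^sub>R M"] M by (auto simp: field_simps)
    have "(\<lambda>n. M *\<^sub>R T (x (r n) /\<^sub>R M)) \<longlonglongrightarrow> M *\<^sub>R l" by (intro tendsto_intros l)
    then have "(\<lambda>n. T (x (r n))) \<longlonglongrightarrow> M *\<^sub>R l" using M(1) by (simp add: T.scaleR)
    moreover have "(\<lambda>n. S (x (r n))) \<longlonglongrightarrow> z"
      using LIMSEQ_subseq_LIMSEQ[OF fz r] by (simp add: o_def x(2))
    ultimately have "(\<lambda>n. S (x (r n)) + T (x (r n))) \<longlonglongrightarrow> z + M *\<^sub>R l" by (rule tendsto_add[rotated])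
    then have lim: "(\<lambda>n. x (r n)) \<longlonglongrightarrow> z + M *\<^sub>R l" by (simp add: S_def)
    have "z + M *\<^sub>R l \<in> Y" using closed_sequentially[OF Y _ lim] x(1) by auto
    moreover have "S (z + M *\<^sub>R l) = z"
      using S.tendsto[OF lim] \<open>(\<lambda>n. S (x (r n))) \<longlonglongrightarrow> z\<close> LIMSEQ_unique by blast
    ultimately show "z \<in> S ` Y" by force
  qed

  define Y where "Y k = (S ^^ k) ` UNIV" for k
  have Y_Suc: "Y (Suc k) = S ` Y k" for k by (simp add: Y_def image_comp)
  have clY: "closed (Y k)" for k
    by (induction k) (simp_all add: Y_Suc closed_image, simp add: Y_def)
  have subY: "subspace (Y k)" for k
    by (induction k)
      (simp_all add: Y_Suc linear_subspace_image S.linear, simp add: Y_def)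
  have decr: "Y (Suc k) \<subseteq> Y k" for k
    by (induction k) (auto simp: Y_Suc, auto simp: Y_def)
  have mono: "Y n \<subseteq> Y m" if "m \<le> n" for m n
    using that decr by (rule_tac lift_Suc_antimono_le[of Y]) auto
  have injk: "x = z" if "(S ^^ k) x = (S ^^ k) z" for k x z
    using that by (induction k) (auto dest: injS)
  \<comment> \<open>Cancelling the injective \<open>S ^^ k\<close> would put \<open>y\<close> into
    the range of \<open>S\<close>.\<close>
  have strict: "(S ^^ k) y \<notin> Y (Suc k)" for k
  proof
    assume "(S ^^ k) y \<in> Y (Suc k)"
    then obtain w where "(S ^^ k) y = (S ^^ Suc k) w" by (auto simp: Y_def)
    then have "(S ^^ k) y = (S ^^ k) (S w)" by (simp add: funpow_swap1)
    then show False using injk[of k y "S w"] not_surj by (auto simp: S_def)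
  qed

  have "\<exists>x. x \<in> Y k \<and> norm x = 1 \<and> (\<forall>z\<in>Y (Suc k). 1/2 \<le> norm (x - z))" for k
  proof -
    let ?u = "(S ^^ k) y"
    have ne: "Y (Suc k) \<noteq> {}" by (simp add: Y_def)
    have uY: "?u \<in> Y k" by (simp add: Y_def)
    define d where "d = infdist ?u (Y (Suc k))"
    have d: "d > 0"
      using strict[of k] clY[of "Suc k"] ne infdist_nonneg[of ?u "Y (Suc k)"]
      unfolding d_def by (metis in_closed_iff_infdist_zero less_le)
    \<comment> \<open>A point within twice the distance exists because \<open>d > 0\<close>; this
      factor 2 becomes the separation 1/2 after normalisation.\<close>
    have "\<exists>z\<in>Y (Suc k). dist ?u z < 2 * d"
    proof (rule ccontr)
      assume "\<not> ?thesis"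
      then have "2 * d \<le> infdist ?u (Y (Suc k))"
        using ne by (auto simp: infdist_def intro!: cINF_greatest)
      then show False using d by (simp add: d_def)
    qed
    then obtain z where z: "z \<in> Y (Suc k)" "dist ?u z < 2 * d" by blast
    define N where "N = norm (?u - z)"
    have N: "N > 0" "N < 2 * d" using z strict[of k] by (auto simp: N_def dist_norm)
    define x where "x = (?u - z) /\<^sub>R N"
    have "x \<in> Y k"
      unfolding x_def using uY z(1) decr subY[of k] by (intro subspace_scale subspace_diff) auto
    moreover have "norm x = 1" using N by (simp add: x_def N_def)
    moreover have "1/2 \<le> norm (x - w)" if w: "w \<in> Y (Suc k)" for w
    proof -
      have "z + N *\<^sub>R w \<in> Y (Suc k)" by (intro subspace_add subspace_scale subY z w)
      then have "d \<le> dist ?u (z + N *\<^sub>R w)" unfolding d_def by (rule infdist_le)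
      also have "?u - (z + N *\<^sub>R w) = N *\<^sub>R (x - w)"
        using N by (simp add: x_def algebra_simps)
      then have "dist ?u (z + N *\<^sub>R w) = N * norm (x - w)" using N by (simp add: dist_norm)
      also have "\<dots> \<le> 2 * d * norm (x - w)" using N by (intro mult_right_mono) auto
      finally show ?thesis using d by simp
    qed
    ultimately show ?thesis by blast
  qed
  then obtain x where x: "\<And>k. x k \<in> Y k" "\<And>k. norm (x k) = 1"
    "\<And>k z. z \<in> Y (Suc k) \<Longrightarrow> 1/2 \<le> norm (x k - z)" by metis
  \<comment> \<open>The difference is \<open>x n\<close> minus
    \<open>S (x n) + x m - S (x m)\<close>, and the subtracted vector lies in
    \<open>Y (Suc n)\<close>.\<close>
  have sep: "1/2 \<le> norm (T (x n) - T (x m))" if "n < m" for n m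
  proof -
    have "x m \<in> Y (Suc n)" using x(1)[of m] mono[of "Suc n" m] that by auto
    moreover have "S (x m) \<in> Y (Suc n)" using \<open>x m \<in> Y (Suc n)\<close> decr by (metis Y_Suc imageI subsetD)
    moreover have "S (x n) \<in> Y (Suc n)" using x(1)[of n] by (simp add: Y_Suc)
    ultimately have "S (x n) + x m - S (x m) \<in> Y (Suc n)"
      by (intro subspace_add subspace_diff subY)
    from x(3)[OF this] show ?thesis by (simp add: S_def)
  qed
  obtain l r where r: "strict_mono (r::nat\<Rightarrow>nat)" and l: "(\<lambda>n. T (x (r n))) \<longlonglongrightarrow> l"
    using compact[of x] x(2) by auto
  obtain N where "\<And>m n. m \<ge> N \<Longrightarrow> n \<ge> N \<Longrightarrow> dist (T (x (r m))) (T (x (r n))) < 1/2"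
    using metric_CauchyD[OF LIMSEQ_imp_Cauchy[OF l], of "1/2"] by auto
  from this[of N "Suc N"] sep[of "r N" "r (Suc N)"] show False
    using r by (simp add: strict_mono_def dist_norm)
qed

section \<open>The torus and trigonometric polynomials\<close>

lemma torus_proj_rep [simp]: "torus_proj (rep_torus x) = x"
  by (rule Quotient_abs_rep[OF Quotient_torus])

lemma rep_torus_proj_diff: "rep_torus (torus_proj y) $ i - y $ i \<in> \<int>"
proof -
  have "torus_proj (rep_torus (torus_proj y)) = torus_proj y" by simp
  then show ?thesis unfolding torus_proj_eq_iff by blast
qed

lemma torus_proj_add_lattice: "(\<And>i. k $ i \<in> \<int>) \<Longrightarrow> torus_proj (y + k) = torus_proj y"
  by (simp add: torus_proj_eq_iff)

text \<open>The preimage of the image is the union of all lattice translates of \<open>U\<close>.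
  Openness of the projection carries a countable basis over to the torus.\<close>

lemma open_image_torus_proj:
  fixes U :: "(real^'n::finite) set"
  assumes "open U"
  shows "open (torus_proj ` U)"
proof -
  have "torus_proj -` (torus_proj ` U) = (\<Union>k\<in>{k. \<forall>i. k $ i \<in> \<int>}. (+) k ` U)" (is "?A = ?B")
  proof
    show "?A \<subseteq> ?B"
    proof
      fix y assume "y \<in> ?A"
      then obtain u where u: "u \<in> U" "torus_proj y = torus_proj u" by auto
      then have "\<forall>i. (y - u) $ i \<in> \<int>" by (simp add: torus_proj_eq_iff)
      moreover have "y = (y - u) + u" by simp
      ultimately show "y \<in> ?B" using u(1) by blast
    qed
    show "?B \<subseteq> ?A"
    proof clarsimp
      fix k u :: "real^'n" assume "u \<in> U" "\<forall>i. k $ i \<in> \<int>"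
      then show "torus_proj (k + u) \<in> torus_proj ` U"
        using torus_proj_add_lattice[of k u] by (simp add: add.commute)
    qed
  qed
  moreover have "open ?B" using assms by (intro open_UN ballI open_translation)
  ultimately show ?thesis by (simp add: open_torus_def)
qed

lemma continuous_on_torus_iff:
  fixes f :: "'n::finite torus \<Rightarrow> 'b::topological_space"
  shows "continuous_on UNIV f \<longleftrightarrow> continuous_on UNIV (\<lambda>y. f (torus_proj y))"
  by (simp add: continuous_on_open_vimage open_torus_def vimage_def)

lemma cos_torus_rep:
  fixes k :: "real^'n::finite"
  assumes "\<And>i. k $ i \<in> \<int>"
  shows "cos (2 * pi * (k \<bullet> rep_torus (torus_proj y)) + a) = cos (2 * pi * (k \<bullet> y) + a)"
proof -
  have "k \<bullet> (rep_torus (torus_proj y) - y) \<in> \<int>"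
    unfolding inner_vec_def using assms rep_torus_proj_diff[of y]
    by (intro Ints_sum) (auto simp: inner_real_def intro!: Ints_mult)
  then obtain n :: int where "k \<bullet> (rep_torus (torus_proj y) - y) = n" by (auto elim: Ints_cases)
  then have "2 * pi * (k \<bullet> rep_torus (torus_proj y)) + a = (2 * pi * (k \<bullet> y) + a) + 2 * pi * n"
    by (simp add: inner_diff_right algebra_simps)
  then show ?thesis using sin_cos_eq_iff by blast
qed

text \<open>The phase \<open>a\<close> treats sine and cosine alike, and differentiation becomes a
  shift of \<open>a\<close> by \<open>pi / 2\<close>. Only for integer \<open>k\<close> is the value
  independent of the representative.\<close>

definition torus_wave :: "real^'n \<Rightarrow> real \<Rightarrow> 'n::finite torus \<Rightarrow> real" where
  "torus_wave k a x = cos (2 * pi * (k \<bullet> rep_torus x) + a)"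

lemma torus_wave_proj:
  "(\<And>i. k $ i \<in> \<int>) \<Longrightarrow> torus_wave k a (torus_proj y) = cos (2 * pi * (k \<bullet> y) + a)"
  unfolding torus_wave_def by (rule cos_torus_rep)

lemma continuous_torus_wave:
  assumes "\<And>i. k $ i \<in> \<int>"
  shows "continuous_on UNIV (torus_wave k a)"
  unfolding continuous_on_torus_iff torus_wave_proj[OF assms] by (intro continuous_intros)

text \<open>For the frequency \<open>axis i 1\<close>, the phases 0 and \<open>- pi / 2\<close> give
  the cosine and the sine of 2 pi times the i-th coordinate, which together determine it modulo 1.
  Both the Hausdorff property and Stone-Weierstrass rest on this.\<close>

lemma torus_wave_separates:
  fixes x y :: "'n::finite torus"
  assumes "x \<noteq> y"
  obtains k a where "\<And>i. k $ i \<in> \<int>" "torus_wave k a x \<noteq> torus_wave k a y"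
proof -
  obtain i where i: "rep_torus x $ i - rep_torus y $ i \<notin> \<int>"
    using assms torus_proj_eq_iff[of "rep_torus x" "rep_torus y"] by auto
  let ?k = "axis i 1 :: real^'n"
  have k: "?k $ j \<in> \<int>" for j by (simp add: axis_def)
  have "torus_wave ?k 0 x \<noteq> torus_wave ?k 0 y \<or> torus_wave ?k (- pi / 2) x \<noteq> torus_wave ?k (- pi / 2) y"
  proof (rule ccontr)
    assume "\<not> ?thesis"
    then have "cos (2 * pi * rep_torus x $ i) = cos (2 * pi * rep_torus y $ i)"
      "sin (2 * pi * rep_torus x $ i) = sin (2 * pi * rep_torus y $ i)"
      by (simp_all add: torus_wave_def inner_axis' cos_add cos_diff)
    then obtain n :: int where "2 * pi * rep_torus x $ i = 2 * pi * rep_torus y $ i + 2 * pi * n"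
      using sin_cos_eq_iff by metis
    then have "2 * pi * (rep_torus x $ i - rep_torus y $ i) = 2 * pi * n" by (simp add: algebra_simps)
    then have "rep_torus x $ i - rep_torus y $ i = n" by simp
    then show False using i by simp
  qed
  then show thesis using that k by blast
qed

instance torus :: (finite) t2_space
proof
  fix x y :: "'a torus" assume "x \<noteq> y"
  then obtain k a where k: "\<And>i. k $ i \<in> \<int>" "torus_wave k a x \<noteq> torus_wave k a y"
    using torus_wave_separates by blast
  obtain U V where UV: "open U" "open V" "torus_wave k a x \<in> U" "torus_wave k a y \<in> V" "U \<inter> V = {}"
    using hausdorff[OF k(2)] by blast
  have "open (torus_wave k a -` U)" "open (torus_wave k a -` V)"
    using continuous_torus_wave[OF k(1), of a] UV(1,2) by (simp_all add: continuous_on_open_vimage)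
  then show "\<exists>U V. open U \<and> open V \<and> x \<in> U \<and> y \<in> V \<and> U \<inter> V = {}"
    using UV(3-5) by (intro exI[of _ "torus_wave k a -` U"] exI[of _ "torus_wave k a -` V"]) auto
qed

text \<open>This sort makes the Borel sets of the product with \<open>real^'n\<close> the product
  sigma-algebra, which is how graph maps are seen to be measurable.\<close>

instance torus :: (finite) second_countable_topology
proof
  obtain B :: "(real^'a) set set" where B: "countable B" "topological_basis B"
    using ex_countable_basis by blast
  have "topological_basis ((`) torus_proj ` B)"
  proof (rule topological_basisI)
    fix U assume "U \<in> (`) torus_proj ` B"
    then show "open U" using B(2) by (auto intro!: open_image_torus_proj topological_basis_open)
  next
    fix U :: "'a torus set" and x assume U: "open U" "x \<in> U"
    then have "open (torus_proj -` U)" "rep_torus x \<in> torus_proj -` U"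
      by (simp_all add: open_torus_def)
    then obtain W where "W \<in> B" "rep_torus x \<in> W" "W \<subseteq> torus_proj -` U"
      using topological_basisE[OF B(2)] by metis
    then show "\<exists>B'\<in>(`) torus_proj ` B. x \<in> B' \<and> B' \<subseteq> U"
      by (intro bexI[of _ "torus_proj ` W"]) (auto intro: image_eqI[of _ _ "rep_torus x"])
  qed
  then show "\<exists>B::'a torus set set. countable B \<and> open = generate_topology B"
    using B(1) by (intro exI[of _ "(`) torus_proj ` B"]) (simp add: topological_basis_imp_subbasis)
qed

definition unit_cell :: "(real^'n::finite) set" where
  "unit_cell = {x. \<forall>i. 0 \<le> x $ i \<and> x $ i < 1}"

lemma unit_cell_representative:
  fixes y :: "real^'n::finite"
  obtains z where "z \<in> unit_cell" "torus_proj z = torus_proj y"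
proof
  let ?z = "\<chi> i. frac (y $ i)"
  show "?z \<in> unit_cell" by (simp add: unit_cell_def frac_lt_1)
  show "torus_proj ?z = torus_proj y"
    by (simp add: torus_proj_eq_iff frac_def)
qed

lemma torus_proj_cube: "torus_proj ` cbox 0 1 = (UNIV :: 'n::finite torus set)"
proof -
  have "x \<in> torus_proj ` cbox 0 1" for x :: "'n torus"
  proof -
    obtain z :: "real^'n" where z: "z \<in> unit_cell" "torus_proj z = torus_proj (rep_torus x)"
      using unit_cell_representative by blast
    have "z \<in> cbox 0 1" using z(1) by (auto simp: unit_cell_def mem_box_cart less_imp_le)
    then show ?thesis using z(2) by (metis imageI torus_proj_rep)
  qed
  then show ?thesis by blast
qed

lemma compact_torus: "compact (UNIV :: 'n::finite torus set)"
  by (metis torus_proj_cube compact_continuous_image continuous_on_subset continuous_torus_proj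
      compact_cbox top_greatest)

lemma torus_continuous_bounded:
  fixes f :: "'n::finite torus \<Rightarrow> 'b::real_normed_vector"
  assumes "continuous_on UNIV f"
  shows "\<exists>B>0. \<forall>x. norm (f x) \<le> B"
proof -
  have "bounded (range f)"
    by (rule compact_imp_bounded[OF compact_continuous_image[OF assms compact_torus]])
  then show ?thesis unfolding bounded_pos by blast
qed

text \<open>With scaled waves and sums as the only rules, a linear identity has to be verified on a
  single wave only. Constants are waves of frequency 0, and products reduce to sums.\<close>

inductive trig_poly :: "('n::finite torus \<Rightarrow> real) \<Rightarrow> bool" where
  wave: "(\<And>i. k $ i \<in> \<int>) \<Longrightarrow> trig_poly (\<lambda>x. c * torus_wave k a x)"
| add: "trig_poly f \<Longrightarrow> trig_poly g \<Longrightarrow> trig_poly (\<lambda>x. f x + g x)"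

text \<open>The product-to-sum formula for two cosines.\<close>

lemma trig_poly_wave_mult:
  assumes "\<And>i. k $ i \<in> \<int>" "\<And>i. l $ i \<in> \<int>"
  shows "trig_poly (\<lambda>x. (c * torus_wave k a x) * (d * torus_wave l b x))"
proof -
  have "trig_poly (\<lambda>x. c * d / 2 * torus_wave (k - l) (a - b) x + c * d / 2 * torus_wave (k + l) (a + b) x)"
    using assms by (intro trig_poly.add trig_poly.wave) auto
  also have "(\<lambda>x. c * d / 2 * torus_wave (k - l) (a - b) x + c * d / 2 * torus_wave (k + l) (a + b) x) =
      (\<lambda>x. (c * torus_wave k a x) * (d * torus_wave l b x))"
    by (intro ext)
      (simp add: torus_wave_def inner_diff_left inner_add_left cos_add cos_diff algebra_simps sin_add sin_diff)
  finally show ?thesis .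
qed

lemma trig_poly_mult:
  assumes f: "trig_poly f" and g: "trig_poly g"
  shows "trig_poly (\<lambda>x. f x * g x)"
  using f
proof induction
  case (wave k c a)
  note k = this
  from g show ?case
  proof induction
    case (wave l d b)
    then show ?case using trig_poly_wave_mult[of k l c a d b] k by blast
  next
    case (add f g)
    from trig_poly.add[OF add.IH] show ?case by (simp add: algebra_simps)
  qed
next
  case (add f1 f2)
  from trig_poly.add[OF add.IH] show ?case by (simp add: algebra_simps)
qed

lemma trig_poly_const: "trig_poly (\<lambda>_. c)"
  using trig_poly.wave[of 0 c 0] by (simp add: torus_wave_def)

lemma trig_poly_continuous: "trig_poly f \<Longrightarrow> continuous_on UNIV f"
  by (induction rule: trig_poly.induct) (auto intro!: continuous_intros continuous_torus_wave)

lemma trig_poly_dense: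
  fixes f :: "'n::finite torus \<Rightarrow> real"
  assumes "continuous_on UNIV f"
  obtains g where "\<And>j. trig_poly (g j)" "uniform_limit UNIV g f sequentially"
proof -
  interpret function_ring_on "{f. trig_poly f}" "UNIV :: 'n torus set"
  proof
    fix x y :: "'n torus" assume "x \<noteq> y"
    then obtain k a where k: "\<And>i. k $ i \<in> \<int>" "torus_wave k a x \<noteq> torus_wave k a y"
      using torus_wave_separates by blast
    have "trig_poly (\<lambda>x. 1 * torus_wave k a x)" by (intro trig_poly.wave k)
    then show "\<exists>f\<in>{f. trig_poly f}. f x \<noteq> f y" using k(2) by auto
  qed (auto simp: compact_torus trig_poly_continuous trig_poly_const
      intro: trig_poly.add trig_poly_mult)
  show thesis using Stone_Weierstrass[OF assms] that by auto
qed

section \<open>Calculus and integration on the torus\<close>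

lemma torus_C1_GDERIV:
  assumes "torus_C1 f"
  shows "GDERIV (\<lambda>y. f (torus_proj y)) y :> torus_grad f (torus_proj y)"
proof -
  obtain g where "\<And>x. has_torus_grad f x (g x)" using assms by (auto simp: torus_C1_def)
  then have "has_torus_grad f (torus_proj y) (torus_grad f (torus_proj y))"
    using torus_grad_eq by metis
  then show ?thesis by (simp add: has_torus_grad_def o_def)
qed

lemma torus_C1_grad_continuous:
  assumes "torus_C1 f"
  shows "continuous_on UNIV (torus_grad f)"
proof -
  obtain g where g: "continuous_on UNIV g" "\<And>x. has_torus_grad f x (g x)"
    using assms by (auto simp: torus_C1_def)
  then have "torus_grad f = g" by (intro ext torus_grad_eq)
  then show ?thesis using g by simp
qed

lemma
  assumes "\<And>y. GDERIV (\<lambda>y. f (torus_proj y)) y :> g (torus_proj y)"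
  shows torus_gradI: "torus_grad f x = g x"
    and torus_C1I: "continuous_on UNIV g \<Longrightarrow> torus_C1 f"
proof -
  have "has_torus_grad f x (g x)" for x
    using assms by (auto simp: has_torus_grad_def o_def)
  then show "torus_grad f x = g x" "continuous_on UNIV g \<Longrightarrow> torus_C1 f"
    by (auto simp: torus_C1_def intro: torus_grad_eq)
qed

lemma torus_C1_continuous:
  assumes "torus_C1 f"
  shows "continuous_on UNIV f"
  unfolding continuous_on_torus_iff
  using torus_C1_GDERIV[OF assms] gderiv_def has_derivative_continuous
  by (auto simp: continuous_on_eq_continuous_at gderiv_def intro: has_derivative_continuous)

lemma
  assumes "torus_C1 f" "torus_C1 g"
  shows torus_C1_add: "torus_C1 (\<lambda>x. f x + g x)"
    and torus_grad_add: "torus_grad (\<lambda>x. f x + g x) x = torus_grad f x + torus_grad g x"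
proof -
  have *: "GDERIV (\<lambda>y. f (torus_proj y) + g (torus_proj y)) y :>
      torus_grad f (torus_proj y) + torus_grad g (torus_proj y)" for y
    by (intro GDERIV_add torus_C1_GDERIV assms)
  show "torus_C1 (\<lambda>x. f x + g x)"
    by (rule torus_C1I[OF *]) (intro continuous_intros torus_C1_grad_continuous assms)
  show "torus_grad (\<lambda>x. f x + g x) x = torus_grad f x + torus_grad g x"
    by (rule torus_gradI[OF *])
qed

lemma
  assumes "torus_C1 f" "torus_C1 g"
  shows torus_C1_mult: "torus_C1 (\<lambda>x. f x * g x)"
    and torus_grad_mult: "torus_grad (\<lambda>x. f x * g x) x = f x *\<^sub>R torus_grad g x + g x *\<^sub>R torus_grad f x"
proof -
  have *: "GDERIV (\<lambda>y. f (torus_proj y) * g (torus_proj y)) y :>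
      f (torus_proj y) *\<^sub>R torus_grad g (torus_proj y) + g (torus_proj y) *\<^sub>R torus_grad f (torus_proj y)" for y
    by (intro GDERIV_mult torus_C1_GDERIV assms)
  show "torus_C1 (\<lambda>x. f x * g x)"
    by (rule torus_C1I[OF *])
      (intro continuous_intros torus_C1_grad_continuous torus_C1_continuous assms)
  show "torus_grad (\<lambda>x. f x * g x) x = f x *\<^sub>R torus_grad g x + g x *\<^sub>R torus_grad f x"
    by (rule torus_gradI[OF *])
qed

lemma torus_C1_const: "torus_C1 (\<lambda>_. c)"
  and torus_grad_const: "torus_grad (\<lambda>_. c) x = 0"
proof -
  have *: "GDERIV (\<lambda>y. c) y :> (\<lambda>_. 0) (torus_proj y)" for y by (simp add: GDERIV_const)
  show "torus_C1 (\<lambda>_. c)" by (rule torus_C1I[OF *]) simp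
  show "torus_grad (\<lambda>_. c) x = 0" by (rule torus_gradI[OF *])
qed

lemma
  assumes "torus_C1 f"
  shows torus_C1_cmult: "torus_C1 (\<lambda>x. c * f x)"
    and torus_grad_cmult: "torus_grad (\<lambda>x. c * f x) x = c *\<^sub>R torus_grad f x"
  using torus_C1_mult[OF torus_C1_const assms] torus_grad_mult[OF torus_C1_const assms]
  by (simp_all add: torus_grad_const)

lemma
  assumes "torus_C1 f" "torus_C1 g"
  shows torus_C1_diff: "torus_C1 (\<lambda>x. f x - g x)"
    and torus_grad_diff: "torus_grad (\<lambda>x. f x - g x) x = torus_grad f x - torus_grad g x"
  using torus_C1_add[OF assms(1) torus_C1_cmult[OF assms(2), of "-1"]]
    torus_grad_add[OF assms(1) torus_C1_cmult[OF assms(2), of "-1"], unfolded torus_grad_cmult[OF assms(2)]]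
  by simp_all

lemma
  fixes k :: "real^'n::finite"
  assumes k: "\<And>i. k $ i \<in> \<int>"
  shows torus_C1_wave: "torus_C1 (torus_wave k a)"
    and torus_grad_wave: "torus_grad (torus_wave k a) x = (2 * pi * torus_wave k (a + pi / 2) x) *\<^sub>R k"
proof -
  have *: "GDERIV (\<lambda>y. torus_wave k a (torus_proj y)) y :>
      (2 * pi * torus_wave k (a + pi / 2) (torus_proj y)) *\<^sub>R k" for y
  proof -
    have "((\<lambda>y. cos (2 * pi * (k \<bullet> y) + a)) has_derivative
        (\<lambda>h. - sin (2 * pi * (k \<bullet> y) + a) * (2 * pi * (k \<bullet> h)))) (at y)"
      by (auto intro!: derivative_eq_intros)
    moreover have "- sin (2 * pi * (k \<bullet> y) + a) * (2 * pi * (k \<bullet> h)) =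
        h \<bullet> (2 * pi * cos (2 * pi * (k \<bullet> y) + (a + pi / 2))) *\<^sub>R k" for h
      using cos_add[of "2 * pi * (k \<bullet> y) + a" "pi / 2"] by (simp add: inner_commute add.assoc)
    ultimately show ?thesis by (simp only: torus_wave_proj[OF k] gderiv_def)
  qed
  show "torus_C1 (torus_wave k a)"
    by (rule torus_C1I[OF *]) (intro continuous_intros continuous_torus_wave k)
  show "torus_grad (torus_wave k a) x = (2 * pi * torus_wave k (a + pi / 2) x) *\<^sub>R k"
    by (rule torus_gradI[OF *])
qed

lemma trig_poly_C1: "trig_poly f \<Longrightarrow> torus_C1 f"
  by (induction rule: trig_poly.induct) (auto intro: torus_C1_add torus_C1_cmult torus_C1_wave)

lemma GDERIV_lipschitz:
  fixes f :: "'a::euclidean_space \<Rightarrow> real"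
  assumes f: "\<And>y. GDERIV f y :> g y" and B: "\<And>y. norm (g y) \<le> B"
  shows "\<bar>f y - f z\<bar> \<le> B * norm (y - z)"
proof -
  have "norm (f y - f z) \<le> B * norm (y - z)"
  proof (rule differentiable_bound[OF convex_UNIV])
    fix x
    show "(f has_derivative (\<lambda>h. h \<bullet> g x)) (at x within UNIV)"
      using f by (simp add: gderiv_def)
    show "onorm (\<lambda>h. h \<bullet> g x) \<le> B"
    proof (rule onorm_le)
      fix h
      have "norm (h \<bullet> g x) \<le> norm h * norm (g x)" using Cauchy_Schwarz_ineq2 by simp
      also have "\<dots> \<le> norm h * B" by (intro mult_left_mono B) auto
      finally show "norm (h \<bullet> g x) \<le> B * norm h" by (simp add: mult.commute)
    qed
  qed auto
  then show ?thesis by simp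
qed

lemma torus_C1_lipschitz:
  assumes "torus_C1 f" "\<And>x. norm (torus_grad f x) \<le> B"
  shows "\<bar>f (torus_proj y) - f (torus_proj z)\<bar> \<le> B * norm (y - z)"
  by (rule GDERIV_lipschitz[OF torus_C1_GDERIV]) (rule assms)+

lemma torus_C1_grad_zero_imp_const:
  assumes f: "torus_C1 f" and 0: "\<And>x. torus_grad f x = 0"
  obtains c where "\<And>x. f x = c"
proof (rule that)
  fix x
  show "f x = f (torus_proj 0)"
    using torus_C1_lipschitz[OF f, of 0 "rep_torus x" 0] 0 by simp
qed

section \<open>Lebesgue measure on the torus and integration of gradients\<close>

lemma unit_cell_measurable [measurable]: "unit_cell \<in> sets borel"
proof -
  have "unit_cell = (\<Inter>i. {x :: real^'a. 0 \<le> x $ i} \<inter> {x. x $ i < 1})"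
    by (auto simp: unit_cell_def)
  also have "\<dots> \<in> sets borel" by measurable
  finally show ?thesis .
qed

lemma box_subset_unit_cell: "box 0 1 \<subseteq> (unit_cell :: (real^'n::finite) set)"
  and unit_cell_subset_cbox: "(unit_cell :: (real^'n::finite) set) \<subseteq> cbox 0 1"
  by (auto simp: unit_cell_def mem_box_cart less_imp_le)

lemma emeasure_unit_cell: "emeasure lborel (unit_cell :: (real^'n::finite) set) = 1"
proof (rule antisym)
  have p: "(\<Prod>b\<in>Basis. (1 - 0 :: real^'n) \<bullet> b) = 1"
    by (rule prod.neutral) (auto simp: Basis_vec_def inner_axis)
  have "emeasure lborel (unit_cell :: (real^'n) set) \<le> emeasure lborel (cbox 0 1 :: (real^'n) set)"
    by (intro emeasure_mono unit_cell_subset_cbox) auto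
  also have "\<dots> = 1"
    using p by (subst emeasure_lborel_cbox) (auto simp: Basis_vec_def inner_axis)
  finally show "emeasure lborel (unit_cell :: (real^'n) set) \<le> 1" .
  have "1 = emeasure lborel (box 0 1 :: (real^'n) set)"
    using p by (subst emeasure_lborel_box) (auto simp: Basis_vec_def inner_axis)
  also have "\<dots> \<le> emeasure lborel (unit_cell :: (real^'n) set)"
    by (intro emeasure_mono box_subset_unit_cell) auto
  finally show "1 \<le> emeasure lborel (unit_cell :: (real^'n) set)" .
qed

lemma torus_lborel_eq: "torus_lborel = distr (restrict_space lborel unit_cell) borel torus_proj"
  by (simp add: torus_lborel_def unit_cell_def)

lemma torus_proj_measurable [measurable]: "torus_proj \<in> borel \<rightarrow>\<^sub>M borel"
  by (rule borel_measurable_continuous_onI[OF continuous_torus_proj])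

lemma torus_proj_measurable_cell [measurable]:
  "torus_proj \<in> restrict_space lborel unit_cell \<rightarrow>\<^sub>M borel"
  by (rule measurable_restrict_space1) simp

lemma sets_torus_lborel [simp, measurable_cong]: "sets torus_lborel = sets borel"
  by (simp add: torus_lborel_eq)

lemma space_torus_lborel [simp]: "space torus_lborel = UNIV"
  by (simp add: torus_lborel_eq)

lemma prob_space_torus_lborel: "prob_space (torus_lborel :: 'n::finite torus measure)"
  unfolding torus_lborel_eq
proof (rule prob_space.prob_space_distr)
  show "prob_space (restrict_space lborel (unit_cell :: (real^'n) set))"
    by (rule prob_spaceI) (simp add: emeasure_restrict_space space_restrict_space emeasure_unit_cell)
qed simp

lemma torus_integral:
  fixes f :: "'n::finite torus \<Rightarrow> real"
  assumes [measurable]: "f \<in> borel_measurable borel"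
  shows "(LINT x|torus_lborel. f x) = (LINT y|lborel. indicator unit_cell y * f (torus_proj y))"
  unfolding torus_lborel_eq
  by (subst integral_distr) (auto simp: integral_restrict_space set_lebesgue_integral_def)

lemma
  fixes g :: "'a::euclidean_space \<Rightarrow> real"
  assumes [measurable]: "g \<in> borel_measurable borel"
  shows lborel_integral_translation: "(LINT x|lborel. g (x + c)) = (LINT x|lborel. g x)"
    and lborel_integrable_translation: "integrable lborel (\<lambda>x. g (x + c)) \<longleftrightarrow> integrable lborel g"
proof -
  have "(LINT x|lborel. g x) = (LINT x|distr lborel borel ((+) c). g x)" by (simp add: lborel_distr_plus)
  also have "\<dots> = (LINT x|lborel. g (x + c))" by (subst integral_distr) (auto simp: add.commute)
  finally show "(LINT x|lborel. g (x + c)) = (LINT x|lborel. g x)" by simp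
  have "integrable lborel g \<longleftrightarrow> integrable (distr lborel borel ((+) c)) g" by (simp add: lborel_distr_plus)
  also have "\<dots> \<longleftrightarrow> integrable lborel (\<lambda>x. g (x + c))"
    by (subst integrable_distr_eq) (auto simp: add.commute)
  finally show "integrable lborel (\<lambda>x. g (x + c)) \<longleftrightarrow> integrable lborel g" by simp
qed

lemma borel_measurable_vec_nth_real [measurable]:
  fixes f :: "'a \<Rightarrow> real^'n::finite"
  assumes [measurable]: "f \<in> borel_measurable M"
  shows "(\<lambda>x. f x $ i) \<in> borel_measurable M"
proof -
  have "(\<lambda>x. f x \<bullet> axis i 1) \<in> borel_measurable M" by measurable
  then show ?thesis by (simp add: inner_axis)
qed

lemma torus_measurable_continuous:
  "continuous_on UNIV f \<Longrightarrow> f \<in> borel_measurable borel"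
  by (rule borel_measurable_continuous_onI)

lemma torus_integrable_continuous:
  fixes f :: "'n::finite torus \<Rightarrow> 'b::{banach,second_countable_topology}"
  assumes "finite_measure M" "sets M = sets borel" "continuous_on UNIV f"
  shows "integrable M f"
proof -
  interpret finite_measure M by fact
  obtain B where B: "B > 0" "\<And>x. norm (f x) \<le> B" using torus_continuous_bounded[OF assms(3)] by blast
  moreover have "f \<in> borel_measurable M"
    using torus_measurable_continuous[OF assms(3)] assms(2) by (simp cong: measurable_cong_sets)
  ultimately show ?thesis by (intro integrable_const_bound[of _ B]) simp_all
qed

lemma integrable_indicator_unit_cell_mult:
  fixes f :: "real^'n::finite \<Rightarrow> real"
  assumes S: "S \<in> sets borel" "S \<subseteq> unit_cell" and f: "f \<in> borel_measurable borel" "\<And>x. \<bar>f x\<bar> \<le> B"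
  shows "integrable lborel (\<lambda>x. indicator S x * f x)"
proof (rule Bochner_Integration.integrable_bound)
  have "emeasure lborel S \<le> emeasure lborel (unit_cell :: (real^'n) set)"
    using S by (intro emeasure_mono) auto
  then have "emeasure lborel S < \<infinity>" using emeasure_unit_cell by (metis ennreal_one_less_top infinity_ennreal_def le_less_trans)
  then show "integrable lborel (\<lambda>x. B * indicator S x)" using S by (intro integrable_mult_right) auto
  show "(\<lambda>x. indicator S x * f x) \<in> borel_measurable lborel" using S(1) f(1) by measurable
  show "AE x in lborel. norm (indicator S x * f x) \<le> norm (B * indicator S x)"
    using f(2) by (auto simp: indicator_def intro: order_trans[OF _ abs_ge_self])
qed

text \<open>The cell translated by \<open>t\<close> in direction \<open>i\<close> consists of
  \<open>A\<close>, which stays inside the cell, and of \<open>C\<close> translated by the lattice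
  vector \<open>e\<close>. Periodicity moves the second piece back, and \<open>A\<close> and
  \<open>C\<close> together fill the cell.\<close>

lemma torus_integral_shift:
  fixes F :: "'n::finite torus \<Rightarrow> real"
  assumes F: "continuous_on UNIV F" and t: "0 \<le> t" "t \<le> 1"
  shows "(LINT y|lborel. indicator unit_cell y * F (torus_proj (y + axis i t))) =
         (LINT y|lborel. indicator unit_cell y * F (torus_proj y))"
proof -
  define f where "f y = F (torus_proj y)" for y
  obtain B where "B > 0" "\<And>x. norm (F x) \<le> B" using torus_continuous_bounded[OF F] by blast
  then have B: "\<And>x. \<bar>F x\<bar> \<le> B" by simp
  have [measurable]: "F \<in> borel_measurable borel" by (rule torus_measurable_continuous[OF F])
  have [measurable]: "f \<in> borel_measurable borel" unfolding f_def by measurable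
  define h e where "h = (axis i t :: real^'n)" and "e = (axis i 1 :: real^'n)"
  define A where "A = (unit_cell :: (real^'n) set) \<inter> {x. t \<le> x $ i}"
  define C where "C = (unit_cell :: (real^'n) set) \<inter> {x. x $ i < t}"
  have [measurable]: "A \<in> sets borel" "C \<in> sets borel" unfolding A_def C_def by measurable
  have intA: "integrable lborel (\<lambda>x. indicator A x * f x)"
    by (rule integrable_indicator_unit_cell_mult[where B=B]) (auto simp: A_def f_def B)
  have intC: "integrable lborel (\<lambda>x. indicator C x * f x)"
    by (rule integrable_indicator_unit_cell_mult[where B=B]) (auto simp: C_def f_def B)
  have per: "f (y + e) = f y" for y
    unfolding f_def e_def by (subst torus_proj_add_lattice) (auto simp: axis_def)
  have ind: "indicator unit_cell (x - h) = (indicator A x + indicator C (x - e) :: real)" for x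
  proof -
    have 1: "x - h \<in> unit_cell \<longleftrightarrow> x \<in> A \<or> x - e \<in> C"
    proof (cases "\<forall>j. j \<noteq> i \<longrightarrow> 0 \<le> x $ j \<and> x $ j < 1")
      case True
      have "z \<in> unit_cell \<longleftrightarrow> 0 \<le> z $ i \<and> z $ i < 1" if "\<And>j. j \<noteq> i \<Longrightarrow> z $ j = x $ j" for z :: "real^'n"
      proof
        assume "0 \<le> z $ i \<and> z $ i < 1"
        then have "0 \<le> z $ j \<and> z $ j < 1" for j
          using True that[of j] by (cases "j = i") auto
        then show "z \<in> unit_cell" by (simp add: unit_cell_def)
      qed (simp add: unit_cell_def)
      from this[of x] this[of "x - h"] this[of "x - e"] show ?thesis
        using t by (auto simp: A_def C_def h_def e_def axis_def)
    next
      case False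
      then obtain j where j: "j \<noteq> i" "\<not> (0 \<le> x $ j \<and> x $ j < 1)" by blast
      have "z \<notin> unit_cell" if "z $ j = x $ j" for z :: "real^'n"
        using j(2) that by (auto simp: unit_cell_def intro!: exI[of _ j])
      from this[of x] this[of "x - h"] this[of "x - e"] j(1) show ?thesis
        by (auto simp: A_def C_def h_def e_def axis_def)
    qed
    have 2: "\<not> (x \<in> A \<and> x - e \<in> C)"
    proof
      assume *: "x \<in> A \<and> x - e \<in> C"
      then have "x $ i < 1" "0 \<le> (x - e) $ i" by (auto simp: A_def C_def unit_cell_def)
      then show False by (simp add: e_def)
    qed
    from 1 2 show ?thesis by (auto simp: indicator_def)
  qed
  have "(LINT y|lborel. indicator unit_cell y * F (torus_proj (y + axis i t))) =
      (LINT y|lborel. indicator unit_cell (y + h - h) * f (y + h))"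
    by (simp add: f_def h_def)
  also have "\<dots> = (LINT y|lborel. indicator unit_cell (y - h) * f y)"
    by (rule lborel_integral_translation[where g="\<lambda>y. indicator unit_cell (y - h) * f y"]) measurable
  also have "\<dots> = (LINT y|lborel. indicator A y * f y + indicator C (y - e) * f y)"
    by (simp add: ind distrib_right)
  also have "\<dots> = (LINT y|lborel. indicator A y * f y) + (LINT y|lborel. indicator C (y - e) * f y)"
  proof (rule Bochner_Integration.integral_add[OF intA])
    show "integrable lborel (\<lambda>y. indicator C (y - e) * f y)"
      using lborel_integrable_translation[of "\<lambda>y. indicator C (y - e) * f y" e] intC
      by (simp add: per)
  qed
  also have "(LINT y|lborel. indicator C (y - e) * f y) = (LINT y|lborel. indicator C y * f y)"
    using lborel_integral_translation[of "\<lambda>y. indicator C (y - e) * f y" e] by (simp add: per)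
  also have "(LINT y|lborel. indicator A y * f y) + \<dots> =
      (LINT y|lborel. indicator A y * f y + indicator C y * f y)"
    by (rule Bochner_Integration.integral_add[OF intA intC, symmetric])
  also have "\<dots> = (LINT y|lborel. indicator unit_cell y * f y)"
    by (intro Bochner_Integration.integral_cong refl) (auto simp: A_def C_def indicator_def)
  finally show ?thesis by (simp add: f_def)
qed

text \<open>Difference quotients in direction \<open>i\<close> have integral zero by translation
  invariance, and the Lipschitz bound dominates them, so the limit has integral zero too.\<close>

lemma torus_integral_grad:
  fixes f :: "'n::finite torus \<Rightarrow> real"
  assumes f: "torus_C1 f"
  shows "(LINT x|torus_lborel. torus_grad f x $ i) = 0"
proof -
  define q where "q n y = indicator unit_cell y *
      ((f (torus_proj (y + axis i (inverse (Suc n)))) - f (torus_proj y)) / inverse (Suc n))"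
    for n and y :: "real^'n"
  have cf: "continuous_on UNIV f" by (rule torus_C1_continuous[OF f])
  have cg: "continuous_on UNIV (torus_grad f)" by (rule torus_C1_grad_continuous[OF f])
  have [measurable]: "f \<in> borel_measurable borel" "torus_grad f \<in> borel_measurable borel"
    by (intro torus_measurable_continuous cf cg)+
  obtain B where B: "B > 0" "\<And>x. norm (torus_grad f x) \<le> B" using torus_continuous_bounded[OF cg] by blast
  obtain B' where "B' > 0" "\<And>x. norm (f x) \<le> B'" using torus_continuous_bounded[OF cf] by blast
  then have B': "\<And>x. \<bar>f x\<bar> \<le> B'" by simp
  have q_le: "\<bar>f (torus_proj (y + axis i (inverse (Suc n)))) - f (torus_proj y)\<bar> / inverse (Suc n) \<le> B" for n y
  proof -
    have n: "norm (axis i t :: real^'n) = \<bar>t\<bar>" for t by (simp add: norm_eq_sqrt_inner inner_axis_axis)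
    have "\<bar>f (torus_proj (y + axis i (inverse (Suc n)))) - f (torus_proj y)\<bar> \<le> B * inverse (Suc n)"
      using torus_C1_lipschitz[OF f B(2), of "y + axis i (inverse (Suc n))" y] by (simp add: n del: of_nat_Suc)
    then show ?thesis by (subst pos_divide_le_eq) auto
  qed
  have "(\<lambda>n. LINT y|lborel. q n y) \<longlonglongrightarrow> (LINT y|lborel. indicator unit_cell y * torus_grad f (torus_proj y) $ i)"
  proof (rule integral_dominated_convergence[where w="\<lambda>y. B * indicator unit_cell y"])
    show "integrable lborel (\<lambda>y. B * indicator (unit_cell :: (real^'n) set) y)"
      by (intro integrable_mult_right integrable_real_indicator) (auto simp: emeasure_unit_cell)
    show "AE y in lborel. norm (q n y) \<le> B * indicator unit_cell y" for n
      using q_le by (auto simp: q_def indicator_def abs_mult divide_inverse simp del: of_nat_Suc)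
    show "AE y in lborel. (\<lambda>n. q n y) \<longlonglongrightarrow> indicator unit_cell y * torus_grad f (torus_proj y) $ i"
    proof (intro AE_I2)
      fix y :: "real^'n"
      have zero: "axis i 0 = (0 :: real^'n)" by (simp add: vec_eq_iff axis_def)
      have "((\<lambda>y. f (torus_proj y)) has_derivative (\<lambda>h. h \<bullet> torus_grad f (torus_proj y))) (at (y + axis i 0))"
        using torus_C1_GDERIV[OF f, of y] by (simp only: gderiv_def add_0_right zero)
      moreover have "((\<lambda>t. y + axis i t) has_derivative (\<lambda>t. axis i t)) (at 0)"
      proof -
        have "linear (axis i :: real \<Rightarrow> real^'n)"
          by (intro linearI) (auto simp: vec_eq_iff axis_def)
        then have "((\<lambda>t. axis i t :: real^'n) has_derivative (\<lambda>t. axis i t)) (at 0)"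
          by (intro bounded_linear_imp_has_derivative) (simp add: linear_linear)
        from has_derivative_add[OF has_derivative_const this] show ?thesis by simp
      qed
      ultimately have "((\<lambda>t. f (torus_proj (y + axis i t))) has_derivative
          (\<lambda>t. axis i t \<bullet> torus_grad f (torus_proj y))) (at 0)"
        by (rule has_derivative_compose[rotated])
      moreover have "(\<lambda>t. axis i t \<bullet> w) = (*) (w $ i)" for w :: "real^'n"
        by (simp add: fun_eq_iff inner_axis')
      ultimately have "DERIV (\<lambda>t. f (torus_proj (y + axis i t))) 0 :> torus_grad f (torus_proj y) $ i"
        by (simp only: has_field_derivative_def)
      then have "((\<lambda>t. (f (torus_proj (y + axis i t)) - f (torus_proj y)) / t) \<longlongrightarrow> torus_grad f (torus_proj y) $ i) (at 0)"
        unfolding DERIV_def add_0_left zero by (simp only: add_0_right)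
      moreover have "filterlim (\<lambda>n. inverse (real (Suc n))) (at 0) sequentially"
        by (intro filterlim_atI LIMSEQ_inverse_real_of_nat) auto
      ultimately have "(\<lambda>n. (f (torus_proj (y + axis i (inverse (Suc n)))) - f (torus_proj y)) / inverse (Suc n))
          \<longlonglongrightarrow> torus_grad f (torus_proj y) $ i" by (rule filterlim_compose)
      then show "(\<lambda>n. q n y) \<longlonglongrightarrow> indicator unit_cell y * torus_grad f (torus_proj y) $ i"
        unfolding q_def by (intro tendsto_mult tendsto_const)
    qed
  qed (simp_all add: q_def)
  moreover have "(LINT y|lborel. q n y) = 0" for n
  proof -
    let ?t = "inverse (real (Suc n))"
    have "(LINT y|lborel. q n y) =
       (LINT y|lborel. (indicator unit_cell y * f (torus_proj (y + axis i ?t))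
          - indicator unit_cell y * f (torus_proj y)) / ?t)"
      by (simp add: q_def algebra_simps diff_divide_distrib)
    also have "\<dots> = ((LINT y|lborel. indicator unit_cell y * f (torus_proj (y + axis i ?t)))
          - (LINT y|lborel. indicator unit_cell y * f (torus_proj y))) / ?t"
      unfolding integral_divide_zero
      by (subst Bochner_Integration.integral_diff)
        (auto intro!: integrable_indicator_unit_cell_mult[where B=B'] simp: B')
    also have "\<dots> = 0" by (subst torus_integral_shift[OF cf]) (auto simp: field_simps)
    finally show ?thesis .
  qed
  ultimately have "(LINT y|lborel. indicator unit_cell y * torus_grad f (torus_proj y) $ i) = 0"
    by (simp add: LIMSEQ_const_iff)
  then show ?thesis by (subst torus_integral) auto
qed

text \<open>The integral over the open box inside the cell vanishes, hence that over the closed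
  cube. There continuity forces the lift to be zero, and the closed cube covers the torus.\<close>

lemma torus_integral_nonneg_eq_0:
  fixes f :: "'n::finite torus \<Rightarrow> real"
  assumes f: "continuous_on UNIV f" and pos: "\<And>x. 0 \<le> f x" and 0: "(LINT x|torus_lborel. f x) = 0"
  shows "f x = 0"
proof -
  have [measurable]: "f \<in> borel_measurable borel" by (rule torus_measurable_continuous[OF f])
  obtain B where "B > 0" "\<And>x. norm (f x) \<le> B" using torus_continuous_bounded[OF f] by blast
  then have B: "\<And>x. \<bar>f x\<bar> \<le> B" by simp
  have i: "integrable lborel (\<lambda>y. indicator S y * f (torus_proj y))"
    if "S \<in> sets borel" "S \<subseteq> unit_cell" for S :: "(real^'n) set"
    using that by (intro integrable_indicator_unit_cell_mult[where B=B]) (auto simp: B)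
  have "(LINT y|lborel. indicator (box 0 1) y * f (torus_proj y)) \<le>
      (LINT y|lborel. indicator unit_cell y * f (torus_proj y))"
    by (intro integral_mono i box_subset_unit_cell mult_right_mono pos)
      (use box_subset_unit_cell in \<open>auto simp: indicator_def\<close>)
  also have "\<dots> = 0" using 0 by (subst (asm) torus_integral) auto
  finally have "(LINT y|lborel. indicator (box 0 1) y * f (torus_proj y)) = 0"
    using pos by (intro antisym) (auto intro!: Bochner_Integration.integral_nonneg)
  then have "integral (box 0 1) (\<lambda>y::real^'n. f (torus_proj y)) = 0"
    using i[OF _ box_subset_unit_cell]
    by (subst set_borel_integral_eq_integral(2)[symmetric])
      (auto simp: set_integrable_def set_lebesgue_integral_def)
  then have "integral (cbox 0 1) (\<lambda>y::real^'n. f (torus_proj y)) = 0"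
    by (simp add: integral_open_interval)
  then have "\<forall>y\<in>cbox 0 (1::real^'n). f (torus_proj y) = 0"
    using f pos by (subst (asm) integral_cbox_eq_0_iff)
      (auto simp: continuous_on_torus_iff box_ne_empty Basis_vec_def inner_axis intro: continuous_on_subset)
  then show ?thesis using torus_proj_cube[where 'n='n] by (metis UNIV_I imageE)
qed

lemma torus_integrable_lborel:
  fixes f :: "'n::finite torus \<Rightarrow> real"
  shows "continuous_on UNIV f \<Longrightarrow> integrable torus_lborel f"
  using prob_space_torus_lborel
  by (intro torus_integrable_continuous) (auto intro: prob_space.finite_measure)

lemma uniform_limit_imp_tendsto_integral:
  fixes f :: "'n::finite torus \<Rightarrow> real"
  assumes M: "finite_measure M" "sets M = sets borel"
    and g: "\<And>j. continuous_on UNIV (g j)" and f: "continuous_on UNIV f" and lim: "uniform_limit UNIV g f sequentially"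
  shows "(\<lambda>j. LINT x|M. g j x) \<longlonglongrightarrow> (LINT x|M. f x)"
proof (rule LIMSEQ_I)
  interpret finite_measure M by fact
  fix e :: real assume e: "e > 0"
  let ?m = "measure M (space M)"
  \<comment> \<open>The summand 1 permits the division even if \<open>M\<close> is the null
    measure.\<close>
  have "\<forall>\<^sub>F j in sequentially. \<forall>x\<in>UNIV. dist (g j x) (f x) < e / (?m + 1)"
    using e by (intro uniform_limitD[OF lim] divide_pos_pos) (auto simp: add_nonneg_pos)
  then obtain N where N: "\<And>j x. j \<ge> N \<Longrightarrow> \<bar>g j x - f x\<bar> < e / (?m + 1)"
    by (auto simp: eventually_sequentially dist_real_def)
  show "\<exists>N. \<forall>j\<ge>N. norm ((LINT x|M. g j x) - (LINT x|M. f x)) < e"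
  proof (intro exI[of _ N] allI impI)
    fix j assume "N \<le> j"
    have i: "integrable M (g j)" "integrable M f" using M f g by (auto intro: torus_integrable_continuous)
    have "norm ((LINT x|M. g j x) - (LINT x|M. f x)) = norm (LINT x|M. g j x - f x)"
      using i by simp
    also have "\<dots> \<le> (LINT x|M. norm (g j x - f x))" by simp
    also have "\<dots> \<le> (LINT x|M. e / (?m + 1))"
      using N[OF \<open>N \<le> j\<close>] i by (intro integral_mono) (auto simp: less_imp_le)
    also have "\<dots> = ?m * (e / (?m + 1))" by simp
    also have "\<dots> < e"
    proof -
      have "0 < ?m + 1" using measure_nonneg[of M "space M"] by linarith
      then show ?thesis using e by (subst times_divide_eq_right, subst pos_divide_less_eq) (auto simp: algebra_simps)
    qed
    finally show "norm ((LINT x|M. g j x) - (LINT x|M. f x)) < e" .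
  qed
qed

text \<open>Trigonometric polynomials are admissible tests and approximate \<open>f\<close>
  uniformly, so in the limit \<open>f\<close> is tested against itself.\<close>

lemma torus_orthogonal_C1_imp_0:
  fixes f :: "'n::finite torus \<Rightarrow> real"
  assumes f: "continuous_on UNIV f"
    and 0: "\<And>\<theta>. torus_C1 \<theta> \<Longrightarrow> (LINT x|torus_lborel. f x * \<theta> x) = 0"
  shows "f x = 0"
proof -
  obtain g where g: "\<And>j. trig_poly (g j)" "uniform_limit UNIV g f sequentially"
    using trig_poly_dense[OF f] by blast
  have "(\<lambda>j. LINT x|torus_lborel. f x * g j x) \<longlonglongrightarrow> (LINT x|torus_lborel. f x * f x)"
  proof (rule uniform_limit_imp_tendsto_integral)
    show "finite_measure torus_lborel" using prob_space_torus_lborel by (rule prob_space.finite_measure)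
    have "bounded (range f)" using compact_torus f compact_continuous_image compact_imp_bounded by blast
    then show "uniform_limit UNIV (\<lambda>j x. f x * g j x) (\<lambda>x. f x * f x) sequentially"
      by (intro uniform_lim_mult g uniform_limit_const) auto
  qed (auto intro!: continuous_on_mult f trig_poly_continuous[OF g(1)])
  then have "(LINT x|torus_lborel. f x * f x) = 0"
    using 0[OF trig_poly_C1[OF g(1)]] by (simp add: LIMSEQ_const_iff)
  then have "f x * f x = 0"
    by (intro torus_integral_nonneg_eq_0[of "\<lambda>x. f x * f x"] continuous_intros f) auto
  then show ?thesis by simp
qed

section \<open>Square-integrable fields\<close>

lemma
  fixes f g :: "'a \<Rightarrow> 'b::euclidean_space"
  assumes [measurable]: "f \<in> borel_measurable M" "g \<in> borel_measurable M"
    and f: "integrable M (\<lambda>x. (norm (f x))\<^sup>2)" and g: "integrable M (\<lambda>x. (norm (g x))\<^sup>2)"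
  shows integrable_inner_L2: "integrable M (\<lambda>x. f x \<bullet> g x)"
    and integrable_norm2_add: "integrable M (\<lambda>x. (norm (f x + g x))\<^sup>2)"
    and integrable_norm2_diff: "integrable M (\<lambda>x. (norm (f x - g x))\<^sup>2)"
    and Cauchy_Schwarz_integral:
      "(LINT x|M. f x \<bullet> g x)\<^sup>2 \<le> (LINT x|M. (norm (f x))\<^sup>2) * (LINT x|M. (norm (g x))\<^sup>2)"
proof -
  show fg: "integrable M (\<lambda>x. f x \<bullet> g x)"
  proof (rule Bochner_Integration.integrable_bound)
    show "integrable M (\<lambda>x. (norm (f x))\<^sup>2 + (norm (g x))\<^sup>2)" using f g by simp
    have "norm (u \<bullet> v) \<le> norm ((norm u)\<^sup>2 + (norm v)\<^sup>2)" for u v :: 'b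
    proof -
      have "norm (u \<bullet> v) \<le> norm u * norm v" using Cauchy_Schwarz_ineq2[of u v] by simp
      also have "\<dots> \<le> (norm u)\<^sup>2 + (norm v)\<^sup>2"
        using sum_squares_bound[of "norm u" "norm v"] mult_nonneg_nonneg[of "norm u" "norm v"]
          norm_ge_zero[of u] norm_ge_zero[of v] by linarith
      finally show ?thesis by simp
    qed
    then show "AE x in M. norm (f x \<bullet> g x) \<le> norm ((norm (f x))\<^sup>2 + (norm (g x))\<^sup>2)" by simp
  qed measurable
  have "(\<lambda>x. (norm (f x + g x))\<^sup>2) = (\<lambda>x. (norm (f x))\<^sup>2 + 2 * (f x \<bullet> g x) + (norm (g x))\<^sup>2)"
    by (auto simp: power2_norm_eq_inner inner_add_left inner_add_right inner_commute)
  then show "integrable M (\<lambda>x. (norm (f x + g x))\<^sup>2)" using f g fg by simp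
  have d: "(norm (f x - t *\<^sub>R g x))\<^sup>2 = (norm (f x))\<^sup>2 - 2 * t * (f x \<bullet> g x) + t\<^sup>2 * (norm (g x))\<^sup>2" for t x
    unfolding power2_norm_eq_inner
    by (simp add: inner_diff_left inner_diff_right inner_commute power2_eq_square algebra_simps)
  then have "(\<lambda>x. (norm (f x - g x))\<^sup>2) = (\<lambda>x. (norm (f x))\<^sup>2 - 2 * (f x \<bullet> g x) + (norm (g x))\<^sup>2)"
    using d[of _ 1] by auto
  then show "integrable M (\<lambda>x. (norm (f x - g x))\<^sup>2)" using f g fg by simp
  define a b c where "a = (LINT x|M. (norm (f x))\<^sup>2)" and "b = (LINT x|M. (norm (g x))\<^sup>2)"
    and "c = (LINT x|M. f x \<bullet> g x)"
  have q: "0 \<le> a - 2 * t * c + t\<^sup>2 * b" for t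
  proof -
    have "0 \<le> (LINT x|M. (norm (f x - t *\<^sub>R g x))\<^sup>2)" by (intro Bochner_Integration.integral_nonneg) simp
    also have "\<dots> = a - 2 * t * c + t\<^sup>2 * b" unfolding d a_def b_def c_def using f g fg by simp
    finally show ?thesis .
  qed
  have b0: "b \<ge> 0" unfolding b_def by (intro Bochner_Integration.integral_nonneg) simp
  \<comment> \<open>The quadratic in \<open>t\<close> is evaluated at its minimiser
    \<open>c / b\<close>. For \<open>b = 0\<close> it is affine, and
    \<open>t = (a + 1) / (2 * c)\<close> would give it the value -1.\<close>
  have "c\<^sup>2 \<le> a * b"
  proof (cases "b = 0")
    case True
    have "c = 0"
    proof (rule ccontr)
      assume "c \<noteq> 0"
      then show False using q[of "(a + 1) / (2 * c)"] True by (simp add: field_simps)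
    qed
    then show ?thesis using True by simp
  next
    case False
    then show ?thesis using q[of "c / b"] b0 by (simp add: field_simps power2_eq_square)
  qed
  then show "(LINT x|M. f x \<bullet> g x)\<^sup>2 \<le> (LINT x|M. (norm (f x))\<^sup>2) * (LINT x|M. (norm (g x))\<^sup>2)"
    unfolding a_def b_def c_def .
qed

lemma integrable_of_norm2:
  fixes f :: "'a \<Rightarrow> 'b::euclidean_space"
  assumes M: "finite_measure M" and [measurable]: "f \<in> borel_measurable M"
    and f: "integrable M (\<lambda>x. (norm (f x))\<^sup>2)"
  shows "integrable M f"
proof (rule Bochner_Integration.integrable_bound)
  interpret finite_measure M by fact
  show "integrable M (\<lambda>x. 1 + (norm (f x))\<^sup>2)" using f by simp
  have "norm w \<le> norm (1 + (norm w)\<^sup>2)" for w :: 'b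
    using sum_squares_bound[of "norm w" 1] by (simp add: power2_eq_square)
      (smt (verit) norm_ge_zero)
  then show "AE x in M. norm (f x) \<le> norm (1 + (norm (f x))\<^sup>2)" by blast
qed measurable

lemma tendsto_integral_inner:
  fixes u :: "nat \<Rightarrow> 'a \<Rightarrow> 'b::euclidean_space"
  assumes [measurable]: "\<And>n. u n \<in> borel_measurable M" "v \<in> borel_measurable M" "w \<in> borel_measurable M"
    and u: "\<And>n. integrable M (\<lambda>x. (norm (u n x))\<^sup>2)" and v: "integrable M (\<lambda>x. (norm (v x))\<^sup>2)"
    and w: "integrable M (\<lambda>x. (norm (w x))\<^sup>2)"
    and lim: "(\<lambda>n. LINT x|M. (norm (u n x - v x))\<^sup>2) \<longlonglongrightarrow> 0"
  shows "(\<lambda>n. LINT x|M. u n x \<bullet> w x) \<longlonglongrightarrow> (LINT x|M. v x \<bullet> w x)"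
proof -
  have uv: "integrable M (\<lambda>x. (norm (u n x - v x))\<^sup>2)" for n
    by (intro integrable_norm2_diff u v) measurable
  have "(\<lambda>n. ((LINT x|M. u n x \<bullet> w x) - (LINT x|M. v x \<bullet> w x))\<^sup>2) \<longlonglongrightarrow> 0"
  proof (rule Lim_null_comparison)
    have "((LINT x|M. u n x \<bullet> w x) - (LINT x|M. v x \<bullet> w x))\<^sup>2 \<le>
        (LINT x|M. (norm (u n x - v x))\<^sup>2) * (LINT x|M. (norm (w x))\<^sup>2)" for n
    proof -
      have "(LINT x|M. u n x \<bullet> w x) - (LINT x|M. v x \<bullet> w x) = (LINT x|M. (u n x - v x) \<bullet> w x)"
        using integrable_inner_L2[of "u n" M w] integrable_inner_L2[of v M w] u v w
        by (simp add: inner_diff_left)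
      moreover have "(LINT x|M. (u n x - v x) \<bullet> w x)\<^sup>2 \<le>
          (LINT x|M. (norm (u n x - v x))\<^sup>2) * (LINT x|M. (norm (w x))\<^sup>2)"
        by (rule Cauchy_Schwarz_integral[OF _ _ uv w]) measurable
      ultimately show ?thesis by simp
    qed
    then show "\<forall>\<^sub>F n in sequentially. norm (((LINT x|M. u n x \<bullet> w x) - (LINT x|M. v x \<bullet> w x))\<^sup>2) \<le>
        (LINT x|M. (norm (u n x - v x))\<^sup>2) * (LINT x|M. (norm (w x))\<^sup>2)" by simp
    show "(\<lambda>n. (LINT x|M. (norm (u n x - v x))\<^sup>2) * (LINT x|M. (norm (w x))\<^sup>2)) \<longlonglongrightarrow> 0"
      using tendsto_mult_right[OF lim, of "LINT x|M. (norm (w x))\<^sup>2"] by simp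
  qed
  from tendsto_real_sqrt[OF this]
  have "(\<lambda>n. \<bar>(LINT x|M. u n x \<bullet> w x) - (LINT x|M. v x \<bullet> w x)\<bar>) \<longlonglongrightarrow> 0"
    by (simp only: real_sqrt_abs real_sqrt_zero)
  then have "(\<lambda>n. (LINT x|M. u n x \<bullet> w x) - (LINT x|M. v x \<bullet> w x)) \<longlonglongrightarrow> 0"
    by (rule tendsto_rabs_zero_cancel)
  then show ?thesis by (rule LIM_zero_cancel)
qed

text \<open>On a finite measure an L2-Cauchy sequence is L1-Cauchy, so a subsequence converges
  almost everywhere. Fatou's lemma then bounds the L2 distance of the whole sequence to that
  pointwise limit.\<close>

lemma L2_complete:
  fixes u :: "nat \<Rightarrow> 'a \<Rightarrow> 'b::euclidean_space"
  assumes M: "finite_measure M"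
    and [measurable]: "\<And>n. u n \<in> borel_measurable M"
    and int: "\<And>n. integrable M (\<lambda>x. (norm (u n x))\<^sup>2)"
    and cauchy: "\<And>e. e > 0 \<Longrightarrow> \<exists>N. \<forall>m\<ge>N. \<forall>n\<ge>N. (LINT x|M. (norm (u m x - u n x))\<^sup>2) < e"
  shows "\<exists>v. v \<in> borel_measurable M \<and> integrable M (\<lambda>x. (norm (v x))\<^sup>2) \<and>
    (\<lambda>n. LINT x|M. (norm (u n x - v x))\<^sup>2) \<longlonglongrightarrow> 0"
proof -
  interpret finite_measure M by fact
  have int1: "integrable M (u n)" for n
    by (rule integrable_of_norm2[OF M _ int]) measurable
  have intd: "integrable M (\<lambda>x. (norm (u m x - u n x))\<^sup>2)" for m n
    by (intro integrable_norm2_diff int) measurable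
  have L1: "\<exists>N. \<forall>m\<ge>N. \<forall>n\<ge>N. (LINT x|M. norm (u m x - u n x)) < e" if e: "e > 0" for e
  proof -
    \<comment> \<open>The weight in \<open>norm w \<le> a / 2 + (norm w)\<^sup>2 / (2 * a)\<close>:
      integrated, the first term stays below \<open>e / 2\<close> by the choice of \<open>a\<close>,
      the second once the squared L2 distance is below \<open>a * e\<close>.\<close>
    define a where "a = e / (measure M (space M) + 1)"
    have a: "a > 0" "a * measure M (space M) < e"
    proof -
      have "0 \<le> measure M (space M)" by simp
      then have m: "0 < measure M (space M) + 1" by linarith
      then show "a > 0" "a * measure M (space M) < e"
        using e by (auto simp: a_def field_simps)
    qed
    obtain N where N: "\<And>m n. m \<ge> N \<Longrightarrow> n \<ge> N \<Longrightarrow> (LINT x|M. (norm (u m x - u n x))\<^sup>2) < a * e"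
      using cauchy[of "a * e"] a e by (metis mult_pos_pos)
    show ?thesis
    proof (intro exI[of _ N] allI impI)
      fix m n assume mn: "N \<le> m" "N \<le> n"
      have "norm w \<le> a / 2 + (norm w)\<^sup>2 / (2 * a)" for w :: 'b
      proof -
        have "2 * a * norm w \<le> a\<^sup>2 + (norm w)\<^sup>2" using sum_squares_bound[of a "norm w"] by simp
        then show ?thesis using a by (simp add: field_simps power2_eq_square)
      qed
      then have "(LINT x|M. norm (u m x - u n x)) \<le> (LINT x|M. a / 2 + (norm (u m x - u n x))\<^sup>2 / (2 * a))"
        using int1 intd by (intro integral_mono) auto
      also have "\<dots> = a * measure M (space M) / 2 + (LINT x|M. (norm (u m x - u n x))\<^sup>2) / (2 * a)"
        using intd by (subst Bochner_Integration.integral_add) auto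
      also have "(LINT x|M. (norm (u m x - u n x))\<^sup>2) / (2 * a) < e / 2"
        using N[OF mn] a by (simp add: field_simps)
      also have "a * measure M (space M) / 2 + e / 2 < e" using a by simp
      finally show "(LINT x|M. norm (u m x - u n x)) < e" by simp
    qed
  qed
  obtain r where r: "strict_mono r" and AEC: "AE x in M. Cauchy (\<lambda>i. u (r i) x)"
    using cauchy_L1_AE_cauchy_subseq[of M u] int1 L1 by blast
  define v where "v x = lim (\<lambda>i. u (r i) x)" for x
  have v[measurable]: "v \<in> borel_measurable M" unfolding v_def by (rule borel_measurable_lim_metric) simp
  have AEv: "AE x in M. (\<lambda>i. u (r i) x) \<longlonglongrightarrow> v x"
    using AEC by eventually_elim (auto simp: v_def Cauchy_convergent_iff convergent_LIMSEQ_iff)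
  have fatou: "\<exists>N. \<forall>n\<ge>N. (\<integral>\<^sup>+x. ennreal ((norm (u n x - v x))\<^sup>2) \<partial>M) \<le> ennreal e" if e: "e > 0" for e
  proof -
    obtain N where N: "\<And>m n. m \<ge> N \<Longrightarrow> n \<ge> N \<Longrightarrow> (LINT x|M. (norm (u m x - u n x))\<^sup>2) < e"
      using cauchy[OF e] by metis
    show ?thesis
    proof (intro exI[of _ N] allI impI)
      fix n assume n: "N \<le> n"
      have "(\<integral>\<^sup>+x. ennreal ((norm (u n x - v x))\<^sup>2) \<partial>M) =
          (\<integral>\<^sup>+x. liminf (\<lambda>i. ennreal ((norm (u n x - u (r i) x))\<^sup>2)) \<partial>M)"
      proof (rule nn_integral_cong_AE)
        show "AE x in M. ennreal ((norm (u n x - v x))\<^sup>2) = liminf (\<lambda>i. ennreal ((norm (u n x - u (r i) x))\<^sup>2))"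
          using AEv
        proof eventually_elim
          fix x assume "(\<lambda>i. u (r i) x) \<longlonglongrightarrow> v x"
          then have "(\<lambda>i. ennreal ((norm (u n x - u (r i) x))\<^sup>2)) \<longlonglongrightarrow> ennreal ((norm (u n x - v x))\<^sup>2)"
            by (intro tendsto_ennrealI tendsto_intros)
          then show "ennreal ((norm (u n x - v x))\<^sup>2) = liminf (\<lambda>i. ennreal ((norm (u n x - u (r i) x))\<^sup>2))"
            by (intro lim_imp_Liminf[symmetric]) auto
        qed
      qed
      also have "\<dots> \<le> liminf (\<lambda>i. \<integral>\<^sup>+x. ennreal ((norm (u n x - u (r i) x))\<^sup>2) \<partial>M)"
        by (rule nn_integral_liminf) measurable
      also have "\<dots> \<le> ennreal e"
      proof (rule Liminf_le)
        show "\<forall>\<^sub>F i in sequentially. (\<integral>\<^sup>+x. ennreal ((norm (u n x - u (r i) x))\<^sup>2) \<partial>M) \<le> ennreal e"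
          using eventually_ge_at_top[of N]
        proof eventually_elim
          fix i assume "N \<le> i"
          then have "N \<le> r i" using r seq_suble order_trans by blast
          then show "(\<integral>\<^sup>+x. ennreal ((norm (u n x - u (r i) x))\<^sup>2) \<partial>M) \<le> ennreal e"
            using N[OF n, of "r i"] intd by (subst nn_integral_eq_integral) (auto intro: ennreal_leI)
        qed
      qed simp
      finally show "(\<integral>\<^sup>+x. ennreal ((norm (u n x - v x))\<^sup>2) \<partial>M) \<le> ennreal e" .
    qed
  qed
  have v2: "integrable M (\<lambda>x. (norm (v x))\<^sup>2)"
  proof -
    obtain N where "(\<integral>\<^sup>+x. ennreal ((norm (u N x - v x))\<^sup>2) \<partial>M) \<le> ennreal 1" using fatou[of 1] by auto
    then have "integrable M (\<lambda>x. (norm (u N x - v x))\<^sup>2)"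
      by (intro integrableI_bounded) (auto intro: le_less_trans)
    then have "integrable M (\<lambda>x. (norm (u N x - (u N x - v x)))\<^sup>2)"
      by (intro integrable_norm2_diff[of "u N" M "\<lambda>x. u N x - v x"] int) measurable
    then show ?thesis by simp
  qed
  have uv: "integrable M (\<lambda>x. (norm (u n x - v x))\<^sup>2)" for n
    by (intro integrable_norm2_diff int v2) measurable
  have "(\<lambda>n. LINT x|M. (norm (u n x - v x))\<^sup>2) \<longlonglongrightarrow> 0"
  proof (rule LIMSEQ_I)
    fix e :: real assume "e > 0"
    then obtain N where N: "\<And>n. n \<ge> N \<Longrightarrow> (\<integral>\<^sup>+x. ennreal ((norm (u n x - v x))\<^sup>2) \<partial>M) \<le> ennreal (e/2)"
      using fatou[of "e/2"] by auto
    show "\<exists>N. \<forall>n\<ge>N. norm ((LINT x|M. (norm (u n x - v x))\<^sup>2) - 0) < e"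
    proof (intro exI[of _ N] allI impI)
      fix n assume "N \<le> n"
      from N[OF this] have "(LINT x|M. (norm (u n x - v x))\<^sup>2) \<le> e / 2"
        using uv[of n] \<open>e > 0\<close> by (subst (asm) nn_integral_eq_integral) auto
      then show "norm ((LINT x|M. (norm (u n x - v x))\<^sup>2) - 0) < e"
        using \<open>e > 0\<close> by (simp add: Bochner_Integration.integral_nonneg)
    qed
  qed
  then show ?thesis using v v2 by blast
qed

section \<open>Weak solutions for a general measure\<close>

text \<open>The first-order condition at \<open>t = 0\<close>. For \<open>t = - c / d\<close> with
  \<open>d\<close> larger than \<open>a\<close> the linear term would outweigh the quadratic one. It
  yields the Euler-Lagrange equation of the flow as well as the subgradient of
  \<open>F\<close>.\<close>

lemma linear_coefficient_eq_0:
  fixes a c :: real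
  assumes "\<And>t. 0 \<le> 2 * t * c + t\<^sup>2 * a"
  shows "c = 0"
proof (rule ccontr)
  assume "c \<noteq> 0"
  define d where "d = \<bar>a\<bar> + 1"
  have d: "d > 0" "a < d" by (auto simp: d_def)
  have "0 \<le> 2 * (- c / d) * c + (- c / d)\<^sup>2 * a" by (rule assms)
  also have "\<dots> = (c\<^sup>2 / d\<^sup>2) * (a - 2 * d)" using d by (simp add: field_simps power2_eq_square)
  also have "\<dots> < 0" using d \<open>c \<noteq> 0\<close> by (intro mult_pos_neg) auto
  finally show False by simp
qed

locale torus_measure =
  fixes \<mu> :: "('n::finite) torus measure"
  assumes mu: "\<mu> \<in> borel_prob"
begin

sublocale prob_space \<mu>
  using mu by (simp add: borel_prob_def)

lemma sets_mu [simp, measurable_cong]: "sets \<mu> = sets borel"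
  using mu by (simp add: borel_prob_def)

lemma space_mu [simp]: "space \<mu> = UNIV"
  using sets_eq_imp_space_eq[OF sets_mu] by simp

text \<open>\<open>flow P v\<close> says that \<open>v\<close> is the orthogonal projection in \<open>L\<^sup>2(\<mu>)\<close> of the constant field \<open>P\<close> onto the fields
  that are orthogonal to all gradients.\<close>

definition flow :: "real^'n \<Rightarrow> ('n torus \<Rightarrow> real^'n) \<Rightarrow> bool" where
  "flow P v \<longleftrightarrow> v \<in> borel_measurable borel \<and> integrable \<mu> (\<lambda>x. (norm (v x))\<^sup>2) \<and>
    (\<forall>\<theta>. torus_C1 \<theta> \<longrightarrow> (LINT x|\<mu>. v x \<bullet> torus_grad \<theta> x) = 0) \<and>
    (\<exists>\<phi>. (\<forall>j::nat. torus_C1 (\<phi> j)) \<and> (\<lambda>j. LINT x|\<mu>. (norm (torus_grad (\<phi> j) x + P - v x))\<^sup>2) \<longlonglongrightarrow> 0)"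

lemma
  assumes "flow P v"
  shows flow_measurable [measurable_dest]: "v \<in> borel_measurable borel"
    and flow_integrable_norm2: "integrable \<mu> (\<lambda>x. (norm (v x))\<^sup>2)"
    and flow_div_free: "torus_C1 \<theta> \<Longrightarrow> (LINT x|\<mu>. v x \<bullet> torus_grad \<theta> x) = 0"
  using assms by (auto simp: flow_def)

lemma torus_grad_measurable: "torus_C1 \<phi> \<Longrightarrow> torus_grad \<phi> \<in> borel_measurable borel"
  by (intro torus_measurable_continuous torus_C1_grad_continuous)

lemma integrable_norm2_torus_grad:
  assumes "torus_C1 \<phi>"
  shows "integrable \<mu> (\<lambda>x. (norm (torus_grad \<phi> x + P))\<^sup>2)"
  by (intro torus_integrable_continuous finite_measure_axioms sets_mu continuous_intros
      torus_C1_grad_continuous assms)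

definition energy :: "real^'n \<Rightarrow> ('n torus \<Rightarrow> real) \<Rightarrow> real" where
  "energy P \<phi> = (LINT x|\<mu>. (norm (torus_grad \<phi> x + P))\<^sup>2)"

lemma F_eq_energy: "F \<mu> P = 1 / 2 * (INF \<phi>\<in>{\<phi>. torus_C1 \<phi>}. energy P \<phi>)"
  by (simp add: F_def energy_def)

lemma energy_bdd_below: "bdd_below (energy P ` {\<phi>. torus_C1 \<phi>})"
  by (rule bdd_belowI[of _ 0]) (auto simp: energy_def)

text \<open>By the parallelogram identity near-minimisers are close to each other, since their
  midpoint cannot have energy below the infimum \<open>m\<close>. Completeness gives the limit
  field, and the first variation makes it orthogonal to gradients.\<close>

lemma flow_exists: "\<exists>v. flow P v"
proof -
  define m where "m = (INF \<phi>\<in>{\<phi>. torus_C1 \<phi>}. energy P \<phi>)"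
  have m_le: "m \<le> energy P \<phi>" if "torus_C1 \<phi>" for \<phi>
    unfolding m_def using that by (intro cINF_lower energy_bdd_below) auto
  have "\<exists>\<phi>. torus_C1 \<phi> \<and> energy P \<phi> < m + inverse (Suc n)" for n
  proof (rule ccontr)
    assume "\<not> ?thesis"
    then have "m + inverse (Suc n) \<le> m"
      unfolding m_def using torus_C1_const by (intro cINF_greatest) (auto simp: not_less m_def[symmetric])
    then show False by (simp del: of_nat_Suc)
  qed
  then obtain \<phi> where \<phi>: "\<And>n. torus_C1 (\<phi> n)" "\<And>n. energy P (\<phi> n) < m + inverse (Suc n)" by metis
  define u where "u n x = torus_grad (\<phi> n) x + P" for n x
  have [measurable]: "u n \<in> borel_measurable borel" for n
    using torus_grad_measurable[OF \<phi>(1)] unfolding u_def by measurable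
  have int: "integrable \<mu> (\<lambda>x. (norm (u n x))\<^sup>2)" for n
    unfolding u_def by (rule integrable_norm2_torus_grad[OF \<phi>(1)])
  have enu: "energy P (\<phi> n) = (LINT x|\<mu>. (norm (u n x))\<^sup>2)" for n by (simp add: energy_def u_def)
  have dist: "(LINT x|\<mu>. (norm (u i x - u j x))\<^sup>2) \<le> 2 * inverse (Suc i) + 2 * inverse (Suc j)" for i j
  proof -
    \<comment> \<open>The midpoint competitor; its field is half the sum of \<open>u i\<close> and
      \<open>u j\<close>, so \<open>4 * m\<close> bounds the squared norm of that sum from
      below.\<close>
    let ?\<psi> = "\<lambda>x. 1/2 * (\<phi> i x + \<phi> j x)"
    have C: "torus_C1 ?\<psi>" by (intro torus_C1_cmult torus_C1_add \<phi>)
    have g: "torus_grad ?\<psi> x + P = (1/2) *\<^sub>R (u i x + u j x)" for x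
      unfolding torus_grad_cmult[OF torus_C1_add[OF \<phi>(1) \<phi>(1)]] torus_grad_add[OF \<phi>(1) \<phi>(1)] u_def
      by (simp add: vec_eq_iff field_simps)
    have s: "integrable \<mu> (\<lambda>x. (norm (u i x + u j x))\<^sup>2)" by (intro integrable_norm2_add int) measurable
    have "m \<le> energy P ?\<psi>" by (rule m_le[OF C])
    also have "\<dots> = (LINT x|\<mu>. (norm (u i x + u j x))\<^sup>2) / 4"
      unfolding energy_def g by (simp add: power_divide power2_eq_square)
    finally have "4 * m \<le> (LINT x|\<mu>. (norm (u i x + u j x))\<^sup>2)" by simp
    moreover have "(LINT x|\<mu>. (norm (u i x - u j x))\<^sup>2) =
        (LINT x|\<mu>. 2 * (norm (u i x))\<^sup>2 + 2 * (norm (u j x))\<^sup>2 - (norm (u i x + u j x))\<^sup>2)"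
      by (intro Bochner_Integration.integral_cong refl)
        (simp add: power2_norm_eq_inner inner_diff_left inner_diff_right inner_add_left inner_add_right)
    moreover have "\<dots> = 2 * energy P (\<phi> i) + 2 * energy P (\<phi> j) - (LINT x|\<mu>. (norm (u i x + u j x))\<^sup>2)"
      using int s by (simp add: enu)
    ultimately show ?thesis using \<phi>(2)[of i] \<phi>(2)[of j] by linarith
  qed
  have um: "u n \<in> borel_measurable \<mu>" for n by measurable
  have cau: "\<exists>N. \<forall>i\<ge>N. \<forall>j\<ge>N. (LINT x|\<mu>. (norm (u i x - u j x))\<^sup>2) < e" if e: "e > 0" for e
  proof -
    obtain N where N: "inverse (real (Suc N)) < e / 4"
      using reals_Archimedean[of "e/4"] e by auto
    show ?thesis
    proof (intro exI[of _ N] allI impI)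
      fix i j assume "N \<le> i" "N \<le> j"
      then have "inverse (real (Suc i)) \<le> inverse (real (Suc N))" "inverse (real (Suc j)) \<le> inverse (real (Suc N))"
        by (auto intro!: le_imp_inverse_le)
      then show "(LINT x|\<mu>. (norm (u i x - u j x))\<^sup>2) < e" using dist[of i j] N by linarith
    qed
  qed
  obtain v where v: "v \<in> borel_measurable \<mu>" "integrable \<mu> (\<lambda>x. (norm (v x))\<^sup>2)"
    "(\<lambda>n. LINT x|\<mu>. (norm (u n x - v x))\<^sup>2) \<longlonglongrightarrow> 0"
    using L2_complete[OF finite_measure_axioms um int cau] by blast
  have [measurable]: "v \<in> borel_measurable borel" using v(1) by (simp cong: measurable_cong_sets)
  have "(LINT x|\<mu>. v x \<bullet> torus_grad \<theta> x) = 0" if \<theta>: "torus_C1 \<theta>" for \<theta>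
  proof -
    have [measurable]: "torus_grad \<theta> \<in> borel_measurable borel" by (rule torus_grad_measurable[OF \<theta>])
    have i\<theta>: "integrable \<mu> (\<lambda>x. (norm (torus_grad \<theta> x))\<^sup>2)"
      using integrable_norm2_torus_grad[OF \<theta>, of 0] by simp
    define a c where "a = (LINT x|\<mu>. (norm (torus_grad \<theta> x))\<^sup>2)" and "c = (LINT x|\<mu>. v x \<bullet> torus_grad \<theta> x)"
    have lim: "(\<lambda>n. LINT x|\<mu>. u n x \<bullet> torus_grad \<theta> x) \<longlonglongrightarrow> c"
      unfolding c_def by (intro tendsto_integral_inner int v i\<theta>) measurable
    \<comment> \<open>Each \<open>\<phi> n\<close> minimises only up to
      \<open>inverse (Suc n)\<close>; comparing it with \<open>\<phi> n + t \<theta>\<close> leaves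
      this slack, which disappears in the limit.\<close>
    have "0 \<le> 2 * t * c + t\<^sup>2 * a" for t
    proof (rule LIMSEQ_le_const)
      show "(\<lambda>n. inverse (real (Suc n)) + 2 * t * (LINT x|\<mu>. u n x \<bullet> torus_grad \<theta> x) + t\<^sup>2 * a)
        \<longlonglongrightarrow> 2 * t * c + t\<^sup>2 * a"
        using tendsto_add[OF tendsto_add[OF LIMSEQ_inverse_real_of_nat tendsto_mult_left[OF lim, of "2*t"]]
          tendsto_const[of "t\<^sup>2 * a"]] by simp
      have "0 \<le> inverse (real (Suc n)) + 2 * t * (LINT x|\<mu>. u n x \<bullet> torus_grad \<theta> x) + t\<^sup>2 * a" for n
      proof -
        have C: "torus_C1 (\<lambda>x. t * \<theta> x)" by (intro torus_C1_cmult \<theta>)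
        have inn: "integrable \<mu> (\<lambda>x. u n x \<bullet> torus_grad \<theta> x)"
          by (intro integrable_inner_L2 int i\<theta>) measurable
        have "m \<le> energy P (\<lambda>x. \<phi> n x + t * \<theta> x)" by (intro m_le torus_C1_add \<phi> C)
        also have "\<dots> = (LINT x|\<mu>. (norm (u n x))\<^sup>2 + 2 * t * (u n x \<bullet> torus_grad \<theta> x)
            + t\<^sup>2 * (norm (torus_grad \<theta> x))\<^sup>2)"
          unfolding energy_def torus_grad_add[OF \<phi>(1) C] torus_grad_cmult[OF \<theta>] power2_norm_eq_inner u_def
          by (intro Bochner_Integration.integral_cong refl)
            (simp add: inner_add_left inner_add_right inner_commute power2_eq_square algebra_simps)
        also have "\<dots> = energy P (\<phi> n) + 2 * t * (LINT x|\<mu>. u n x \<bullet> torus_grad \<theta> x) + t\<^sup>2 * a"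
          using int inn i\<theta> by (simp add: enu a_def)
        finally show ?thesis using \<phi>(2)[of n] by linarith
      qed
      then show "\<exists>N. \<forall>n\<ge>N. 0 \<le> inverse (real (Suc n)) + 2 * t * (LINT x|\<mu>. u n x \<bullet> torus_grad \<theta> x) + t\<^sup>2 * a"
        by blast
    qed
    then show ?thesis using linear_coefficient_eq_0 unfolding c_def by blast
  qed
  then have "flow P v" unfolding flow_def using v \<phi>(1) by (auto simp: u_def)
  then show ?thesis by blast
qed

lemma
  assumes "\<xi> \<in> \<Lambda>_marg \<mu>"
  shows marg_prob: "prob_space \<xi>" and marg_sets: "sets \<xi> = sets borel"
    and marg_integrable_norm2: "integrable \<xi> (\<lambda>z. (norm (snd z))\<^sup>2)"
    and marg_div_free: "torus_C1 \<theta> \<Longrightarrow> (LINT z|\<xi>. snd z \<bullet> torus_grad \<theta> (fst z)) = 0"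
    and marg_distr: "distr \<xi> borel fst = \<mu>"
  using assms by (auto simp: \<Lambda>_marg_def \<Lambda>_def borel_prob_def split_beta')

lemma borel_fst [measurable]: "fst \<in> (borel :: ('n torus \<times> (real^'n)) measure) \<rightarrow>\<^sub>M borel"
  and borel_snd [measurable]: "snd \<in> (borel :: ('n torus \<times> (real^'n)) measure) \<rightarrow>\<^sub>M borel"
  by (auto intro!: borel_measurable_continuous_onI continuous_intros)

lemma
  fixes f :: "'n torus \<Rightarrow> real"
  assumes \<xi>: "\<xi> \<in> \<Lambda>_marg \<mu>" and [measurable]: "f \<in> borel_measurable borel"
  shows marg_integral_fst: "(LINT z|\<xi>. f (fst z)) = (LINT x|\<mu>. f x)"
    and marg_integrable_fst: "integrable \<xi> (\<lambda>z. f (fst z)) \<longleftrightarrow> integrable \<mu> f"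
proof -
  note [measurable_cong] = marg_sets[OF \<xi>]
  show "(LINT z|\<xi>. f (fst z)) = (LINT x|\<mu>. f x)"
    by (subst marg_distr[OF \<xi>, symmetric], subst integral_distr) auto
  show "integrable \<xi> (\<lambda>z. f (fst z)) \<longleftrightarrow> integrable \<mu> f"
    by (subst marg_distr[OF \<xi>, symmetric], subst integrable_distr_eq) auto
qed

text \<open>Measures in \<open>\<Lambda>_marg \<mu>\<close> annihilate gradients, and
  \<open>v - P\<close> is a limit of gradients. The convergence in L2 of \<mu> is also convergence
  in L2 of \<xi>, because these fields depend on the first component only, whose law is
  \<mu>.\<close>

lemma flow_orthogonal:
  assumes flow: "flow P v" and \<xi>: "\<xi> \<in> \<Lambda>_marg \<mu>"
  shows "(LINT z|\<xi>. snd z \<bullet> v (fst z)) = (LINT z|\<xi>. snd z \<bullet> P)"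
    and "integrable \<xi> (\<lambda>z. snd z \<bullet> v (fst z))" and "integrable \<xi> (\<lambda>z. snd z \<bullet> P)"
proof -
  note [measurable_cong] = marg_sets[OF \<xi>]
  note [measurable] = flow_measurable[OF flow]
  interpret \<xi>: prob_space \<xi> by (rule marg_prob[OF \<xi>])
  have ip: "integrable \<xi> (\<lambda>z. (norm (snd z))\<^sup>2)" by (rule marg_integrable_norm2[OF \<xi>])
  have iv: "integrable \<xi> (\<lambda>z. (norm (v (fst z)))\<^sup>2)"
    using flow_integrable_norm2[OF flow] by (subst marg_integrable_fst[OF \<xi>]) auto
  obtain \<phi> where \<phi>: "\<And>j::nat. torus_C1 (\<phi> j)" and
    lim: "(\<lambda>j. LINT x|\<mu>. (norm (torus_grad (\<phi> j) x + P - v x))\<^sup>2) \<longlonglongrightarrow> 0"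
    using flow unfolding flow_def by auto
  have [measurable]: "torus_grad (\<phi> j) \<in> borel_measurable borel" for j by (rule torus_grad_measurable[OF \<phi>])
  have ig: "integrable \<xi> (\<lambda>z. (norm (torus_grad (\<phi> j) (fst z) + Q))\<^sup>2)" for j Q
    using integrable_norm2_torus_grad[OF \<phi>] by (subst marg_integrable_fst[OF \<xi>]) auto
  have "(\<lambda>j. LINT z|\<xi>. (norm (torus_grad (\<phi> j) (fst z) + P - v (fst z)))\<^sup>2) \<longlonglongrightarrow> 0"
    using lim by (subst marg_integral_fst[OF \<xi>]) auto
  then have "(\<lambda>j. LINT z|\<xi>. (torus_grad (\<phi> j) (fst z) + P) \<bullet> snd z) \<longlonglongrightarrow> (LINT z|\<xi>. v (fst z) \<bullet> snd z)"
    by (intro tendsto_integral_inner ig iv ip) measurable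
  moreover have "(LINT z|\<xi>. (torus_grad (\<phi> j) (fst z) + P) \<bullet> snd z) = (LINT z|\<xi>. P \<bullet> snd z)" for j
  proof -
    have "integrable \<xi> (\<lambda>z. torus_grad (\<phi> j) (fst z) \<bullet> snd z)" "integrable \<xi> (\<lambda>z. P \<bullet> snd z)"
      using ig[of j 0] by (intro integrable_inner_L2 ip; simp; measurable)+
    moreover have "(LINT z|\<xi>. torus_grad (\<phi> j) (fst z) \<bullet> snd z) = 0"
      using marg_div_free[OF \<xi> \<phi>[of j]] by (subst inner_commute)
    ultimately show ?thesis by (simp add: inner_add_left)
  qed
  ultimately show "(LINT z|\<xi>. snd z \<bullet> v (fst z)) = (LINT z|\<xi>. snd z \<bullet> P)"
    by (simp add: LIMSEQ_const_iff inner_commute)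
  show "integrable \<xi> (\<lambda>z. snd z \<bullet> v (fst z))" by (intro integrable_inner_L2 ip iv) measurable
  show "integrable \<xi> (\<lambda>z. snd z \<bullet> P)" by (intro integrable_inner_L2 ip) auto
qed

text \<open>Complete the square around \<open>v\<close>: the cross term, the integral of
  \<open>p \<bullet> v\<close>, equals that of \<open>p \<bullet> P\<close> by
  \<open>flow_orthogonal\<close>.\<close>

lemma flow_energy_identity:
  assumes flow: "flow P v" and \<xi>: "\<xi> \<in> \<Lambda>_marg \<mu>"
  shows "(LINT z|\<xi>. (norm (snd z))\<^sup>2 / 2 - snd z \<bullet> P) =
    1 / 2 * (LINT z|\<xi>. (norm (snd z - v (fst z)))\<^sup>2) - 1 / 2 * (LINT x|\<mu>. (norm (v x))\<^sup>2)"
    and "integrable \<xi> (\<lambda>z. (norm (snd z - v (fst z)))\<^sup>2)"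
proof -
  note [measurable_cong] = marg_sets[OF \<xi>]
  note [measurable] = flow_measurable[OF flow]
  have ip: "integrable \<xi> (\<lambda>z. (norm (snd z))\<^sup>2)" by (rule marg_integrable_norm2[OF \<xi>])
  have iv: "integrable \<xi> (\<lambda>z. (norm (v (fst z)))\<^sup>2)"
    using flow_integrable_norm2[OF flow] by (subst marg_integrable_fst[OF \<xi>]) auto
  note o = flow_orthogonal[OF flow \<xi>]
  show "integrable \<xi> (\<lambda>z. (norm (snd z - v (fst z)))\<^sup>2)" by (intro integrable_norm2_diff ip iv) measurable
  have "(LINT z|\<xi>. (norm (snd z - v (fst z)))\<^sup>2) =
      (LINT z|\<xi>. (norm (snd z))\<^sup>2 - 2 * (snd z \<bullet> v (fst z)) + (norm (v (fst z)))\<^sup>2)"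
    by (intro Bochner_Integration.integral_cong refl)
      (simp add: power2_norm_eq_inner inner_diff_left inner_diff_right inner_commute)
  also have "\<dots> = (LINT z|\<xi>. (norm (snd z))\<^sup>2) - 2 * (LINT z|\<xi>. snd z \<bullet> P) + (LINT x|\<mu>. (norm (v x))\<^sup>2)"
    using ip iv o marg_integral_fst[OF \<xi>, of "\<lambda>x. (norm (v x))\<^sup>2"] by simp
  finally show "(LINT z|\<xi>. (norm (snd z))\<^sup>2 / 2 - snd z \<bullet> P) =
    1 / 2 * (LINT z|\<xi>. (norm (snd z - v (fst z)))\<^sup>2) - 1 / 2 * (LINT x|\<mu>. (norm (v x))\<^sup>2)"
    using ip o by (simp add: diff_divide_distrib add_divide_distrib)
qed

section \<open>Graph measures, uniqueness of the weak solution and the value of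
  \<open>F\<close>\<close>

definition graph_measure :: "('n torus \<Rightarrow> real^'n) \<Rightarrow> ('n torus \<times> (real^'n)) measure" where
  "graph_measure v = distr \<mu> borel (\<lambda>x. (x, v x))"

lemma graph_map_measurable:
  fixes v :: "'n torus \<Rightarrow> real^'n"
  assumes [measurable]: "v \<in> borel_measurable borel"
  shows "(\<lambda>x. (x, v x)) \<in> (borel :: 'n torus measure) \<rightarrow>\<^sub>M borel"
proof -
  have "(\<lambda>x. (x, v x)) \<in> (borel :: 'n torus measure) \<rightarrow>\<^sub>M borel \<Otimes>\<^sub>M borel" by measurable
  then show ?thesis unfolding borel_prod[where 'a="'n torus" and 'b="real^'n"] .
qed

lemma
  fixes f :: "'n torus \<times> (real^'n) \<Rightarrow> 'b::{banach, second_countable_topology}"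
  assumes v: "v \<in> borel_measurable borel" and f: "f \<in> borel_measurable borel"
  shows graph_measure_integral: "(LINT z|graph_measure v. f z) = (LINT x|\<mu>. f (x, v x))"
    and graph_measure_integrable: "integrable (graph_measure v) f \<longleftrightarrow> integrable \<mu> (\<lambda>x. f (x, v x))"
  unfolding graph_measure_def using graph_map_measurable[OF v] f
  by (auto intro!: integral_distr integrable_distr_eq cong: measurable_cong_sets)

lemma graph_measure_in_marg:
  assumes flow: "flow P v"
  shows "graph_measure v \<in> \<Lambda>_marg \<mu>"
proof -
  note v [measurable] = flow_measurable[OF flow]
  have vm: "(\<lambda>x. (x, v x)) \<in> \<mu> \<rightarrow>\<^sub>M borel"
    using graph_map_measurable[OF v] by (simp cong: measurable_cong_sets)
  have "distr (graph_measure v) borel fst = distr \<mu> borel (\<lambda>x. x)"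
    unfolding graph_measure_def by (subst distr_distr[OF borel_fst vm]) (simp add: o_def)
  then have "distr (graph_measure v) borel fst = \<mu>" by (simp add: distr_id2)
  moreover have "prob_space (graph_measure v)"
    unfolding graph_measure_def by (rule prob_space_distr[OF vm])
  moreover have "sets (graph_measure v) = sets borel" by (simp add: graph_measure_def)
  moreover have "integrable (graph_measure v) (\<lambda>z. (norm (snd z))\<^sup>2)"
    using flow_integrable_norm2[OF flow] by (subst graph_measure_integrable[OF v]) auto
  moreover have "(LINT z|graph_measure v. snd z \<bullet> torus_grad \<theta> (fst z)) = 0" if \<theta>: "torus_C1 \<theta>" for \<theta>
  proof -
    have [measurable]: "torus_grad \<theta> \<in> borel_measurable borel" by (rule torus_grad_measurable[OF \<theta>])
    show ?thesis using flow_div_free[OF flow \<theta>] by (subst graph_measure_integral[OF v]) auto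
  qed
  ultimately show ?thesis by (simp add: \<Lambda>_marg_def \<Lambda>_def borel_prob_def split_beta')
qed

lemma graph_measure_value:
  assumes flow: "flow P v"
  shows "(LINT z|graph_measure v. (norm (snd z))\<^sup>2 / 2 - snd z \<bullet> P) = - 1 / 2 * (LINT x|\<mu>. (norm (v x))\<^sup>2)"
proof -
  note v [measurable] = flow_measurable[OF flow]
  have "(LINT z|graph_measure v. (norm (snd z - v (fst z)))\<^sup>2) = 0"
    by (subst graph_measure_integral[OF v]) auto
  then show ?thesis using flow_energy_identity(1)[OF flow graph_measure_in_marg[OF flow]] by simp
qed

text \<open>By the energy identity a minimiser has vanishing integral of
  \<open>|p - v(x)|^2\<close>, so it is carried by the graph of \<open>v\<close>. A measure carried
  by a graph is the image of its first marginal.\<close>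

lemma weak_solution_iff:
  assumes flow: "flow P v"
  shows "weak_solution \<mu> P \<nu> \<longleftrightarrow> \<nu> = graph_measure v"
proof
  assume "\<nu> = graph_measure v"
  moreover have "(LINT z|graph_measure v. (norm (snd z))\<^sup>2 / 2 - snd z \<bullet> P) \<le>
      (LINT z|\<xi>. (norm (snd z))\<^sup>2 / 2 - snd z \<bullet> P)" if "\<xi> \<in> \<Lambda>_marg \<mu>" for \<xi>
    unfolding graph_measure_value[OF flow] flow_energy_identity(1)[OF flow that]
    by (simp add: Bochner_Integration.integral_nonneg)
  ultimately show "weak_solution \<mu> P \<nu>"
    unfolding weak_solution_def using graph_measure_in_marg[OF flow] by (auto simp: split_beta')
next
  assume ws: "weak_solution \<mu> P \<nu>"
  note v [measurable] = flow_measurable[OF flow]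
  have \<nu>: "\<nu> \<in> \<Lambda>_marg \<mu>" using ws by (simp add: weak_solution_def)
  note sets_nu [measurable_cong] = marg_sets[OF \<nu>]
  have "(LINT z|\<nu>. (norm (snd z))\<^sup>2 / 2 - snd z \<bullet> P) \<le> (LINT z|graph_measure v. (norm (snd z))\<^sup>2 / 2 - snd z \<bullet> P)"
    using ws graph_measure_in_marg[OF flow] by (auto simp: weak_solution_def split_beta')
  then have "(LINT z|\<nu>. (norm (snd z - v (fst z)))\<^sup>2) \<le> 0"
    unfolding graph_measure_value[OF flow] flow_energy_identity(1)[OF flow \<nu>] by simp
  then have "(LINT z|\<nu>. (norm (snd z - v (fst z)))\<^sup>2) = 0"
    by (intro antisym) (auto intro: Bochner_Integration.integral_nonneg)
  then have "AE z in \<nu>. (norm (snd z - v (fst z)))\<^sup>2 = 0"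
    by (subst (asm) integral_nonneg_eq_0_iff_AE[OF flow_energy_identity(2)[OF flow \<nu>]]) auto
  then have AE: "AE z in \<nu>. z = (fst z, v (fst z))"
    by eventually_elim (auto simp: prod_eq_iff)
  have vm: "(\<lambda>x. (x, v x)) \<in> borel \<rightarrow>\<^sub>M borel" by (rule graph_map_measurable[OF v])
  have "\<nu> = distr \<nu> borel (\<lambda>z. z)" using sets_nu by (simp add: distr_id2)
  also have "\<dots> = distr \<nu> borel ((\<lambda>x. (x, v x)) \<circ> fst)"
    using AE by (intro distr_cong_AE) (auto simp: o_def intro!: measurable_compose[OF borel_fst vm] cong: measurable_cong_sets)
  also have "\<dots> = distr (distr \<nu> borel fst) borel (\<lambda>x. (x, v x))"
    using vm by (subst distr_distr) (auto cong: measurable_cong_sets)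
  finally show "\<nu> = graph_measure v" by (simp add: marg_distr[OF \<nu>] graph_measure_def)
qed

text \<open>Pythagoras: \<open>torus_grad \<phi> + P - v\<close> is orthogonal to \<open>v\<close>,
  so the energy is its squared norm plus that of \<open>v\<close>. The first part tends to 0 along
  the sequence that defines the flow.\<close>

lemma F_eq_flow:
  assumes flow: "flow P v"
  shows "F \<mu> P = 1 / 2 * (LINT x|\<mu>. (norm (v x))\<^sup>2)"
proof -
  note v [measurable] = flow_measurable[OF flow]
  note iv = flow_integrable_norm2[OF flow]
  \<comment> \<open>The graph of \<open>v\<close> is itself an admissible measure, so
    \<open>flow_orthogonal\<close> applies to it.\<close>
  have vP: "(LINT x|\<mu>. v x \<bullet> v x) = (LINT x|\<mu>. v x \<bullet> P)"
    using flow_orthogonal(1)[OF flow graph_measure_in_marg[OF flow]]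
    by (subst (asm) graph_measure_integral[OF v], measurable, subst (asm) graph_measure_integral[OF v]) auto
  define m where "m = (LINT x|\<mu>. (norm (v x))\<^sup>2)"
  have en: "energy P \<phi> = (LINT x|\<mu>. (norm (torus_grad \<phi> x + P - v x))\<^sup>2) + m" if \<phi>: "torus_C1 \<phi>" for \<phi>
  proof -
    have [measurable]: "torus_grad \<phi> \<in> borel_measurable borel" by (rule torus_grad_measurable[OF \<phi>])
    have i1: "integrable \<mu> (\<lambda>x. v x \<bullet> torus_grad \<phi> x)" "integrable \<mu> (\<lambda>x. v x \<bullet> P)" "integrable \<mu> (\<lambda>x. v x \<bullet> v x)"
      using integrable_norm2_torus_grad[OF \<phi>, of 0] iv by (intro integrable_inner_L2; simp; measurable)+
    have i2: "integrable \<mu> (\<lambda>x. (norm (torus_grad \<phi> x + P - v x))\<^sup>2)"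
      by (intro integrable_norm2_diff integrable_norm2_torus_grad \<phi> iv) measurable
    have "energy P \<phi> = (LINT x|\<mu>. (norm (torus_grad \<phi> x + P - v x))\<^sup>2
        + (2 * (v x \<bullet> torus_grad \<phi> x) + 2 * (v x \<bullet> P) - 2 * (v x \<bullet> v x)) + (norm (v x))\<^sup>2)"
      unfolding energy_def power2_norm_eq_inner
      by (intro Bochner_Integration.integral_cong refl)
        (simp add: inner_add_left inner_add_right inner_diff_left inner_diff_right inner_commute)
    also have "\<dots> = (LINT x|\<mu>. (norm (torus_grad \<phi> x + P - v x))\<^sup>2)
        + (2 * (LINT x|\<mu>. v x \<bullet> torus_grad \<phi> x) + 2 * (LINT x|\<mu>. v x \<bullet> P) - 2 * (LINT x|\<mu>. v x \<bullet> v x)) + m"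
      using i1 i2 iv by (simp add: m_def del: inner_eq_zero_iff)
    also have "\<dots> = (LINT x|\<mu>. (norm (torus_grad \<phi> x + P - v x))\<^sup>2) + m"
      using flow_div_free[OF flow \<phi>] vP by simp
    finally show ?thesis .
  qed
  have "(INF \<phi>\<in>{\<phi>. torus_C1 \<phi>}. energy P \<phi>) = m"
  proof (rule antisym)
    show "m \<le> (INF \<phi>\<in>{\<phi>. torus_C1 \<phi>}. energy P \<phi>)"
      using torus_C1_const by (intro cINF_greatest) (auto simp: en)
    obtain \<phi> where \<phi>: "\<And>j::nat. torus_C1 (\<phi> j)" and
      lim: "(\<lambda>j. LINT x|\<mu>. (norm (torus_grad (\<phi> j) x + P - v x))\<^sup>2) \<longlonglongrightarrow> 0"
      using flow unfolding flow_def by auto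
    have "(\<lambda>j. energy P (\<phi> j)) \<longlonglongrightarrow> 0 + m" unfolding en[OF \<phi>] by (intro tendsto_add lim tendsto_const)
    moreover have "(INF \<phi>\<in>{\<phi>. torus_C1 \<phi>}. energy P \<phi>) \<le> energy P (\<phi> j)" for j
      using \<phi> by (intro cINF_lower energy_bdd_below) simp
    ultimately show "(INF \<phi>\<in>{\<phi>. torus_C1 \<phi>}. energy P \<phi>) \<le> m"
      using LIMSEQ_le_const[of "\<lambda>j. energy P (\<phi> j)"] by auto
  qed
  then show ?thesis by (simp add: F_eq_energy m_def)
qed

section \<open>The mean of the flow and the conjugate of \<open>F\<close>\<close>

definition the_flow :: "real^'n \<Rightarrow> 'n torus \<Rightarrow> real^'n" where
  "the_flow P = (SOME v. flow P v)"

lemma flow_the_flow: "flow P (the_flow P)"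
  unfolding the_flow_def using flow_exists by (rule someI_ex)

text \<open>The symmetric linear map \<open>A\<close> of the overview. A flow is determined only up
  to null sets of \<mu>, which do not affect its mean.\<close>

definition mean_flow :: "real^'n \<Rightarrow> real^'n" where
  "mean_flow P = (LINT x|\<mu>. the_flow P x)"

lemma flow_integrable: "flow P v \<Longrightarrow> integrable \<mu> v"
  by (rule integrable_of_norm2[OF finite_measure_axioms _ flow_integrable_norm2])
    (auto dest: flow_measurable cong: measurable_cong_sets)

text \<open>Two flows for the same \<open>P\<close> have the same graph measure, as both graphs are
  the unique weak solution.\<close>

lemma mean_flow_eq:
  assumes flow: "flow P v"
  shows "mean_flow P = (LINT x|\<mu>. v x)"
proof -
  have "graph_measure v = graph_measure (the_flow P)"
    using weak_solution_iff[OF flow] weak_solution_iff[OF flow_the_flow] by blast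
  then have "(LINT z|graph_measure v. snd z) = (LINT z|graph_measure (the_flow P). snd z)" by simp
  then show ?thesis
    unfolding mean_flow_def
    by (simp add: graph_measure_integral[OF flow_measurable[OF flow] borel_snd]
        graph_measure_integral[OF flow_measurable[OF flow_the_flow] borel_snd])
qed

text \<open>Integrated against the graph of \<open>w\<close>, the field \<open>v\<close> may be
  replaced by the constant \<open>P\<close>. Exchanging the two flows gives the symmetry of
  \<open>mean_flow\<close>, equating them gives the quadratic form of \<open>F\<close>.\<close>

lemma inner_flows:
  assumes flow: "flow P v" "flow Q w"
  shows "(LINT x|\<mu>. w x \<bullet> v x) = P \<bullet> mean_flow Q"
proof -
  note [measurable] = flow_measurable[OF flow(1)] flow_measurable[OF flow(2)]
  have "(LINT x|\<mu>. w x \<bullet> v x) = (LINT x|\<mu>. w x \<bullet> P)"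
    using flow_orthogonal(1)[OF flow(1) graph_measure_in_marg[OF flow(2)]]
    by (subst (asm) graph_measure_integral, measurable, subst (asm) graph_measure_integral) auto
  also have "\<dots> = P \<bullet> mean_flow Q"
    using mean_flow_eq[OF flow(2)] flow_integrable[OF flow(2)] by (simp add: inner_commute)
  finally show ?thesis .
qed

lemma mean_flow_symmetric: "P \<bullet> mean_flow Q = Q \<bullet> mean_flow P"
  using inner_flows[OF flow_the_flow[of P] flow_the_flow[of Q]]
    inner_flows[OF flow_the_flow[of Q] flow_the_flow[of P]] by (simp add: inner_commute)

text \<open>A map that is symmetric with respect to an inner product is linear.\<close>

lemma linear_mean_flow: "linear mean_flow"
proof (rule linearI)
  have *: "mean_flow (a *\<^sub>R P + b *\<^sub>R Q) = a *\<^sub>R mean_flow P + b *\<^sub>R mean_flow Q" for a b P Q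
  proof -
    have "R \<bullet> mean_flow (a *\<^sub>R P + b *\<^sub>R Q) = R \<bullet> (a *\<^sub>R mean_flow P + b *\<^sub>R mean_flow Q)" for R
      using mean_flow_symmetric[of R "a *\<^sub>R P + b *\<^sub>R Q"] mean_flow_symmetric[of R P] mean_flow_symmetric[of R Q]
      by (simp add: inner_add_left inner_add_right)
    then show ?thesis by (metis vector_eq_ldot)
  qed
  show "mean_flow (P + Q) = mean_flow P + mean_flow Q" for P Q using *[of 1 P 1 Q] by simp
  show "mean_flow (a *\<^sub>R P) = a *\<^sub>R mean_flow P" for a P using *[of a P 0 P] by simp
qed

lemma flow_norm2: "flow P v \<Longrightarrow> (LINT x|\<mu>. (norm (v x))\<^sup>2) = P \<bullet> mean_flow P"
  using inner_flows[of P v P v] by (simp add: power2_norm_eq_inner)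

lemma F_eq_mean_flow: "F \<mu> P = 1 / 2 * (P \<bullet> mean_flow P)"
  using F_eq_flow[OF flow_the_flow[of P]] flow_norm2[OF flow_the_flow[of P]] by simp

lemma graph_measure_in_mean:
  assumes flow: "flow P v"
  shows "graph_measure v \<in> \<Lambda>_mean \<mu> (mean_flow P)"
  using graph_measure_in_marg[OF flow] mean_flow_eq[OF flow]
    graph_measure_integral[OF flow_measurable[OF flow] borel_snd]
  by (simp add: \<Lambda>_mean_def split_beta')

lemma graph_measure_norm2:
  assumes flow: "flow P v"
  shows "(LINT z|graph_measure v. (norm (snd z))\<^sup>2) = P \<bullet> mean_flow P"
  using flow_norm2[OF flow]
  by (subst graph_measure_integral[OF flow_measurable[OF flow]]) auto

text \<open>Weak duality. The energy identity bounds the functional on all of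
  \<open>\<Lambda>_marg \<mu>\<close> from below by \<open>- F \<mu> P\<close>, and for mean
  \<open>J\<close> its linear part is \<open>- (J \<bullet> P)\<close>.\<close>

lemma mean_norm2_lower:
  assumes \<xi>: "\<xi> \<in> \<Lambda>_mean \<mu> J"
  shows "P \<bullet> J - F \<mu> P \<le> 1 / 2 * (LINT z|\<xi>. (norm (snd z))\<^sup>2)"
proof -
  have \<xi>m: "\<xi> \<in> \<Lambda>_marg \<mu>" and J: "(LINT z|\<xi>. snd z) = J" using \<xi> by (auto simp: \<Lambda>_mean_def split_beta')
  interpret \<xi>: prob_space \<xi> by (rule marg_prob[OF \<xi>m])
  note [measurable_cong] = marg_sets[OF \<xi>m]
  have ip: "integrable \<xi> (\<lambda>z. (norm (snd z))\<^sup>2)" by (rule marg_integrable_norm2[OF \<xi>m])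
  have i: "integrable \<xi> snd" by (rule integrable_of_norm2[OF \<xi>.finite_measure_axioms _ ip]) measurable
  have "- F \<mu> P \<le> (LINT z|\<xi>. (norm (snd z))\<^sup>2 / 2 - snd z \<bullet> P)"
    unfolding flow_energy_identity(1)[OF flow_the_flow \<xi>m] F_eq_flow[OF flow_the_flow]
    by (simp add: Bochner_Integration.integral_nonneg)
  also have "\<dots> = 1 / 2 * (LINT z|\<xi>. (norm (snd z))\<^sup>2) - J \<bullet> P"
    using ip i J by simp
  finally show ?thesis by (simp add: inner_commute)
qed

text \<open>By symmetry a vector orthogonal to the range lies in the kernel. If the component of
  \<open>J\<close> orthogonal to the range is nonzero, it serves as \<open>Q\<close>.\<close>

lemma range_mean_flow_or_kernel:
  obtains P where "J = mean_flow P" | Q where "mean_flow Q = 0" "Q \<bullet> J > 0"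
proof -
  have sub: "subspace (range mean_flow)" using linear_mean_flow by (simp add: linear_subspace_image)
  obtain y z where yz: "y \<in> span (range mean_flow)" "\<And>w. w \<in> span (range mean_flow) \<Longrightarrow> orthogonal z w" "J = y + z"
    using orthogonal_subspace_decomp_exists[of "range mean_flow" J] by metis
  have y: "y \<in> range mean_flow" using yz(1) sub by (simp add: span_eq_iff[THEN iffD2])
  have "z \<bullet> mean_flow w = 0" for w using yz(2)[of "mean_flow w"] by (simp add: orthogonal_def span_base)
  then have "w \<bullet> mean_flow z = 0" for w using mean_flow_symmetric[of w z] by simp
  then have z: "mean_flow z = 0" by (metis inner_eq_zero_iff)
  show thesis
  proof (cases "z = 0")
    case True
    then show thesis using y yz(3) that(1) by auto
  next
    case False
    have "z \<bullet> y = 0" using yz(1,2) by (simp add: orthogonal_def)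
    then have "z \<bullet> J > 0" using False yz(3) by (simp add: inner_add_right)
    then show thesis using z that(2) by blast
  qed
qed

text \<open>One inequality is weak duality. For \<open>J = mean_flow P\<close> the graph of the flow
  attains it. Otherwise \<open>F\<close> vanishes along a kernel direction in which the linear term
  grows, so \<open>Fstar\<close> is infinite.\<close>

lemma Fstar_eq: "Fstar \<mu> J = ereal (1 / 2) * (INF \<nu>\<in>\<Lambda>_mean \<mu> J. ereal (LINT z|\<nu>. (norm (snd z))\<^sup>2))"
proof (rule antisym)
  show "Fstar \<mu> J \<le> ereal (1 / 2) * (INF \<nu>\<in>\<Lambda>_mean \<mu> J. ereal (LINT z|\<nu>. (norm (snd z))\<^sup>2))"
    unfolding Fstar_def
  proof (rule SUP_least)
    fix P
    have "ereal (2 * (P \<bullet> J - F \<mu> P)) \<le> (INF \<nu>\<in>\<Lambda>_mean \<mu> J. ereal (LINT z|\<nu>. (norm (snd z))\<^sup>2))"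
      using mean_norm2_lower[of _ J P] by (intro INF_greatest) fastforce
    from ereal_mult_left_mono[OF this, of "ereal (1/2)"]
    show "ereal (P \<bullet> J - F \<mu> P) \<le> ereal (1 / 2) * (INF \<nu>\<in>\<Lambda>_mean \<mu> J. ereal (LINT z|\<nu>. (norm (snd z))\<^sup>2))"
      by (simp add: diff_divide_distrib)
  qed
  consider P where "J = mean_flow P" | Q where "mean_flow Q = 0" "Q \<bullet> J > 0"
    using range_mean_flow_or_kernel by blast
  then show "ereal (1 / 2) * (INF \<nu>\<in>\<Lambda>_mean \<mu> J. ereal (LINT z|\<nu>. (norm (snd z))\<^sup>2)) \<le> Fstar \<mu> J"
  proof cases
    case 1
    have "(INF \<nu>\<in>\<Lambda>_mean \<mu> J. ereal (LINT z|\<nu>. (norm (snd z))\<^sup>2)) \<le> ereal (P \<bullet> J)"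
      using INF_lower[OF graph_measure_in_mean[OF flow_the_flow[of P]], of "\<lambda>\<nu>. ereal (LINT z|\<nu>. (norm (snd z))\<^sup>2)"]
      by (simp add: 1 graph_measure_norm2[OF flow_the_flow])
    from ereal_mult_left_mono[OF this, of "ereal (1/2)"]
    have "ereal (1 / 2) * (INF \<nu>\<in>\<Lambda>_mean \<mu> J. ereal (LINT z|\<nu>. (norm (snd z))\<^sup>2)) \<le> ereal (P \<bullet> J - F \<mu> P)"
      by (simp add: F_eq_mean_flow 1)
    also have "\<dots> \<le> Fstar \<mu> J" unfolding Fstar_def by (rule SUP_upper) simp
    finally show ?thesis .
  next
    case 2
    have "\<exists>P\<in>UNIV. ereal (real n) \<le> ereal (P \<bullet> J - F \<mu> P)" for n
    \<comment> \<open>Scaled so that the product with \<open>J\<close> is exactly \<open>n\<close>,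
      while \<open>F\<close> is zero at this kernel vector.\<close>
    proof (intro bexI[of _ "(real n / (Q \<bullet> J)) *\<^sub>R Q"])
      show "ereal (real n) \<le> ereal ((real n / (Q \<bullet> J)) *\<^sub>R Q \<bullet> J - F \<mu> ((real n / (Q \<bullet> J)) *\<^sub>R Q))"
        using 2 by (simp add: F_eq_mean_flow linear_scale[OF linear_mean_flow])
    qed simp
    then have "Fstar \<mu> J = \<infinity>" unfolding Fstar_def by (rule SUP_PInfty)
    then show ?thesis by simp
  qed
qed

text \<open>\<open>F\<close> is a quadratic form, and along the direction
  \<open>?H = mean_flow P - J\<close> the subgradient inequality has first-order coefficient
  \<open>?H \<bullet> ?H\<close>, which must vanish.\<close>

lemma subgradient_imp_mean_flow:
  assumes J: "J \<in> subgradient (F \<mu>) P"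
  shows "J = mean_flow P"
proof -
  let ?H = "mean_flow P - J"
  interpret linear mean_flow by (rule linear_mean_flow)
  have "0 \<le> 2 * t * (?H \<bullet> ?H) + t\<^sup>2 * (?H \<bullet> mean_flow ?H)" for t
  proof -
    have "F \<mu> (P + t *\<^sub>R ?H) \<ge> F \<mu> P + J \<bullet> (t *\<^sub>R ?H)"
      using J unfolding subgradient_def by (metis (mono_tags, lifting) add_diff_cancel_left' mem_Collect_eq)
    moreover have "F \<mu> (P + t *\<^sub>R ?H) = F \<mu> P + t * (?H \<bullet> mean_flow P) + t\<^sup>2 / 2 * (?H \<bullet> mean_flow ?H)"
    proof -
      have "P \<bullet> mean_flow ?H = ?H \<bullet> mean_flow P" by (rule mean_flow_symmetric)
      moreover have "mean_flow (P + t *\<^sub>R ?H) = mean_flow P + t *\<^sub>R mean_flow ?H"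
        by (simp only: add scaleR)
      ultimately show ?thesis
        unfolding F_eq_mean_flow
        by (simp only: inner_add_left inner_add_right inner_scaleR_left inner_scaleR_right)
          (simp add: power2_eq_square algebra_simps)
    qed
    moreover have "?H \<bullet> mean_flow P - J \<bullet> ?H = ?H \<bullet> ?H" by (simp add: inner_diff_right inner_commute)
    ultimately show ?thesis by (simp add: algebra_simps)
  qed
  then have "?H \<bullet> ?H = 0" by (rule linear_coefficient_eq_0)
  then show ?thesis by simp
qed

text \<open>Since \<open>J = mean_flow P\<close>, weak duality with this same \<open>P\<close>
  becomes an equality for the graph of the flow.\<close>

lemma subgradient_attained:
  assumes J: "J \<in> subgradient (F \<mu>) P" and \<nu>: "weak_solution \<mu> P \<nu>"
  shows "\<nu> \<in> \<Lambda>_mean \<mu> J"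
    and "ereal (LINT z|\<nu>. (norm (snd z))\<^sup>2) = (INF \<xi>\<in>\<Lambda>_mean \<mu> J. ereal (LINT z|\<xi>. (norm (snd z))\<^sup>2))"
proof -
  have \<nu>_eq: "\<nu> = graph_measure (the_flow P)" using \<nu> weak_solution_iff[OF flow_the_flow] by blast
  show mem: "\<nu> \<in> \<Lambda>_mean \<mu> J"
    unfolding \<nu>_eq subgradient_imp_mean_flow[OF J] by (rule graph_measure_in_mean[OF flow_the_flow])
  show "ereal (LINT z|\<nu>. (norm (snd z))\<^sup>2) = (INF \<xi>\<in>\<Lambda>_mean \<mu> J. ereal (LINT z|\<xi>. (norm (snd z))\<^sup>2))"
  proof (rule antisym)
    show "ereal (LINT z|\<nu>. (norm (snd z))\<^sup>2) \<le> (INF \<xi>\<in>\<Lambda>_mean \<mu> J. ereal (LINT z|\<xi>. (norm (snd z))\<^sup>2))"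
    proof (rule INF_greatest)
      fix \<xi> assume "\<xi> \<in> \<Lambda>_mean \<mu> J"
      from mean_norm2_lower[OF this, of P]
      show "ereal (LINT z|\<nu>. (norm (snd z))\<^sup>2) \<le> ereal (LINT z|\<xi>. (norm (snd z))\<^sup>2)"
        by (simp add: \<nu>_eq graph_measure_norm2[OF flow_the_flow] F_eq_mean_flow
            subgradient_imp_mean_flow[OF J])
    qed
  qed (rule INF_lower[OF mem])
qed

end

section \<open>Gaussian integrals\<close>

lemma std_normal_density_has_derivative:
  "(std_normal_density has_real_derivative (- x * std_normal_density x)) (at x)"
proof -
  define c where "c = 1 / sqrt (2 * pi)"
  have "std_normal_density = (\<lambda>x. c * exp (- x\<^sup>2 / 2))"
    by (simp add: fun_eq_iff std_normal_density_def c_def)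
  then show ?thesis by (auto intro!: derivative_eq_intros simp: power2_eq_square)
qed

lemma std_normal_density_tendsto_0:
  "(std_normal_density \<longlongrightarrow> 0) at_top" "(std_normal_density \<longlongrightarrow> 0) at_bot"
proof -
  have e: "((\<lambda>x::real. exp (- (x\<^sup>2 / 2))) \<longlongrightarrow> 0) at_top"
  proof (rule filterlim_compose[OF exp_at_bot])
    show "filterlim (\<lambda>x::real. - (x\<^sup>2 / 2)) at_bot at_top" by real_asymp
  qed
  have "((\<lambda>x. 1 / sqrt (2 * pi) * exp (- (x\<^sup>2 / 2))) \<longlongrightarrow> 1 / sqrt (2 * pi) * 0) at_top"
    by (intro tendsto_mult tendsto_const e)
  then show top: "(std_normal_density \<longlongrightarrow> 0) at_top"
    by (simp add: std_normal_density_def[abs_def])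
  have "(\<lambda>x. std_normal_density (- x)) = std_normal_density"
    by (simp add: fun_eq_iff std_normal_density_def)
  then have "((\<lambda>x. std_normal_density (- x)) \<longlongrightarrow> 0) at_top" using top by (simp only:)
  then show "(std_normal_density \<longlongrightarrow> 0) at_bot"
    by (simp add: filterlim_at_bot_mirror)
qed

lemma integrable_std_normal_iexp:
  "integrable lborel (\<lambda>x. complex_of_real (std_normal_density x * x ^ k) * iexp (t * x))"
proof (rule Bochner_Integration.integrable_bound[OF integrable_std_normal_moment_abs[of k]])
  show "AE x in lborel. norm (complex_of_real (std_normal_density x * x ^ k) * iexp (t * x)) \<le>
      norm (std_normal_density x * \<bar>x\<bar> ^ k)"
    by (simp add: norm_mult abs_mult power_abs norm_exp_i_times norm_power)
qed measurable

lemma std_normal_iexp_moment_0: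
  "(CLINT x|lborel. complex_of_real (std_normal_density x) * iexp (t * x)) = complex_of_real (exp (- t\<^sup>2 / 2))"
proof -
  have "char std_normal_distribution t = (CLINT x|lborel. std_normal_density x *\<^sub>R iexp (t * x))"
    unfolding char_def by (subst integral_density) auto
  then show ?thesis by (simp add: char_std_normal_distribution scaleR_conv_of_real)
qed

text \<open>Gaussian integration by parts: \<open>?f\<close> is the derivative of \<open>?F\<close>,
  which vanishes at both ends, so the integral of \<open>?f\<close> is zero and the first moment
  reduces to the zeroth.\<close>

lemma std_normal_iexp_moment_1:
  "(CLINT x|lborel. complex_of_real (std_normal_density x * x) * iexp (t * x)) =
    \<i> * complex_of_real (t * exp (- t\<^sup>2 / 2))"
proof -
  let ?F = "\<lambda>x. complex_of_real (std_normal_density x) * iexp (t * x)"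
  let ?f = "\<lambda>x. \<i> * t * ?F x - complex_of_real (std_normal_density x * x) * iexp (t * x)"
  have i0: "integrable lborel ?F" using integrable_std_normal_iexp[of 0 t] by simp
  have i1: "integrable lborel (\<lambda>x. complex_of_real (std_normal_density x * x) * iexp (t * x))"
    using integrable_std_normal_iexp[of 1 t] by simp
  have i: "integrable lborel ?f"
    by (intro Bochner_Integration.integrable_diff integrable_mult_right i0 i1)
  have cont: "isCont ?f x" for x
    unfolding std_normal_density_def by (intro continuous_intros) auto
  have der: "(?F has_vector_derivative ?f x) (at x)" for x
  proof -
    have 1: "((\<lambda>x. complex_of_real (std_normal_density x)) has_vector_derivative
        complex_of_real (- x * std_normal_density x)) (at x)"
      using std_normal_density_has_derivative[of x]
      by (intro has_vector_derivative_of_real) (simp add: has_real_derivative_iff_has_vector_derivative)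
    have 2: "((\<lambda>x. iexp (t * x)) has_vector_derivative (\<i> * t * iexp (t * x))) (at x)"
    proof -
      have "((iexp \<circ> (\<lambda>x. t * x)) has_vector_derivative (t *\<^sub>R (\<i> * iexp (t * x)))) (at x)"
        by (intro vector_diff_chain_at has_vector_derivative_iexp)
          (auto intro!: derivative_eq_intros simp: has_real_derivative_iff_has_vector_derivative[symmetric])
      then show ?thesis by (simp add: o_def scaleR_conv_of_real mult_ac)
    qed
    from has_vector_derivative_mult[OF 1 2] show ?thesis by (simp add: mult_ac)
  qed
  have lim: "(?F \<longlongrightarrow> 0) at_top" "(?F \<longlongrightarrow> 0) at_bot"
    by (rule tendsto_norm_zero_cancel; simp add: norm_mult std_normal_density_tendsto_0 tendsto_rabs_zero)+
  have "(LBINT x=-\<infinity>..\<infinity>. ?f x) = 0 - 0"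
  proof (rule interval_integral_FTC_integrable[where F="?F"])
    show "set_integrable lborel (einterval (- \<infinity>) \<infinity>) ?f"
      using i by (simp add: set_integrable_def)
    show "((?F \<circ> real_of_ereal) \<longlongrightarrow> 0) (at_right (- \<infinity>))"
      "((?F \<circ> real_of_ereal) \<longlongrightarrow> 0) (at_left \<infinity>)"
      unfolding ereal_tendsto_simps by (rule lim)+
  qed (use der cont in auto)
  then have "(CLINT x|lborel. ?f x) = 0"
    by (simp add: interval_lebesgue_integral_def set_lebesgue_integral_def)
  then have "\<i> * t * (CLINT x|lborel. ?F x) - (CLINT x|lborel. complex_of_real (std_normal_density x * x) * iexp (t * x)) = 0"
    using i0 i1 by (subst (asm) Bochner_Integration.integral_diff) auto
  then have "(CLINT x|lborel. complex_of_real (std_normal_density x * x) * iexp (t * x)) =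
      \<i> * t * complex_of_real (exp (- t\<^sup>2 / 2))"
    unfolding std_normal_iexp_moment_0 by (rule eq_iff_diff_eq_0[THEN iffD2, symmetric])
  then show ?thesis by (simp only: of_real_mult mult.assoc)
qed

text \<open>The law of a standard Gaussian vector, taken as an image of a product measure so that
  Fourier integrals factor over the coordinates.\<close>

definition gaussian :: "(real^'n::finite) measure" where
  "gaussian = distr (PiM UNIV (\<lambda>_. std_normal_distribution)) borel (\<lambda>f. \<chi> i. f i)"

interpretation std_normal_product: product_prob_space "\<lambda>_::'i. std_normal_distribution" UNIV
  using real_dist_normal_dist by (intro product_prob_spaceI) (auto simp: real_distribution_def)

lemma vec_lambda_measurable [measurable]:
  "(\<lambda>f. \<chi> i. f i) \<in> PiM UNIV (\<lambda>_. std_normal_distribution) \<rightarrow>\<^sub>M (borel :: (real^'n::finite) measure)"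
proof (subst borel_measurable_euclidean_space, intro ballI)
  fix b :: "real^'n" assume "b \<in> Basis"
  then obtain i where i: "b = axis i 1" by (auto simp: Basis_vec_def)
  have "(\<lambda>f. f i) \<in> PiM UNIV (\<lambda>_. std_normal_distribution) \<rightarrow>\<^sub>M std_normal_distribution" by measurable
  then have "(\<lambda>f. f i) \<in> borel_measurable (PiM UNIV (\<lambda>_. std_normal_distribution))"
    by (simp cong: measurable_cong_sets)
  then show "(\<lambda>f. (\<chi> i. f i) \<bullet> b) \<in> borel_measurable (PiM UNIV (\<lambda>_. std_normal_distribution))"
    by (simp add: i inner_axis)
qed

lemma sets_gaussian [simp, measurable_cong]: "sets gaussian = sets borel"
  by (simp add: gaussian_def)

lemma space_gaussian [simp]: "space gaussian = UNIV"
  by (simp add: gaussian_def)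

interpretation gaussian: prob_space gaussian
  unfolding gaussian_def
  by (rule std_normal_product.prob_space_distr) measurable

lemma
  fixes f :: "'n::finite \<Rightarrow> real \<Rightarrow> complex"
  assumes f [measurable]: "\<And>i. f i \<in> borel_measurable borel"
    and int: "\<And>i. integrable lborel (\<lambda>x. std_normal_density x *\<^sub>R f i x)"
  shows gaussian_integral_prod:
      "(CLINT z|gaussian. (\<Prod>i\<in>UNIV. f i (z $ i))) = (\<Prod>i\<in>UNIV. CLINT x|lborel. std_normal_density x *\<^sub>R f i x)"
    and gaussian_integrable_prod: "integrable gaussian (\<lambda>z. \<Prod>i\<in>UNIV. f i (z $ i))"
proof -
  have i: "integrable std_normal_distribution (f i)" for i
    using int by (subst integrable_density) auto
  have m: "(\<lambda>z. \<Prod>i\<in>UNIV. f i (z $ i)) \<in> borel_measurable (borel :: (real^'n) measure)"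
  proof -
    have "(\<lambda>z::real^'n. z $ i) \<in> borel_measurable borel" for i
      by (intro borel_measurable_continuous_onI continuous_intros)
    then show ?thesis by (intro borel_measurable_prod measurable_compose[OF _ f])
  qed
  have "(CLINT z|gaussian. (\<Prod>i\<in>UNIV. f i (z $ i))) =
      (CLINT g|PiM UNIV (\<lambda>_. std_normal_distribution). (\<Prod>i\<in>UNIV. f i (g i)))"
    unfolding gaussian_def by (subst integral_distr[OF vec_lambda_measurable m]) simp
  also have "\<dots> = (\<Prod>i\<in>UNIV. CLINT x|std_normal_distribution. f i x)"
    by (rule std_normal_product.product_integral_prod) (auto intro: i)
  also have "\<dots> = (\<Prod>i\<in>UNIV. CLINT x|lborel. std_normal_density x *\<^sub>R f i x)"
    by (intro prod.cong refl integral_density) auto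
  finally show "(CLINT z|gaussian. (\<Prod>i\<in>UNIV. f i (z $ i))) = (\<Prod>i\<in>UNIV. CLINT x|lborel. std_normal_density x *\<^sub>R f i x)" .
  have "integrable (PiM UNIV (\<lambda>_. std_normal_distribution)) (\<lambda>g. \<Prod>i\<in>UNIV. f i (g i))"
    by (rule std_normal_product.product_integrable_prod) (auto intro: i)
  then show "integrable gaussian (\<lambda>z. \<Prod>i\<in>UNIV. f i (z $ i))"
    unfolding gaussian_def by (subst integrable_distr_eq[OF vec_lambda_measurable m]) simp
qed

lemma iexp_inner: "iexp (\<xi> \<bullet> z) = (\<Prod>i\<in>UNIV. iexp (\<xi> $ i * z $ i))"
  by (simp add: inner_vec_def exp_sum sum_distrib_left flip: of_real_mult)

lemma prod_exp_norm:
  "(\<Prod>i\<in>UNIV. complex_of_real (exp (- (\<xi> $ i)\<^sup>2 / 2))) = complex_of_real (exp (- (norm \<xi>)\<^sup>2 / 2))"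
  for \<xi> :: "real^'n::finite"
proof -
  have "(norm \<xi>)\<^sup>2 = (\<Sum>i\<in>UNIV. (\<xi> $ i)\<^sup>2)"
    unfolding power2_norm_eq_inner by (simp add: inner_vec_def power2_eq_square)
  then have "exp (- (norm \<xi>)\<^sup>2 / 2) = (\<Prod>i\<in>UNIV. exp (- (\<xi> $ i)\<^sup>2 / 2))"
    by (simp add: exp_sum[symmetric] sum_negf sum_divide_distrib[symmetric])
  then show ?thesis by simp
qed

lemma gaussian_iexp_moment_0:
  fixes \<xi> :: "real^'n::finite"
  shows "(CLINT z|gaussian. iexp (\<xi> \<bullet> z)) = complex_of_real (exp (- (norm \<xi>)\<^sup>2 / 2))"
    and "integrable gaussian (\<lambda>z. iexp (\<xi> \<bullet> z))"
proof -
  have 1: "integrable lborel (\<lambda>x. std_normal_density x *\<^sub>R iexp (\<xi> $ i * x))" for i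
    using integrable_std_normal_iexp[of 0 "\<xi> $ i"] by (simp add: scaleR_conv_of_real)
  have "(CLINT z|gaussian. iexp (\<xi> \<bullet> z)) = (\<Prod>i\<in>UNIV. CLINT x|lborel. std_normal_density x *\<^sub>R iexp (\<xi> $ i * x))"
    unfolding iexp_inner by (rule gaussian_integral_prod[OF _ 1]) measurable
  also have "\<dots> = (\<Prod>i\<in>UNIV. complex_of_real (exp (- (\<xi> $ i)\<^sup>2 / 2)))"
    using std_normal_iexp_moment_0 by (simp add: scaleR_conv_of_real)
  finally show "(CLINT z|gaussian. iexp (\<xi> \<bullet> z)) = complex_of_real (exp (- (norm \<xi>)\<^sup>2 / 2))"
    by (simp only: prod_exp_norm)
  show "integrable gaussian (\<lambda>z. iexp (\<xi> \<bullet> z))"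
    unfolding iexp_inner by (rule gaussian_integrable_prod[OF _ 1]) measurable
qed

lemma gaussian_iexp_moment_1:
  fixes \<xi> :: "real^'n::finite"
  shows "(CLINT z|gaussian. complex_of_real (z $ j) * iexp (\<xi> \<bullet> z)) =
      \<i> * complex_of_real (\<xi> $ j * exp (- (norm \<xi>)\<^sup>2 / 2))"
    and "integrable gaussian (\<lambda>z. complex_of_real (z $ j) * iexp (\<xi> \<bullet> z))"
proof -
  \<comment> \<open>The factor \<open>z $ j\<close> is absorbed into the j-th coordinate, so that
    the integrand is again a product.\<close>
  define f where "f i x = (if i = j then complex_of_real x else 1) * iexp (\<xi> $ i * x)" for i x
  have split: "(\<Prod>i\<in>UNIV. (if i = j then a else 1) * g i) = a * (\<Prod>i\<in>UNIV. g i)" for a :: complex and g :: "'n \<Rightarrow> complex"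
    by (simp add: prod.distrib)
  have eq: "complex_of_real (z $ j) * iexp (\<xi> \<bullet> z) = (\<Prod>i\<in>UNIV. f i (z $ i))" for z
    unfolding iexp_inner split[symmetric] f_def by (intro prod.cong refl) auto
  have m: "f i \<in> borel_measurable borel" for i unfolding f_def by measurable
  have 1: "integrable lborel (\<lambda>x. std_normal_density x *\<^sub>R f i x)" for i
    using integrable_std_normal_iexp[of 0 "\<xi> $ i"] integrable_std_normal_iexp[of 1 "\<xi> $ i"]
    by (cases "i = j") (simp_all add: scaleR_conv_of_real f_def mult.assoc)
  have v: "(CLINT x|lborel. std_normal_density x *\<^sub>R f i x) =
      (if i = j then \<i> * complex_of_real (\<xi> $ j) else 1) * complex_of_real (exp (- (\<xi> $ i)\<^sup>2 / 2))" for i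
    using std_normal_iexp_moment_0[of "\<xi> $ i"] std_normal_iexp_moment_1[of "\<xi> $ i"]
    by (cases "i = j") (simp_all add: scaleR_conv_of_real f_def mult.assoc)
  have "(CLINT z|gaussian. complex_of_real (z $ j) * iexp (\<xi> \<bullet> z)) =
      (\<Prod>i\<in>UNIV. CLINT x|lborel. std_normal_density x *\<^sub>R f i x)"
    unfolding eq by (rule gaussian_integral_prod[OF m 1])
  also have "\<dots> = \<i> * complex_of_real (\<xi> $ j) * complex_of_real (exp (- (norm \<xi>)\<^sup>2 / 2))"
    unfolding v split by (simp only: prod_exp_norm)
  finally show "(CLINT z|gaussian. complex_of_real (z $ j) * iexp (\<xi> \<bullet> z)) =
      \<i> * complex_of_real (\<xi> $ j * exp (- (norm \<xi>)\<^sup>2 / 2))" by simp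
  show "integrable gaussian (\<lambda>z. complex_of_real (z $ j) * iexp (\<xi> \<bullet> z))"
    unfolding eq by (rule gaussian_integrable_prod[OF m 1])
qed

lemma integrable_gaussian_norm: "integrable gaussian (\<lambda>z :: real^'n::finite. norm z)"
proof (rule Bochner_Integration.integrable_bound)
  have "integrable gaussian (\<lambda>z :: real^'n. \<bar>z $ j\<bar>)" for j
  proof -
    have "integrable gaussian (\<lambda>z :: real^'n. norm (complex_of_real (z $ j) * iexp (0 \<bullet> z)))"
      by (intro integrable_norm gaussian_iexp_moment_1(2))
    then show ?thesis by simp
  qed
  then show "integrable gaussian (\<lambda>z :: real^'n. \<Sum>j\<in>UNIV. \<bar>z $ j\<bar>)" by simp
  show "AE z :: real^'n in gaussian. norm (norm z) \<le> norm (\<Sum>j\<in>UNIV. \<bar>z $ j\<bar>)"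
    using norm_le_l1_cart by (auto simp: sum_nonneg)
qed measurable

lemma gaussian_cos:
  fixes \<xi> :: "real^'n::finite"
  shows "(LINT z|gaussian. cos (a + \<xi> \<bullet> z)) = exp (- (norm \<xi>)\<^sup>2 / 2) * cos a"
proof -
  have "(LINT z|gaussian. cos (a + \<xi> \<bullet> z)) = (LINT z|gaussian. Re (iexp a * iexp (\<xi> \<bullet> z)))"
    by (intro Bochner_Integration.integral_cong refl)
      (simp add: Re_exp flip: exp_add distrib_left of_real_add)
  also have "\<dots> = Re (CLINT z|gaussian. iexp a * iexp (\<xi> \<bullet> z))"
    by (intro integral_Re integrable_mult_right gaussian_iexp_moment_0)
  also have "\<dots> = Re (iexp a * complex_of_real (exp (- (norm \<xi>)\<^sup>2 / 2)))"
    by (simp only: integral_mult_right_zero gaussian_iexp_moment_0)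
  finally show ?thesis by (simp add: Re_exp)
qed

text \<open>The sine and the sign come from the real part of \<open>iexp a\<close> times the
  imaginary unit in the first moment.\<close>

lemma gaussian_cos_moment:
  fixes \<xi> :: "real^'n::finite"
  shows "(LINT z|gaussian. cos (a + \<xi> \<bullet> z) *\<^sub>R z) = (- exp (- (norm \<xi>)\<^sup>2 / 2) * sin a) *\<^sub>R \<xi>"
proof -
  have int: "integrable gaussian (\<lambda>z. cos (a + \<xi> \<bullet> z) *\<^sub>R z)"
    by (rule Bochner_Integration.integrable_bound[OF integrable_gaussian_norm])
      (auto intro!: mult_left_le_one_le abs_cos_le_one)
  have "(LINT z|gaussian. cos (a + \<xi> \<bullet> z) *\<^sub>R z) $ j = ((- exp (- (norm \<xi>)\<^sup>2 / 2) * sin a) *\<^sub>R \<xi>) $ j" for j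
  proof -
    have "(LINT z|gaussian. cos (a + \<xi> \<bullet> z) *\<^sub>R z) $ j = (LINT z|gaussian. (cos (a + \<xi> \<bullet> z) *\<^sub>R z) $ j)"
      using integral_bounded_linear[OF bounded_linear_vec_nth int] by simp
    also have "\<dots> = (LINT z|gaussian. Re (iexp a * (complex_of_real (z $ j) * iexp (\<xi> \<bullet> z))))"
    proof (intro Bochner_Integration.integral_cong refl)
      fix z :: "real^'n"
      have "iexp a * (complex_of_real (z $ j) * iexp (\<xi> \<bullet> z)) = complex_of_real (z $ j) * iexp (a + \<xi> \<bullet> z)"
        by (simp add: exp_add distrib_left)
      then have "Re (iexp a * (complex_of_real (z $ j) * iexp (\<xi> \<bullet> z))) = Re (complex_of_real (z $ j) * iexp (a + \<xi> \<bullet> z))"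
        by (simp only:)
      then show "(cos (a + \<xi> \<bullet> z) *\<^sub>R z) $ j = Re (iexp a * (complex_of_real (z $ j) * iexp (\<xi> \<bullet> z)))"
        by (simp add: Re_exp del: of_real_add)
    qed
    also have "\<dots> = Re (CLINT z|gaussian. iexp a * (complex_of_real (z $ j) * iexp (\<xi> \<bullet> z)))"
      by (intro integral_Re integrable_mult_right gaussian_iexp_moment_1)
    also have "\<dots> = Re (iexp a * (\<i> * complex_of_real (\<xi> $ j * exp (- (norm \<xi>)\<^sup>2 / 2))))"
      using gaussian_iexp_moment_1(1)[of j \<xi>] by simp
    finally show ?thesis by (simp add: Im_exp Re_exp)
  qed
  then show ?thesis by (simp add: vec_eq_iff)
qed

section \<open>The resolvent of the Laplacian\<close>

lemma le_if_le_add_mult_epsilon: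
  fixes a b C :: real
  assumes "\<And>e. e > 0 \<Longrightarrow> a \<le> b + e * C" and "C \<ge> 0"
  shows "a \<le> b"
proof (rule field_le_epsilon)
  fix e :: real assume e: "e > 0"
  have "a \<le> b + e / (C + 1) * C" using assms(2) e by (intro assms(1)) auto
  also have "e / (C + 1) * C \<le> e" using assms(2) e by (simp add: field_simps)
  finally show "a \<le> b + e" by simp
qed

section \<open>Gaussian averages and their fluxes\<close>

definition gauss_avg :: "real \<Rightarrow> (real^'n::finite \<Rightarrow> real) \<Rightarrow> real^'n \<Rightarrow> real" where
  "gauss_avg s f y = (LINT z|gaussian. f (y + s *\<^sub>R z))"

text \<open>\<open>gauss_avg s\<close> is the heat semigroup at time s^2 / 2, and for positive
  \<open>s\<close> the flux is formally \<open>s\<close> times its gradient: the derivative falls on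
  the Gaussian, so \<open>f\<close> need not be differentiable.\<close>

definition gauss_flux :: "real \<Rightarrow> (real^'n::finite \<Rightarrow> real) \<Rightarrow> real^'n \<Rightarrow> real^'n" where
  "gauss_flux s f y = (LINT z|gaussian. f (y + s *\<^sub>R z) *\<^sub>R z)"

definition gauss_norm :: "'n::finite itself \<Rightarrow> real" where
  "gauss_norm _ = (LINT z|(gaussian :: (real^'n) measure). norm z)"

lemma gauss_norm_nonneg: "0 \<le> gauss_norm t"
  unfolding gauss_norm_def by (intro Bochner_Integration.integral_nonneg) simp

text \<open>A class of functions on \<open>real^'n\<close>, because the semigroup law applies
  \<open>gauss_flux\<close> to the function \<open>gauss_avg\<close>, which lives there, and not
  only to lifts from the torus.\<close>

definition bounded_borel :: "(real^'n::finite \<Rightarrow> real) \<Rightarrow> bool" where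
  "bounded_borel f \<longleftrightarrow> f \<in> borel_measurable borel \<and> bounded (range f)"

lemma
  fixes f :: "real^'n::finite \<Rightarrow> real"
  assumes f: "bounded_borel f"
  shows gauss_avg_integrable: "integrable gaussian (\<lambda>z. f (y + s *\<^sub>R z))"
    and gauss_flux_integrable: "integrable gaussian (\<lambda>z. f (y + s *\<^sub>R z) *\<^sub>R z)"
proof -
  have [measurable]: "f \<in> borel_measurable borel" using f by (simp add: bounded_borel_def)
  obtain B where B: "\<And>y. \<bar>f y\<bar> \<le> B" using f by (auto simp: bounded_borel_def bounded_iff)
  show "integrable gaussian (\<lambda>z. f (y + s *\<^sub>R z))"
    using B by (intro gaussian.integrable_const_bound[of _ B]) auto
  have "norm (f (y + s *\<^sub>R z) *\<^sub>R z) \<le> norm (B * norm z)" for z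
    using B by (auto intro!: order_trans[OF mult_right_mono abs_ge_self])
  then show "integrable gaussian (\<lambda>z. f (y + s *\<^sub>R z) *\<^sub>R z)"
    by (intro Bochner_Integration.integrable_bound[OF integrable_mult_right[OF integrable_gaussian_norm]]) auto
qed

lemma
  fixes f :: "real^'n::finite \<Rightarrow> real"
  assumes f: "bounded_borel f" and B: "\<And>y. \<bar>f y\<bar> \<le> B"
  shows gauss_avg_le: "\<bar>gauss_avg s f y\<bar> \<le> B"
    and gauss_flux_le: "norm (gauss_flux s f y) \<le> B * gauss_norm TYPE('n)"
proof -
  have "\<bar>gauss_avg s f y\<bar> \<le> (LINT z|gaussian. \<bar>f (y + s *\<^sub>R z)\<bar>)"
    unfolding gauss_avg_def by (rule integral_abs_bound)
  also have "\<dots> \<le> (LINT z|(gaussian :: (real^'n) measure). B)"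
    using B gauss_avg_integrable[OF f] by (intro integral_mono) auto
  finally show "\<bar>gauss_avg s f y\<bar> \<le> B" by (simp add: gaussian.prob_space[unfolded space_gaussian])
  have "norm (gauss_flux s f y) \<le> (LINT z|gaussian. norm (f (y + s *\<^sub>R z) *\<^sub>R z))"
    unfolding gauss_flux_def by (rule integral_norm_bound)
  also have "\<dots> \<le> (LINT z|gaussian. B * norm (z :: real^'n))"
    using B by (intro integral_mono integrable_norm[OF gauss_flux_integrable[OF f]]
      integrable_mult_right integrable_gaussian_norm) (simp add: mult_right_mono)
  finally show "norm (gauss_flux s f y) \<le> B * gauss_norm TYPE('n)" by (simp add: gauss_norm_def)
qed

lemma
  assumes "bounded_borel f" "bounded_borel g"
  shows gauss_avg_add: "gauss_avg s (\<lambda>y. f y + g y) y = gauss_avg s f y + gauss_avg s g y"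
    and gauss_flux_add: "gauss_flux s (\<lambda>y. f y + g y) y = gauss_flux s f y + gauss_flux s g y"
    and gauss_avg_diff: "gauss_avg s (\<lambda>y. f y - g y) y = gauss_avg s f y - gauss_avg s g y"
    and gauss_flux_diff: "gauss_flux s (\<lambda>y. f y - g y) y = gauss_flux s f y - gauss_flux s g y"
  using assms[THEN gauss_avg_integrable, of y s] assms[THEN gauss_flux_integrable, of y s]
  by (simp_all add: gauss_avg_def gauss_flux_def scaleR_left_distrib scaleR_left_diff_distrib)

lemma gauss_avg_cmult: "gauss_avg s (\<lambda>y. c * f y) y = c * gauss_avg s f y"
  and gauss_flux_cmult: "gauss_flux s (\<lambda>y. c * f y) y = c *\<^sub>R gauss_flux s f y"
  by (simp_all add: gauss_avg_def gauss_flux_def flip: scaleR_scaleR)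

lemma gauss_avg_cos: "gauss_avg s (\<lambda>y. cos (\<xi> \<bullet> y + a)) y = exp (- (s * norm \<xi>)\<^sup>2 / 2) * cos (\<xi> \<bullet> y + a)"
proof -
  have "gauss_avg s (\<lambda>y. cos (\<xi> \<bullet> y + a)) y = (LINT z|gaussian. cos ((\<xi> \<bullet> y + a) + (s *\<^sub>R \<xi>) \<bullet> z))"
    by (simp add: gauss_avg_def inner_add_right algebra_simps)
  also have "\<dots> = exp (- (norm (s *\<^sub>R \<xi>))\<^sup>2 / 2) * cos (\<xi> \<bullet> y + a)" by (rule gaussian_cos)
  finally show ?thesis by (simp add: power_mult_distrib)
qed

lemma gauss_flux_cos:
  "gauss_flux s (\<lambda>y. cos (\<xi> \<bullet> y + a)) y = (- exp (- (s * norm \<xi>)\<^sup>2 / 2) * sin (\<xi> \<bullet> y + a) * s) *\<^sub>R \<xi>"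
proof -
  have "gauss_flux s (\<lambda>y. cos (\<xi> \<bullet> y + a)) y = (LINT z|gaussian. cos ((\<xi> \<bullet> y + a) + (s *\<^sub>R \<xi>) \<bullet> z) *\<^sub>R z)"
    by (simp add: gauss_flux_def inner_add_right algebra_simps)
  also have "\<dots> = (- exp (- (norm (s *\<^sub>R \<xi>))\<^sup>2 / 2) * sin (\<xi> \<bullet> y + a)) *\<^sub>R (s *\<^sub>R \<xi>)" by (rule gaussian_cos_moment)
  finally show ?thesis by (simp add: power_mult_distrib)
qed

abbreviation torus_lift :: "('n::finite torus \<Rightarrow> real) \<Rightarrow> real^'n \<Rightarrow> real" where
  "torus_lift \<psi> \<equiv> (\<lambda>y. \<psi> (torus_proj y))"

lemma bounded_borel_lift:
  assumes "continuous_on UNIV \<psi>"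
  shows "bounded_borel (torus_lift \<psi>)"
proof -
  have "torus_lift \<psi> \<in> borel_measurable borel"
    by (rule measurable_compose[OF torus_proj_measurable torus_measurable_continuous[OF assms]])
  then show ?thesis
    using torus_continuous_bounded[OF assms] by (auto simp: bounded_borel_def bounded_iff)
qed

lemma torus_proj_rep_add: "torus_proj (rep_torus (torus_proj y) + u) = torus_proj (y + u)"
  using rep_torus_proj_diff[of y] by (simp add: torus_proj_eq_iff)

text \<open>Waves are eigenfunctions of Gaussian averaging. The identities for trigonometric
  polynomials below reduce to these two formulas.\<close>

lemma
  fixes k :: "real^'n::finite"
  assumes k: "\<And>i. k $ i \<in> \<int>"
  shows gauss_avg_wave: "gauss_avg s (torus_lift (torus_wave k a)) y =
      exp (- (s * norm ((2 * pi) *\<^sub>R k))\<^sup>2 / 2) * torus_wave k a (torus_proj y)"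
    and gauss_flux_wave: "gauss_flux s (torus_lift (torus_wave k a)) y =
      (exp (- (s * norm ((2 * pi) *\<^sub>R k))\<^sup>2 / 2) * s) *\<^sub>R torus_grad (torus_wave k a) (torus_proj y)"
proof -
  have w: "torus_lift (torus_wave k b) = (\<lambda>y. cos (((2 * pi) *\<^sub>R k) \<bullet> y + b))" for b
    by (simp add: torus_wave_proj[OF k] fun_eq_iff)
  then have w': "torus_wave k b (torus_proj y) = cos (((2 * pi) *\<^sub>R k) \<bullet> y + b)" for b y by metis
  show "gauss_avg s (torus_lift (torus_wave k a)) y =
      exp (- (s * norm ((2 * pi) *\<^sub>R k))\<^sup>2 / 2) * torus_wave k a (torus_proj y)"
    unfolding w gauss_avg_cos w' by simp
  have "cos (((2 * pi) *\<^sub>R k) \<bullet> y + (a + pi / 2)) = - sin (((2 * pi) *\<^sub>R k) \<bullet> y + a)"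
    using cos_add[of "((2 * pi) *\<^sub>R k) \<bullet> y + a" "pi / 2"] by (simp add: add.assoc)
  then show "gauss_flux s (torus_lift (torus_wave k a)) y =
      (exp (- (s * norm ((2 * pi) *\<^sub>R k))\<^sup>2 / 2) * s) *\<^sub>R torus_grad (torus_wave k a) (torus_proj y)"
    unfolding w gauss_flux_cos torus_grad_wave[OF k] w' by (simp add: algebra_simps)
qed

text \<open>On a wave both sides are explicit multiples of the gradient of the wave, which avoids
  differentiating under the integral sign.\<close>

lemma gauss_avg_trig_gradient:
  assumes "trig_poly \<psi>" "s > 0"
  shows "GDERIV (gauss_avg s (torus_lift \<psi>)) y :> (1 / s) *\<^sub>R gauss_flux s (torus_lift \<psi>) y"
  using assms
proof induction
  case (wave k c a)
  let ?e = "exp (- (s * norm ((2 * pi) *\<^sub>R k))\<^sup>2 / 2)"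
  have "GDERIV (\<lambda>y. (c * ?e) * torus_wave k a (torus_proj y)) y :>
      torus_grad (\<lambda>x. (c * ?e) * torus_wave k a x) (torus_proj y)"
    by (intro torus_C1_GDERIV torus_C1_cmult torus_C1_wave wave)
  moreover have "gauss_avg s (torus_lift (\<lambda>x. c * torus_wave k a x)) =
      (\<lambda>y. (c * ?e) * torus_wave k a (torus_proj y))"
    using gauss_avg_wave[OF wave(1)] by (simp add: fun_eq_iff gauss_avg_cmult)
  moreover have "(1 / s) *\<^sub>R gauss_flux s (torus_lift (\<lambda>x. c * torus_wave k a x)) y =
      torus_grad (\<lambda>x. (c * ?e) * torus_wave k a x) (torus_proj y)"
    using gauss_flux_wave[OF wave(1)] wave(2)
    by (simp add: gauss_flux_cmult torus_grad_cmult[OF torus_C1_wave[OF wave(1)]])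
  ultimately show ?case by (simp only:)
next
  case (add \<psi> G)
  note m = add(1,2)[THEN trig_poly_continuous, THEN bounded_borel_lift]
  have "gauss_avg s (torus_lift (\<lambda>x. \<psi> x + G x)) = (\<lambda>y. gauss_avg s (torus_lift \<psi>) y + gauss_avg s (torus_lift G) y)"
    by (rule ext) (rule gauss_avg_add[OF m])
  then show ?case
    using GDERIV_add[OF add.IH(1)[OF add.prems] add.IH(2)[OF add.prems]]
    by (simp add: gauss_flux_add[OF m] scaleR_add_right)
qed

text \<open>The gradient is the flux divided by \<open>s\<close>, and the flux is controlled by the
  sup bound \<open>B\<close> alone. As no derivative of \<psi> enters, bounds built on this one
  survive uniform approximation.\<close>

lemma gauss_avg_trig_lipschitz:
  fixes \<psi> :: "'n::finite torus \<Rightarrow> real"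
  assumes \<psi>: "trig_poly \<psi>" "\<And>x. \<bar>\<psi> x\<bar> \<le> B" and s: "s > 0"
  shows "\<bar>gauss_avg s (torus_lift \<psi>) y - gauss_avg s (torus_lift \<psi>) y'\<bar> \<le> B * gauss_norm TYPE('n) / s * norm (y - y')"
proof (rule GDERIV_lipschitz[OF gauss_avg_trig_gradient[OF \<psi>(1) s]])
  show "norm ((1 / s) *\<^sub>R gauss_flux s (torus_lift \<psi>) x) \<le> B * gauss_norm TYPE('n) / s" for x
    using gauss_flux_le[OF bounded_borel_lift[OF trig_poly_continuous[OF \<psi>(1)]], of B s x] \<psi>(2) s
    by (simp add: divide_right_mono)
qed

lemma bounded_borel_gauss_avg_trig:
  assumes \<psi>: "trig_poly \<psi>" and s: "s > 0"
  shows "bounded_borel (gauss_avg s (torus_lift \<psi>))"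
proof -
  note m = bounded_borel_lift[OF trig_poly_continuous[OF \<psi>]]
  obtain B where "\<And>y. \<bar>torus_lift \<psi> y\<bar> \<le> B" using m by (auto simp: bounded_borel_def bounded_iff)
  then have "\<bar>gauss_avg s (torus_lift \<psi>) y\<bar> \<le> B" for y by (rule gauss_avg_le[OF m])
  moreover have "continuous_on UNIV (gauss_avg s (torus_lift \<psi>))"
    using gauss_avg_trig_gradient[OF \<psi> s]
    by (auto simp: gderiv_def continuous_on_eq_continuous_at intro: has_derivative_continuous)
  ultimately show ?thesis
    by (auto simp: bounded_borel_def bounded_iff intro: borel_measurable_continuous_onI)
qed

lemma trig_poly_approx:
  fixes \<psi> :: "'n::finite torus \<Rightarrow> real"
  assumes \<psi>: "continuous_on UNIV \<psi>" and e: "e > 0"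
  shows "\<exists>G. trig_poly G \<and> (\<forall>x. \<bar>\<psi> x - G x\<bar> \<le> e)"
proof -
  obtain g where g: "\<And>j. trig_poly (g j)" "uniform_limit UNIV g \<psi> sequentially"
    using trig_poly_dense[OF \<psi>] by blast
  from uniform_limitD[OF g(2) e] obtain j where "\<forall>x\<in>UNIV. dist (g j x) (\<psi> x) < e"
    by (auto simp: eventually_sequentially)
  then have "\<bar>\<psi> x - g j x\<bar> \<le> e" for x by (auto simp: dist_real_def abs_minus_commute intro: less_imp_le)
  then show ?thesis using g(1) by blast
qed

text \<open>Variances add, so two averages at scale \<sigma> make one at scale
  \<open>sqrt 2 * \<sigma>\<close>. The outer \<open>sqrt 2\<close> appears because the flux carries
  the scale as a factor.\<close>

lemma gauss_flux_semigroup_trig: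
  assumes "trig_poly \<psi>" "\<sigma> > 0"
  shows "gauss_flux (sqrt 2 * \<sigma>) (torus_lift \<psi>) y = sqrt 2 *\<^sub>R gauss_flux \<sigma> (gauss_avg \<sigma> (torus_lift \<psi>)) y"
  using assms
proof induction
  case (wave k c a)
  let ?w = "torus_lift (torus_wave k a)"
  let ?e = "exp (- (\<sigma> * norm ((2 * pi) *\<^sub>R k))\<^sup>2 / 2)"
  have avg: "gauss_avg \<sigma> (torus_lift (\<lambda>x. c * torus_wave k a x)) = (\<lambda>y. (c * ?e) * ?w y)"
    using gauss_avg_wave[OF wave(1)] by (simp add: fun_eq_iff gauss_avg_cmult)
  have "exp (- (sqrt 2 * \<sigma> * norm ((2 * pi) *\<^sub>R k))\<^sup>2 / 2) = ?e * ?e"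
    by (simp add: power_mult_distrib flip: exp_add)
  then show ?case
    unfolding avg gauss_flux_cmult gauss_flux_wave[OF wave(1)] by simp
next
  case (add \<psi> G)
  note m = add(1,2)[THEN trig_poly_continuous, THEN bounded_borel_lift]
  note mc = bounded_borel_gauss_avg_trig[OF add(1) add.prems] bounded_borel_gauss_avg_trig[OF add(2) add.prems]
  have "gauss_avg \<sigma> (torus_lift (\<lambda>x. \<psi> x + G x)) = (\<lambda>y. gauss_avg \<sigma> (torus_lift \<psi>) y + gauss_avg \<sigma> (torus_lift G) y)"
    by (rule ext) (rule gauss_avg_add[OF m])
  then show ?case
    using add.IH[OF add.prems] by (simp add: gauss_flux_add[OF m] gauss_flux_add[OF mc] scaleR_add_right)
qed

text \<open>The semigroup law spreads the smoothing over two Gaussian averages: the inner one is Lipschitz by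
  its gradient bound, and the outer flux preserves this.\<close>

lemma gauss_flux_trig_lipschitz:
  fixes \<psi> :: "'n::finite torus \<Rightarrow> real"
  assumes \<psi>: "trig_poly \<psi>" "\<And>x. \<bar>\<psi> x\<bar> \<le> B" and s: "s > 0"
  shows "norm (gauss_flux s (torus_lift \<psi>) y - gauss_flux s (torus_lift \<psi>) y') \<le>
    2 * B * (gauss_norm TYPE('n))\<^sup>2 / s * norm (y - y')"
proof -
  define \<sigma> where "\<sigma> = s / sqrt 2"
  have \<sigma>: "\<sigma> > 0" "s = sqrt 2 * \<sigma>" using s by (auto simp: \<sigma>_def)
  let ?K = "gauss_norm TYPE('n)" and ?g = "gauss_avg \<sigma> (torus_lift \<psi>)"
  define L where "L = B * ?K / \<sigma> * norm (y - y')"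
  have i: "integrable gaussian (\<lambda>z. ?g (u + \<sigma> *\<^sub>R z) *\<^sub>R z)" for u
    by (rule gauss_flux_integrable[OF bounded_borel_gauss_avg_trig[OF \<psi>(1) \<sigma>(1)]])
  have "gauss_flux \<sigma> ?g y - gauss_flux \<sigma> ?g y' =
      (LINT z|gaussian. (?g (y + \<sigma> *\<^sub>R z) - ?g (y' + \<sigma> *\<^sub>R z)) *\<^sub>R z)"
    unfolding gauss_flux_def scaleR_left_diff_distrib by (rule Bochner_Integration.integral_diff[OF i i, symmetric])
  also have "norm \<dots> \<le> (LINT z|gaussian. norm ((?g (y + \<sigma> *\<^sub>R z) - ?g (y' + \<sigma> *\<^sub>R z)) *\<^sub>R z))"
    by (rule integral_norm_bound)
  also have "\<dots> \<le> (LINT z|gaussian. L * norm (z :: real^'n))"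
  proof (rule integral_mono)
    show "integrable gaussian (\<lambda>z. norm ((?g (y + \<sigma> *\<^sub>R z) - ?g (y' + \<sigma> *\<^sub>R z)) *\<^sub>R z))"
      unfolding scaleR_left_diff_distrib by (intro integrable_norm Bochner_Integration.integrable_diff i)
    show "integrable gaussian (\<lambda>z. L * norm (z :: real^'n))" by (intro integrable_mult_right integrable_gaussian_norm)
    show "norm ((?g (y + \<sigma> *\<^sub>R z) - ?g (y' + \<sigma> *\<^sub>R z)) *\<^sub>R z) \<le> L * norm z" for z
      using mult_right_mono[OF gauss_avg_trig_lipschitz[OF \<psi> \<sigma>(1), of "y + \<sigma> *\<^sub>R z" "y' + \<sigma> *\<^sub>R z"] norm_ge_zero[of z]]
      by (simp add: L_def)
  qed
  also have "\<dots> = L * ?K" by (simp add: gauss_norm_def)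
  finally have "norm (gauss_flux \<sigma> ?g y - gauss_flux \<sigma> ?g y') \<le> L * ?K" .
  then have "sqrt 2 * norm (gauss_flux \<sigma> ?g y - gauss_flux \<sigma> ?g y') \<le> sqrt 2 * (L * ?K)"
    by (intro mult_left_mono) auto
  moreover have "gauss_flux s (torus_lift \<psi>) y - gauss_flux s (torus_lift \<psi>) y' =
      sqrt 2 *\<^sub>R (gauss_flux \<sigma> ?g y - gauss_flux \<sigma> ?g y')"
    unfolding \<sigma>(2) gauss_flux_semigroup_trig[OF \<psi>(1) \<sigma>(1)] by (simp add: scaleR_diff_right)
  \<comment> \<open>The factor 2 arises from two factors \<open>sqrt 2\<close>: one from the
    semigroup law, the other from \<open>1 / \<sigma> = sqrt 2 / s\<close>.\<close>
  moreover have "sqrt 2 * (L * ?K) = 2 * B * ?K\<^sup>2 / s * norm (y - y')"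
  proof -
    have "sqrt 2 * (L * ?K) = (sqrt 2 * sqrt 2) * B * ?K\<^sup>2 / (sqrt 2 * \<sigma>) * norm (y - y')"
      using \<sigma>(1) by (simp add: L_def power2_eq_square field_simps)
    then show ?thesis by (simp flip: \<sigma>(2))
  qed
  ultimately show ?thesis by simp
qed

text \<open>A trigonometric polynomial within \<open>e\<close> of \<psi> has sup bound
  \<open>B + e\<close>, and its flux differs by at most \<open>e\<close> times
  \<open>gauss_norm\<close> at each of the two points. Then \<open>e\<close> tends to 0.\<close>

lemma gauss_flux_lipschitz:
  fixes \<psi> :: "'n::finite torus \<Rightarrow> real"
  assumes \<psi>: "continuous_on UNIV \<psi>" "\<And>x. \<bar>\<psi> x\<bar> \<le> B" and s: "s > 0"
  shows "norm (gauss_flux s (torus_lift \<psi>) y - gauss_flux s (torus_lift \<psi>) y') \<le>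
    2 * B * (gauss_norm TYPE('n))\<^sup>2 / s * norm (y - y')"
proof -
  let ?K = "gauss_norm TYPE('n)" and ?V = "\<lambda>f :: 'n torus \<Rightarrow> real. gauss_flux s (torus_lift f)"
  define c where "c = 2 * ?K\<^sup>2 / s * norm (y - y')"
  have "norm (?V \<psi> y - ?V \<psi> y') \<le> B * c"
  proof (rule le_if_le_add_mult_epsilon[where C="2 * ?K + c"])
    fix e :: real assume e: "e > 0"
    obtain G where G: "trig_poly G" "\<And>x. \<bar>\<psi> x - G x\<bar> \<le> e" using trig_poly_approx[OF \<psi>(1) e] by blast
    have cG: "continuous_on UNIV G" by (rule trig_poly_continuous[OF G(1)])
    have "\<bar>G x\<bar> \<le> B + e" for x using \<psi>(2)[of x] G(2)[of x] by linarith
    then have "norm (?V G y - ?V G y') \<le> 2 * (B + e) * ?K\<^sup>2 / s * norm (y - y')"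
      by (rule gauss_flux_trig_lipschitz[OF G(1) _ s])
    also have "\<dots> = (B + e) * c" by (simp add: c_def)
    finally have 1: "norm (?V G y - ?V G y') \<le> (B + e) * c" .
    have 2: "norm (?V \<psi> u - ?V G u) \<le> e * ?K" for u
      using gauss_flux_le[OF bounded_borel_lift[OF continuous_on_diff[OF \<psi>(1) cG]], of e s u] G(2)
      unfolding gauss_flux_diff[OF bounded_borel_lift[OF \<psi>(1)] bounded_borel_lift[OF cG]] by blast
    have "?V \<psi> y - ?V \<psi> y' = (?V \<psi> y - ?V G y) + (?V G y - ?V G y') - (?V \<psi> y' - ?V G y')" by simp
    also have "norm \<dots> \<le> norm (?V \<psi> y - ?V G y) + norm (?V G y - ?V G y') + norm (?V \<psi> y' - ?V G y')"
      by (rule order_trans[OF norm_triangle_ineq4 add_right_mono[OF norm_triangle_ineq]])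
    also have "\<dots> \<le> e * ?K + (B + e) * c + e * ?K" by (intro add_mono 1 2)
    finally show "norm (?V \<psi> y - ?V \<psi> y') \<le> B * c + e * (2 * ?K + c)" by (simp add: algebra_simps)
  next
    show "0 \<le> 2 * ?K + c"
      using s unfolding c_def
      by (intro add_nonneg_nonneg mult_nonneg_nonneg divide_nonneg_nonneg gauss_norm_nonneg) auto
  qed
  then show ?thesis by (simp add: c_def mult_ac)
qed

text \<open>Integrated against \<open>rayleigh_weight\<close>, the Fourier multiplier \<open>exp (- s\<^sup>2 q / 2)\<close> of the Gaussian average,
  \<open>q = |2 \<pi> k|\<^sup>2\<close>, becomes \<open>1 / (1 + q)\<close>, the multiplier of \<open>(1 - laplacian)\<^sup>-\<^sup>1\<close>.\<close>

definition rayleigh_weight :: "real \<Rightarrow> real" where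
  "rayleigh_weight s = indicator {0..} s * (s * exp (- s\<^sup>2 / 2))"

text \<open>On the half line this is \<open>rayleigh_weight\<close> divided by \<open>s\<close>; the
  division comes from the gradient of \<open>gauss_avg\<close>, which is the flux over
  \<open>s\<close>.\<close>

definition half_gauss_weight :: "real \<Rightarrow> real" where
  "half_gauss_weight s = indicator {0..} s * exp (- s\<^sup>2 / 2)"

lemma weight_measurable [measurable]:
  "rayleigh_weight \<in> borel_measurable borel" "half_gauss_weight \<in> borel_measurable borel"
  unfolding rayleigh_weight_def[abs_def] half_gauss_weight_def[abs_def] by measurable

lemma weight_nonneg: "0 \<le> rayleigh_weight s" "0 \<le> half_gauss_weight s"
  by (auto simp: rayleigh_weight_def half_gauss_weight_def indicator_def)

lemma rayleigh_weight_has_integral: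
  assumes q: "0 \<le> q"
  shows "has_bochner_integral lborel (\<lambda>s. rayleigh_weight s * exp (- s\<^sup>2 * q / 2)) (1 / (1 + q))"
proof -
  define c where "c = 1 + q"
  have c: "c > 0" using q by (simp add: c_def)
  let ?f = "\<lambda>s::real. s * exp (- s\<^sup>2 * c / 2)" and ?F = "\<lambda>s::real. - exp (- s\<^sup>2 * c / 2) / c"
  have eq: "rayleigh_weight s * exp (- s\<^sup>2 * q / 2) = ?f s * indicator {0..} s" for s
    by (simp add: rayleigh_weight_def c_def algebra_simps add_divide_distrib flip: exp_add)
  have "(\<integral>\<^sup>+s. ennreal (?f s) * indicator {0..} s \<partial>lborel) = ennreal (0 - ?F 0)"
  proof (rule nn_integral_FTC_atLeast)
    show "DERIV ?F s :> ?f s" for s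
      using c by (auto intro!: derivative_eq_intros)
    have "((\<lambda>s::real. exp (- (c / 2 * s\<^sup>2))) \<longlongrightarrow> 0) at_top"
    proof (rule filterlim_compose[OF exp_at_bot])
      have "filterlim (\<lambda>s::real. c / 2 * s\<^sup>2) at_top at_top"
        using c by (intro filterlim_tendsto_pos_mult_at_top[OF tendsto_const]) (auto intro!: filterlim_pow_at_top filterlim_ident)
      then show "filterlim (\<lambda>s::real. - (c / 2 * s\<^sup>2)) at_bot at_top"
        by (simp add: filterlim_uminus_at_bot)
    qed
    then have "((\<lambda>s::real. - exp (- (c / 2 * s\<^sup>2)) / c) \<longlongrightarrow> - 0 / c) at_top"
      using c by (intro tendsto_intros) auto
    then show "(?F \<longlongrightarrow> 0) at_top" by (simp add: mult.commute)
  qed auto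
  then have "(\<integral>\<^sup>+s. ennreal (?f s * indicator {0..} s) \<partial>lborel) = ennreal (1 / c)"
    by (simp add: ennreal_mult'' ennreal_indicator)
  then show ?thesis
    unfolding eq c_def[symmetric] using c by (intro has_bochner_integral_nn_integral) (auto simp: indicator_def)
qed

lemma rayleigh_weight_integrable: "integrable lborel rayleigh_weight"
  and rayleigh_weight_integral: "(LINT s|lborel. rayleigh_weight s) = 1"
  using rayleigh_weight_has_integral[of 0] by (auto simp: has_bochner_integral_iff)

lemma half_gauss_weight_integrable: "integrable lborel half_gauss_weight"
proof (rule Bochner_Integration.integrable_bound)
  show "integrable lborel (\<lambda>s. sqrt (2 * pi) * std_normal_density s)"
    using integrable_std_normal_moment[of 0] by simp
  show "AE s in lborel. norm (half_gauss_weight s) \<le> norm (sqrt (2 * pi) * std_normal_density s)"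
    by (auto simp: half_gauss_weight_def std_normal_density_def indicator_def)
qed measurable

text \<open>The Laplace transform at 1 of the heat semigroup: with time t = s^2 / 2 the measure
  exp(-t) dt becomes \<open>rayleigh_weight s\<close> ds.\<close>

definition resolvent :: "('n::finite torus \<Rightarrow> real) \<Rightarrow> 'n torus \<Rightarrow> real" where
  "resolvent \<psi> x = (LINT s|lborel. rayleigh_weight s * gauss_avg s (torus_lift \<psi>) (rep_torus x))"

definition resolvent_grad :: "('n::finite torus \<Rightarrow> real) \<Rightarrow> 'n torus \<Rightarrow> real^'n" where
  "resolvent_grad \<psi> x = (LINT s|lborel. half_gauss_weight s *\<^sub>R gauss_flux s (torus_lift \<psi>) (rep_torus x))"

text \<open>Any lift may replace \<open>rep_torus\<close>. Continuity estimates need this freedom,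
  since two nearby lifts may have distant chosen representatives.\<close>

lemma resolvent_grad_proj:
  "resolvent_grad \<psi> (torus_proj y) = (LINT s|lborel. half_gauss_weight s *\<^sub>R gauss_flux s (torus_lift \<psi>) y)"
  by (simp add: resolvent_grad_def gauss_flux_def torus_proj_rep_add)

definition resolvent_grad_bound :: "'n::finite itself \<Rightarrow> real" where
  "resolvent_grad_bound t = (LINT s|lborel. half_gauss_weight s) * gauss_norm t"

lemma resolvent_grad_bound_nonneg: "0 \<le> resolvent_grad_bound t"
  unfolding resolvent_grad_bound_def
  by (intro mult_nonneg_nonneg gauss_norm_nonneg Bochner_Integration.integral_nonneg weight_nonneg)

lemma
  fixes \<psi> :: "'n::finite torus \<Rightarrow> real"
  assumes \<psi>: "continuous_on UNIV \<psi>" and B: "\<And>x. \<bar>\<psi> x\<bar> \<le> B"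
  shows resolvent_integrable: "integrable lborel (\<lambda>s. rayleigh_weight s * gauss_avg s (torus_lift \<psi>) y)"
    and resolvent_grad_integrable: "integrable lborel (\<lambda>s. half_gauss_weight s *\<^sub>R gauss_flux s (torus_lift \<psi>) y)"
    and resolvent_le: "\<bar>resolvent \<psi> x\<bar> \<le> B"
    and resolvent_grad_le: "norm (resolvent_grad \<psi> x) \<le> B * resolvent_grad_bound TYPE('n)"
proof -
  let ?K = "gauss_norm TYPE('n)"
  note m = bounded_borel_lift[OF \<psi>]
  have [measurable]: "torus_lift \<psi> \<in> borel_measurable borel" using m by (simp add: bounded_borel_def)
  have [measurable]: "(\<lambda>s. gauss_avg s (torus_lift \<psi>) y) \<in> borel_measurable borel"
    "(\<lambda>s. gauss_flux s (torus_lift \<psi>) y) \<in> borel_measurable borel" for y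
    unfolding gauss_avg_def gauss_flux_def by measurable
  have le1: "norm (rayleigh_weight s * gauss_avg s (torus_lift \<psi>) y) \<le> B * rayleigh_weight s" for s y
    using gauss_avg_le[OF m B, of s y] weight_nonneg(1)[of s]
    by (simp add: abs_mult mult.commute[of _ "rayleigh_weight s"] mult_left_mono)
  have le2: "norm (half_gauss_weight s *\<^sub>R gauss_flux s (torus_lift \<psi>) y) \<le> B * ?K * half_gauss_weight s" for s y
    using gauss_flux_le[OF m B, of s y] weight_nonneg(2)[of s]
    by (simp add: mult.commute[of _ "half_gauss_weight s"] mult_left_mono)
  have i1: "integrable lborel (\<lambda>s. B * rayleigh_weight s)" by (intro integrable_mult_right rayleigh_weight_integrable)
  have i2: "integrable lborel (\<lambda>s. B * ?K * half_gauss_weight s)" by (intro integrable_mult_right half_gauss_weight_integrable)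
  show 1: "integrable lborel (\<lambda>s. rayleigh_weight s * gauss_avg s (torus_lift \<psi>) y)" for y
    by (rule Bochner_Integration.integrable_bound[OF i1]) (measurable, use le1 in \<open>auto intro: order_trans[OF _ abs_ge_self]\<close>)
  show 2: "integrable lborel (\<lambda>s. half_gauss_weight s *\<^sub>R gauss_flux s (torus_lift \<psi>) y)" for y
    by (rule Bochner_Integration.integrable_bound[OF i2]) (measurable, use le2 in \<open>auto intro: order_trans[OF _ abs_ge_self]\<close>)
  have "norm (resolvent \<psi> x) \<le> (LINT s|lborel. norm (rayleigh_weight s * gauss_avg s (torus_lift \<psi>) (rep_torus x)))"
    unfolding resolvent_def by (rule integral_norm_bound)
  also have "\<dots> \<le> (LINT s|lborel. B * rayleigh_weight s)"
    by (intro integral_mono integrable_norm 1 i1 le1)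
  finally show "\<bar>resolvent \<psi> x\<bar> \<le> B" by (simp add: rayleigh_weight_integral)
  have "norm (resolvent_grad \<psi> x) \<le> (LINT s|lborel. norm (half_gauss_weight s *\<^sub>R gauss_flux s (torus_lift \<psi>) (rep_torus x)))"
    unfolding resolvent_grad_def by (rule integral_norm_bound)
  also have "\<dots> \<le> (LINT s|lborel. B * ?K * half_gauss_weight s)"
    by (intro integral_mono integrable_norm 2 i2 le2)
  finally show "norm (resolvent_grad \<psi> x) \<le> B * resolvent_grad_bound TYPE('n)"
    by (simp add: resolvent_grad_bound_def mult_ac)
qed

lemma
  fixes \<psi> G :: "'n::finite torus \<Rightarrow> real"
  assumes \<psi>: "continuous_on UNIV \<psi>" and G: "continuous_on UNIV G"
  shows resolvent_add: "resolvent (\<lambda>x. \<psi> x + G x) x = resolvent \<psi> x + resolvent G x"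
    and resolvent_grad_add: "resolvent_grad (\<lambda>x. \<psi> x + G x) x = resolvent_grad \<psi> x + resolvent_grad G x"
    and resolvent_diff: "resolvent (\<lambda>x. \<psi> x - G x) x = resolvent \<psi> x - resolvent G x"
    and resolvent_grad_diff: "resolvent_grad (\<lambda>x. \<psi> x - G x) x = resolvent_grad \<psi> x - resolvent_grad G x"
proof -
  obtain B C where B: "\<And>x. \<bar>\<psi> x\<bar> \<le> B" and C: "\<And>x. \<bar>G x\<bar> \<le> C"
    using torus_continuous_bounded[OF \<psi>] torus_continuous_bounded[OF G] by auto
  note m = bounded_borel_lift[OF \<psi>] bounded_borel_lift[OF G]
  note i = resolvent_integrable[OF \<psi> B] resolvent_integrable[OF G C]
    resolvent_grad_integrable[OF \<psi> B] resolvent_grad_integrable[OF G C]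
  show "resolvent (\<lambda>x. \<psi> x + G x) x = resolvent \<psi> x + resolvent G x"
    unfolding resolvent_def gauss_avg_add[OF m] distrib_left using i by simp
  show "resolvent_grad (\<lambda>x. \<psi> x + G x) x = resolvent_grad \<psi> x + resolvent_grad G x"
    unfolding resolvent_grad_def gauss_flux_add[OF m] scaleR_add_right using i by simp
  show "resolvent (\<lambda>x. \<psi> x - G x) x = resolvent \<psi> x - resolvent G x"
    unfolding resolvent_def gauss_avg_diff[OF m] right_diff_distrib using i by simp
  show "resolvent_grad (\<lambda>x. \<psi> x - G x) x = resolvent_grad \<psi> x - resolvent_grad G x"
    unfolding resolvent_grad_def gauss_flux_diff[OF m] scaleR_diff_right using i by simp
qed

lemma resolvent_cmult: "resolvent (\<lambda>x. c * \<psi> x) x = c * resolvent \<psi> x"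
  by (simp add: resolvent_def gauss_avg_cmult mult.left_commute)

lemma resolvent_grad_cmult: "resolvent_grad (\<lambda>x. c * \<psi> x) x = c *\<^sub>R resolvent_grad \<psi> x"
proof -
  have "resolvent_grad (\<lambda>x. c * \<psi> x) x =
      (LINT s|lborel. c *\<^sub>R (half_gauss_weight s *\<^sub>R gauss_flux s (torus_lift \<psi>) (rep_torus x)))"
    by (simp add: resolvent_grad_def gauss_flux_cmult mult.commute)
  then show ?thesis unfolding resolvent_grad_def by (simp only: integral_scaleR_right)
qed

lemma
  fixes k :: "real^'n::finite"
  assumes k: "\<And>i. k $ i \<in> \<int>"
  shows resolvent_wave: "resolvent (torus_wave k a) x = 1 / (1 + (norm ((2 * pi) *\<^sub>R k))\<^sup>2) * torus_wave k a x"
    and resolvent_grad_wave: "resolvent_grad (torus_wave k a) x =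
      (1 / (1 + (norm ((2 * pi) *\<^sub>R k))\<^sup>2)) *\<^sub>R torus_grad (torus_wave k a) x"
proof -
  let ?q = "(norm ((2 * pi) *\<^sub>R k))\<^sup>2"
  have h: "has_bochner_integral lborel (\<lambda>s. rayleigh_weight s * exp (- s\<^sup>2 * ?q / 2)) (1 / (1 + ?q))"
    by (rule rayleigh_weight_has_integral) simp
  have e: "exp (- (s * norm ((2 * pi) *\<^sub>R k))\<^sup>2 / 2) = exp (- s\<^sup>2 * ?q / 2)" for s
    by (simp only: power_mult_distrib minus_mult_left)
  have "resolvent (torus_wave k a) x = (LINT s|lborel. rayleigh_weight s * exp (- s\<^sup>2 * ?q / 2) * torus_wave k a x)"
    unfolding resolvent_def gauss_avg_wave[OF k] e by (simp only: torus_proj_rep mult.assoc)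
  also have "\<dots> = (LINT s|lborel. rayleigh_weight s * exp (- s\<^sup>2 * ?q / 2)) * torus_wave k a x"
    by (rule integral_mult_left_zero)
  also have "\<dots> = 1 / (1 + ?q) * torus_wave k a x" using h by (simp only: has_bochner_integral_integral_eq)
  finally show "resolvent (torus_wave k a) x = 1 / (1 + ?q) * torus_wave k a x" .
  \<comment> \<open>The flux of a wave contributes the missing factor \<open>s\<close>, so the
    function and its gradient receive the same multiplier.\<close>
  have w: "half_gauss_weight s * (exp (- s\<^sup>2 * ?q / 2) * s) = rayleigh_weight s * exp (- s\<^sup>2 * ?q / 2)" for s
    by (simp add: half_gauss_weight_def rayleigh_weight_def)
  have "resolvent_grad (torus_wave k a) x =
      (LINT s|lborel. (rayleigh_weight s * exp (- s\<^sup>2 * ?q / 2)) *\<^sub>R torus_grad (torus_wave k a) x)"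
    unfolding resolvent_grad_def gauss_flux_wave[OF k] e by (simp only: torus_proj_rep scaleR_scaleR w)
  also have "\<dots> = (LINT s|lborel. rayleigh_weight s * exp (- s\<^sup>2 * ?q / 2)) *\<^sub>R torus_grad (torus_wave k a) x"
    using h by (intro integral_scaleR_left) (auto simp: has_bochner_integral_iff)
  also have "\<dots> = (1 / (1 + ?q)) *\<^sub>R torus_grad (torus_wave k a) x"
    using h by (simp only: has_bochner_integral_integral_eq)
  finally show "resolvent_grad (torus_wave k a) x = (1 / (1 + ?q)) *\<^sub>R torus_grad (torus_wave k a) x" .
qed

lemma
  assumes "trig_poly \<psi>"
  shows trig_poly_resolvent_C1: "torus_C1 (resolvent \<psi>)"
    and trig_poly_torus_grad_resolvent: "torus_grad (resolvent \<psi>) x = resolvent_grad \<psi> x"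
proof -
  have "torus_C1 (resolvent \<psi>) \<and> (\<forall>x. torus_grad (resolvent \<psi>) x = resolvent_grad \<psi> x)"
    using assms
  proof induction
    case (wave k c a)
    define d where "d = c * (1 / (1 + (norm ((2 * pi) *\<^sub>R k))\<^sup>2))"
    have "resolvent (\<lambda>x. c * torus_wave k a x) = (\<lambda>x. d * torus_wave k a x)"
      using resolvent_wave[OF wave] by (simp add: fun_eq_iff resolvent_cmult d_def)
    moreover have "resolvent_grad (\<lambda>x. c * torus_wave k a x) x = d *\<^sub>R torus_grad (torus_wave k a) x" for x
      using resolvent_grad_wave[OF wave] by (simp add: resolvent_grad_cmult d_def)
    ultimately show ?case
      using torus_C1_cmult[OF torus_C1_wave[OF wave]] torus_grad_cmult[OF torus_C1_wave[OF wave]] by simp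
  next
    case (add \<psi> G)
    note c = trig_poly_continuous[OF add(1)] trig_poly_continuous[OF add(2)]
    have "resolvent (\<lambda>x. \<psi> x + G x) = (\<lambda>x. resolvent \<psi> x + resolvent G x)"
      by (intro ext resolvent_add c)
    then show ?case using add.IH by (simp add: torus_C1_add torus_grad_add resolvent_grad_add[OF c])
  qed
  then show "torus_C1 (resolvent \<psi>)" "torus_grad (resolvent \<psi>) x = resolvent_grad \<psi> x" by auto
qed

lemma resolvent_approx:
  fixes \<psi> G :: "'n::finite torus \<Rightarrow> real"
  assumes \<psi>: "continuous_on UNIV \<psi>" and G: "continuous_on UNIV G" and e: "\<And>x. \<bar>\<psi> x - G x\<bar> \<le> e"
  shows "\<bar>resolvent \<psi> x - resolvent G x\<bar> \<le> e"
    and "norm (resolvent_grad \<psi> x - resolvent_grad G x) \<le> e * resolvent_grad_bound TYPE('n)"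
proof -
  have c: "continuous_on UNIV (\<lambda>x. \<psi> x - G x)" by (intro continuous_intros \<psi> G)
  show "\<bar>resolvent \<psi> x - resolvent G x\<bar> \<le> e"
    using resolvent_le[OF c e] by (simp add: resolvent_diff[OF \<psi> G])
  show "norm (resolvent_grad \<psi> x - resolvent_grad G x) \<le> e * resolvent_grad_bound TYPE('n)"
    using resolvent_grad_le[OF c e] by (simp add: resolvent_grad_diff[OF \<psi> G])
qed

lemma
  fixes \<psi> :: "'n::finite torus \<Rightarrow> real"
  assumes lim: "uniform_limit UNIV g \<psi> sequentially" and g: "\<And>j. continuous_on UNIV (g j)" and \<psi>: "continuous_on UNIV \<psi>"
  shows uniform_limit_resolvent: "uniform_limit UNIV (\<lambda>j. resolvent (g j)) (resolvent \<psi>) sequentially"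
    and uniform_limit_resolvent_grad: "uniform_limit UNIV (\<lambda>j. resolvent_grad (g j)) (resolvent_grad \<psi>) sequentially"
proof -
  let ?C = "resolvent_grad_bound TYPE('n) + 1"
  have C: "?C > 0" using resolvent_grad_bound_nonneg[of "TYPE('n)"] by linarith
  have *: "\<forall>\<^sub>F j in sequentially. \<forall>x. \<bar>g j x - \<psi> x\<bar> \<le> e" if "e > 0" for e
    using uniform_limitD[OF lim that] by eventually_elim (auto simp: dist_real_def less_imp_le)
  show "uniform_limit UNIV (\<lambda>j. resolvent (g j)) (resolvent \<psi>) sequentially"
  proof (rule uniform_limitI)
    fix e :: real assume e: "e > 0"
    from *[of "e / 2"] e have "\<forall>\<^sub>F j in sequentially. \<forall>x. \<bar>g j x - \<psi> x\<bar> \<le> e / 2" by simp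
    then show "\<forall>\<^sub>F j in sequentially. \<forall>x\<in>UNIV. dist (resolvent (g j) x) (resolvent \<psi> x) < e"
    proof eventually_elim
      case (elim j)
      have "\<bar>resolvent (g j) x - resolvent \<psi> x\<bar> \<le> e / 2" for x
        using elim by (intro resolvent_approx g \<psi>) auto
      then have "\<bar>resolvent (g j) x - resolvent \<psi> x\<bar> < e" for x
        using e by (rule_tac le_less_trans[of _ "e / 2"]) auto
      then show ?case by (simp add: dist_real_def)
    qed
  qed
  show "uniform_limit UNIV (\<lambda>j. resolvent_grad (g j)) (resolvent_grad \<psi>) sequentially"
  proof (rule uniform_limitI)
    fix e :: real assume e: "e > 0"
    from *[of "e / 2 / ?C"] e C have "\<forall>\<^sub>F j in sequentially. \<forall>x. \<bar>g j x - \<psi> x\<bar> \<le> e / 2 / ?C" by simp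
    then show "\<forall>\<^sub>F j in sequentially. \<forall>x\<in>UNIV. dist (resolvent_grad (g j) x) (resolvent_grad \<psi> x) < e"
    proof eventually_elim
      case (elim j)
      have "norm (resolvent_grad (g j) x - resolvent_grad \<psi> x) < e" for x
      proof -
        have "norm (resolvent_grad (g j) x - resolvent_grad \<psi> x) \<le> e / 2 / ?C * resolvent_grad_bound TYPE('n)"
          using elim by (intro resolvent_approx g \<psi>) auto
        also have "\<dots> \<le> e / 2 / ?C * ?C" using e C by (intro mult_left_mono) auto
        also have "\<dots> = e / 2" using C by (metis less_irrefl nonzero_divide_eq_eq)
        finally show ?thesis using e by linarith
      qed
      then show ?case by (simp add: dist_norm)
    qed
  qed
qed

lemma resolvent_grad_continuous:
  assumes \<psi>: "continuous_on UNIV \<psi>"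
  shows "continuous_on UNIV (resolvent_grad \<psi>)"
proof -
  obtain g where g: "\<And>j. trig_poly (g j)" "uniform_limit UNIV g \<psi> sequentially"
    using trig_poly_dense[OF \<psi>] by blast
  show ?thesis
  proof (rule uniform_limit_theorem)
    show "uniform_limit UNIV (\<lambda>j. resolvent_grad (g j)) (resolvent_grad \<psi>) sequentially"
      by (intro uniform_limit_resolvent_grad g \<psi> trig_poly_continuous)
    have "resolvent_grad (g j) = torus_grad (resolvent (g j))" for j
      by (intro ext trig_poly_torus_grad_resolvent[symmetric] g)
    then show "\<forall>\<^sub>F j in sequentially. continuous_on UNIV (resolvent_grad (g j))"
      using torus_C1_grad_continuous[OF trig_poly_resolvent_C1[OF g(1)]] by simp
  qed simp
qed

text \<open>For trigonometric approximations of \<psi> the resolvents converge pointwise and their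
  gradients uniformly, so the derivative passes to the limit. Thus a merely continuous \<psi>
  already has a resolvent of class C1.\<close>

lemma
  fixes \<psi> :: "'n::finite torus \<Rightarrow> real"
  assumes \<psi>: "continuous_on UNIV \<psi>"
  shows resolvent_C1: "torus_C1 (resolvent \<psi>)"
    and torus_grad_resolvent: "torus_grad (resolvent \<psi>) x = resolvent_grad \<psi> x"
proof -
  obtain g where g: "\<And>j. trig_poly (g j)" "uniform_limit UNIV g \<psi> sequentially"
    using trig_poly_dense[OF \<psi>] by blast
  have lim: "(\<lambda>j. resolvent (g j) x) \<longlonglongrightarrow> resolvent \<psi> x" for x
    by (rule tendsto_uniform_limitI[OF uniform_limit_resolvent[OF g(2) trig_poly_continuous[OF g(1)] \<psi>]]) simp
  have "\<exists>h. \<forall>y\<in>UNIV. (\<lambda>j. resolvent (g j) (torus_proj y)) \<longlonglongrightarrow> h y \<and>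
     (h has_derivative (\<lambda>u. u \<bullet> resolvent_grad \<psi> (torus_proj y))) (at y within UNIV)"
  proof (rule has_derivative_sequence[OF convex_UNIV])
    fix j y
    show "((\<lambda>y. resolvent (g j) (torus_proj y)) has_derivative (\<lambda>u. u \<bullet> resolvent_grad (g j) (torus_proj y))) (at y within UNIV)"
      using torus_C1_GDERIV[OF trig_poly_resolvent_C1[OF g(1)[of j]], of y]
      by (simp add: gderiv_def trig_poly_torus_grad_resolvent[OF g(1)])
  next
    fix e :: real assume e: "e > 0"
    have "\<forall>\<^sub>F j in sequentially. \<forall>x\<in>UNIV. dist (resolvent_grad (g j) x) (resolvent_grad \<psi> x) < e"
      by (rule uniform_limitD[OF uniform_limit_resolvent_grad[OF g(2) trig_poly_continuous[OF g(1)] \<psi>] e])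
    then show "\<forall>\<^sub>F j in sequentially. \<forall>y\<in>UNIV. \<forall>u. norm (u \<bullet> resolvent_grad (g j) (torus_proj y) - u \<bullet> resolvent_grad \<psi> (torus_proj y)) \<le> e * norm u"
    proof eventually_elim
      case (elim j)
      show ?case
      proof (intro ballI allI)
        fix y u
        have "norm (u \<bullet> resolvent_grad (g j) (torus_proj y) - u \<bullet> resolvent_grad \<psi> (torus_proj y)) \<le>
            norm u * norm (resolvent_grad (g j) (torus_proj y) - resolvent_grad \<psi> (torus_proj y))"
          using Cauchy_Schwarz_ineq2 by (simp only: real_norm_def inner_diff_right[symmetric])
        also have "\<dots> \<le> norm u * e" using elim by (intro mult_left_mono) (auto simp: dist_norm less_imp_le)
        finally show "norm (u \<bullet> resolvent_grad (g j) (torus_proj y) - u \<bullet> resolvent_grad \<psi> (torus_proj y)) \<le> e * norm u"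
          by (simp add: mult.commute)
      qed
    qed
  qed (use lim in auto)
  then obtain h where h: "\<And>y. (\<lambda>j. resolvent (g j) (torus_proj y)) \<longlonglongrightarrow> h y"
    "\<And>y. (h has_derivative (\<lambda>u. u \<bullet> resolvent_grad \<psi> (torus_proj y))) (at y)" by auto
  have "h = (\<lambda>y. resolvent \<psi> (torus_proj y))" using h(1) lim LIMSEQ_unique by blast
  then have *: "GDERIV (\<lambda>y. resolvent \<psi> (torus_proj y)) y :> resolvent_grad \<psi> (torus_proj y)" for y
    using h(2)[of y] by (simp add: gderiv_def)
  show "torus_C1 (resolvent \<psi>)" by (rule torus_C1I[OF *]) (rule resolvent_grad_continuous[OF \<psi>])
  show "torus_grad (resolvent \<psi>) x = resolvent_grad \<psi> x" by (rule torus_gradI[OF *])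
qed

text \<open>Below the scale \<open>\<eta>\<close> the flux is merely bounded, above it is Lipschitz with a constant of order \<open>1 / \<eta>\<close>.\<close>

lemma resolvent_grad_equicontinuous:
  fixes \<psi> :: "'n::finite torus \<Rightarrow> real"
  assumes \<psi>: "continuous_on UNIV \<psi>" "\<And>x. \<bar>\<psi> x\<bar> \<le> 1" and \<eta>: "\<eta> > 0"
  shows "norm (resolvent_grad \<psi> (torus_proj y) - resolvent_grad \<psi> (torus_proj y')) \<le>
    2 * gauss_norm TYPE('n) * \<eta> +
    2 * (gauss_norm TYPE('n))\<^sup>2 / \<eta> * norm (y - y') * (LINT s|lborel. half_gauss_weight s)"
proof -
  let ?K = "gauss_norm TYPE('n)" and ?V = "\<lambda>s. gauss_flux s (torus_lift \<psi>)"
  define c where "c = 2 * ?K\<^sup>2 / \<eta> * norm (y - y')"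
  have c0: "c \<ge> 0" using \<eta> gauss_norm_nonneg by (simp add: c_def)
  note i = resolvent_grad_integrable[OF \<psi>]
  have "resolvent_grad \<psi> (torus_proj y) - resolvent_grad \<psi> (torus_proj y') =
      (LINT s|lborel. half_gauss_weight s *\<^sub>R (?V s y - ?V s y'))"
    unfolding resolvent_grad_proj scaleR_diff_right by (rule Bochner_Integration.integral_diff[OF i i, symmetric])
  also have "norm \<dots> \<le> (LINT s|lborel. norm (half_gauss_weight s *\<^sub>R (?V s y - ?V s y')))"
    by (rule integral_norm_bound)
  also have "\<dots> \<le> (LINT s|lborel. 2 * ?K * indicator {0..\<eta>} s + c * half_gauss_weight s)"
  proof (rule integral_mono)
    show "integrable lborel (\<lambda>s. norm (half_gauss_weight s *\<^sub>R (?V s y - ?V s y')))"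
      unfolding scaleR_diff_right by (intro integrable_norm Bochner_Integration.integrable_diff i)
    show "integrable lborel (\<lambda>s. 2 * ?K * indicator {0..\<eta>} s + c * half_gauss_weight s)"
      using \<eta> by (intro Bochner_Integration.integrable_add integrable_mult_right half_gauss_weight_integrable integrable_real_indicator) auto
    show "norm (half_gauss_weight s *\<^sub>R (?V s y - ?V s y')) \<le> 2 * ?K * indicator {0..\<eta>} s + c * half_gauss_weight s" for s
    proof -
      consider "s < 0" | "0 \<le> s" "s \<le> \<eta>" | "\<eta> < s" by linarith
      then show ?thesis
      proof cases
        case 1
        then show ?thesis by (simp add: half_gauss_weight_def)
      next
        case 2
        have "norm (?V s y) \<le> 1 * ?K" "norm (?V s y') \<le> 1 * ?K"
          by (intro gauss_flux_le bounded_borel_lift \<psi>)+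
        then have "norm (?V s y - ?V s y') \<le> 2 * ?K" using norm_triangle_ineq4[of "?V s y" "?V s y'"] by simp
        moreover have "half_gauss_weight s \<le> 1" by (simp add: half_gauss_weight_def indicator_def)
        ultimately have "half_gauss_weight s * norm (?V s y - ?V s y') \<le> 1 * (2 * ?K)"
          using weight_nonneg(2) by (intro mult_mono) auto
        moreover have "0 \<le> c * half_gauss_weight s" using c0 weight_nonneg(2) by simp
        ultimately show ?thesis using 2 weight_nonneg(2)[of s] by (simp add: indicator_def)
      next
        case 3
        have "norm (?V s y - ?V s y') \<le> 2 * 1 * ?K\<^sup>2 / s * norm (y - y')"
          using 3 \<eta> by (intro gauss_flux_lipschitz \<psi>) auto
        also have "\<dots> \<le> c" unfolding c_def using 3 \<eta> gauss_norm_nonneg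
          by (intro mult_right_mono) (auto intro!: divide_left_mono)
        finally have "half_gauss_weight s * norm (?V s y - ?V s y') \<le> half_gauss_weight s * c"
          using weight_nonneg(2) by (rule mult_left_mono)
        then show ?thesis using 3 weight_nonneg(2)[of s] by (simp add: mult.commute)
      qed
    qed
  qed
  also have "\<dots> = 2 * ?K * \<eta> + c * (LINT s|lborel. half_gauss_weight s)"
    using \<eta> by (subst Bochner_Integration.integral_add)
      (auto intro!: integrable_mult_right half_gauss_weight_integrable integrable_real_indicator)
  finally show ?thesis unfolding c_def .
qed

section \<open>Integration by parts and the weak form of the resolvent equation\<close>

lemma torus_integral_by_parts:
  fixes f \<theta> :: "'n::finite torus \<Rightarrow> real"
  assumes f: "torus_C1 f" and \<theta>: "torus_C1 \<theta>"
  shows "(LINT x|torus_lborel. f x * torus_grad \<theta> x $ i) = - (LINT x|torus_lborel. torus_grad f x $ i * \<theta> x)"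
proof -
  have c: "continuous_on UNIV (\<lambda>x. f x * torus_grad \<theta> x $ i)" "continuous_on UNIV (\<lambda>x. torus_grad f x $ i * \<theta> x)"
    by (intro continuous_intros torus_C1_continuous torus_C1_grad_continuous f \<theta>)+
  have "0 = (LINT x|torus_lborel. f x * torus_grad \<theta> x $ i + torus_grad f x $ i * \<theta> x)"
    using torus_integral_grad[OF torus_C1_mult[OF f \<theta>], of i]
    unfolding torus_grad_mult[OF f \<theta>] by (simp add: mult.commute)
  also have "\<dots> = (LINT x|torus_lborel. f x * torus_grad \<theta> x $ i) + (LINT x|torus_lborel. torus_grad f x $ i * \<theta> x)"
    by (intro Bochner_Integration.integral_add torus_integrable_lborel c)
  finally show ?thesis by simp
qed

text \<open>The weak eigenvalue equation for minus the Laplacian: each differentiation brings down a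
  factor \<open>2 * pi * k\<close> and shifts the phase by \<open>pi / 2\<close>, and two shifts
  reverse the sign.\<close>

lemma torus_wave_dirichlet:
  fixes k :: "real^'n::finite"
  assumes k: "\<And>i. k $ i \<in> \<int>" and \<theta>: "torus_C1 \<theta>"
  shows "(LINT x|torus_lborel. torus_grad (torus_wave k a) x \<bullet> torus_grad \<theta> x) =
    (norm ((2 * pi) *\<^sub>R k))\<^sup>2 * (LINT x|torus_lborel. torus_wave k a x * \<theta> x)"
proof -
  let ?w = "torus_wave k (a + pi / 2)"
  have w: "torus_C1 ?w" by (rule torus_C1_wave[OF k])
  have int: "integrable torus_lborel (\<lambda>x. ?w x * torus_grad \<theta> x $ i)" for i
    by (intro torus_integrable_lborel continuous_intros torus_C1_continuous[OF w] torus_C1_grad_continuous \<theta>)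
  have g: "torus_grad ?w x $ i = - 2 * pi * k $ i * torus_wave k a x" for x i
    using cos_add[of "2 * pi * (k \<bullet> rep_torus x) + a" pi]
    by (simp add: torus_grad_wave[OF k] torus_wave_def add.assoc)
  have "(LINT x|torus_lborel. torus_grad (torus_wave k a) x \<bullet> torus_grad \<theta> x) =
      (LINT x|torus_lborel. (\<Sum>i\<in>UNIV. (2 * pi * k $ i) * (?w x * torus_grad \<theta> x $ i)))"
    by (intro Bochner_Integration.integral_cong refl)
      (simp add: torus_grad_wave[OF k] inner_vec_def mult_ac sum_distrib_left)
  also have "\<dots> = (\<Sum>i\<in>UNIV. (2 * pi * k $ i) * (LINT x|torus_lborel. ?w x * torus_grad \<theta> x $ i))"
    using int by simp
  also have "\<dots> = (\<Sum>i\<in>UNIV. (2 * pi * k $ i) * (2 * pi * k $ i * (LINT x|torus_lborel. torus_wave k a x * \<theta> x)))"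
    unfolding torus_integral_by_parts[OF w \<theta>] g by (simp add: mult.assoc)
  also have "\<dots> = (norm ((2 * pi) *\<^sub>R k))\<^sup>2 * (LINT x|torus_lborel. torus_wave k a x * \<theta> x)"
    unfolding power2_norm_eq_inner by (simp add: inner_vec_def sum_distrib_right sum_distrib_left mult_ac)
  finally show ?thesis .
qed

text \<open>The equation \<open>R \<psi> - laplacian (R \<psi>) = \<psi>\<close> tested with
  \<theta>, which asks for one derivative of \<open>R \<psi>\<close> only. On a wave with
  \<open>q = |2 \<pi> k|^2\<close> it is \<open>q / (1 + q) = 1 - 1 / (1 + q)\<close>; uniform
  limits give the rest.\<close>

lemma resolvent_weak:
  fixes \<psi> :: "'n::finite torus \<Rightarrow> real"
  assumes \<psi>: "continuous_on UNIV \<psi>" and \<theta>: "torus_C1 \<theta>"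
  shows "(LINT x|torus_lborel. resolvent_grad \<psi> x \<bullet> torus_grad \<theta> x) =
    (LINT x|torus_lborel. (\<psi> x - resolvent \<psi> x) * \<theta> x)"
proof -
  have c\<theta>: "continuous_on UNIV \<theta>" "continuous_on UNIV (torus_grad \<theta>)"
    by (intro torus_C1_continuous torus_C1_grad_continuous \<theta>)+
  have ir: "integrable torus_lborel (\<lambda>x. resolvent_grad G x \<bullet> torus_grad \<theta> x)" if "continuous_on UNIV G" for G
    by (intro torus_integrable_lborel continuous_intros resolvent_grad_continuous that c\<theta>)
  have il: "integrable torus_lborel (\<lambda>x. (G x - resolvent G x) * \<theta> x)" if "continuous_on UNIV G" for G
    by (intro torus_integrable_lborel continuous_intros torus_C1_continuous[OF resolvent_C1] that c\<theta>)
  have trig: "(LINT x|torus_lborel. resolvent_grad G x \<bullet> torus_grad \<theta> x) =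
    (LINT x|torus_lborel. (G x - resolvent G x) * \<theta> x)" if "trig_poly G" for G
    using that
  proof induction
    case (wave k c a)
    define q where "q = (norm ((2 * pi) *\<^sub>R k))\<^sup>2"
    have q: "1 + q > 0" by (simp add: q_def add_pos_nonneg)
    have "(LINT x|torus_lborel. resolvent_grad (\<lambda>x. c * torus_wave k a x) x \<bullet> torus_grad \<theta> x) =
        c * (1 / (1 + q)) * (q * (LINT x|torus_lborel. torus_wave k a x * \<theta> x))"
      unfolding resolvent_grad_cmult resolvent_grad_wave[OF wave] q_def torus_wave_dirichlet[OF wave \<theta>, symmetric]
      by simp
    also have "\<dots> = (c * (1 - 1 / (1 + q))) * (LINT x|torus_lborel. torus_wave k a x * \<theta> x)"
      using q by (simp add: field_simps)
    also have "\<dots> = (LINT x|torus_lborel. (c * (1 - 1 / (1 + q))) * (torus_wave k a x * \<theta> x))"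
      by (rule integral_mult_right_zero[symmetric])
    also have "\<dots> = (LINT x|torus_lborel. (c * torus_wave k a x - resolvent (\<lambda>x. c * torus_wave k a x) x) * \<theta> x)"
      unfolding resolvent_cmult resolvent_wave[OF wave] q_def[symmetric]
      by (intro Bochner_Integration.integral_cong refl) (simp add: algebra_simps)
    finally show ?case .
  next
    case (add G H)
    note c = trig_poly_continuous[OF add(1)] trig_poly_continuous[OF add(2)]
    have "(LINT x|torus_lborel. resolvent_grad (\<lambda>x. G x + H x) x \<bullet> torus_grad \<theta> x) =
      (LINT x|torus_lborel. resolvent_grad G x \<bullet> torus_grad \<theta> x) + (LINT x|torus_lborel. resolvent_grad H x \<bullet> torus_grad \<theta> x)"
      unfolding resolvent_grad_add[OF c] inner_add_left by (intro Bochner_Integration.integral_add ir c)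
    also have "\<dots> = (LINT x|torus_lborel. (G x - resolvent G x) * \<theta> x + (H x - resolvent H x) * \<theta> x)"
      unfolding add.IH by (intro Bochner_Integration.integral_add[symmetric] il c)
    also have "\<dots> = (LINT x|torus_lborel. (G x + H x - resolvent (\<lambda>x. G x + H x) x) * \<theta> x)"
      unfolding resolvent_add[OF c] by (simp add: algebra_simps)
    finally show ?case .
  qed
  obtain g where g: "\<And>j. trig_poly (g j)" "uniform_limit UNIV g \<psi> sequentially"
    using trig_poly_dense[OF \<psi>] by blast
  note cg = trig_poly_continuous[OF g(1)]
  have fm: "finite_measure (torus_lborel :: 'n torus measure)"
    by (rule prob_space.finite_measure[OF prob_space_torus_lborel])
  have bd: "bounded (range f)" if "continuous_on UNIV f" for f :: "'n torus \<Rightarrow> 'c::real_normed_vector"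
    by (rule compact_imp_bounded[OF compact_continuous_image[OF that compact_torus]])
  have "(\<lambda>j. LINT x|torus_lborel. resolvent_grad (g j) x \<bullet> torus_grad \<theta> x) \<longlonglongrightarrow>
      (LINT x|torus_lborel. resolvent_grad \<psi> x \<bullet> torus_grad \<theta> x)"
  proof (rule uniform_limit_imp_tendsto_integral[OF fm])
    show "uniform_limit UNIV (\<lambda>j x. resolvent_grad (g j) x \<bullet> torus_grad \<theta> x) (\<lambda>x. resolvent_grad \<psi> x \<bullet> torus_grad \<theta> x) sequentially"
      by (intro bounded_bilinear.bounded_uniform_limit[OF bounded_bilinear_inner]
        uniform_limit_resolvent_grad g cg \<psi> uniform_limit_const bd resolvent_grad_continuous c\<theta>)
  qed (auto intro!: continuous_on_inner resolvent_grad_continuous cg \<psi> c\<theta>)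
  moreover have "(\<lambda>j. LINT x|torus_lborel. (g j x - resolvent (g j) x) * \<theta> x) \<longlonglongrightarrow>
      (LINT x|torus_lborel. (\<psi> x - resolvent \<psi> x) * \<theta> x)"
  proof (rule uniform_limit_imp_tendsto_integral[OF fm])
    show "uniform_limit UNIV (\<lambda>j x. (g j x - resolvent (g j) x) * \<theta> x) (\<lambda>x. (\<psi> x - resolvent \<psi> x) * \<theta> x) sequentially"
      by (intro uniform_lim_mult uniform_limit_minus uniform_limit_resolvent g cg \<psi> uniform_limit_const bd
        continuous_on_diff torus_C1_continuous[OF resolvent_C1] c\<theta>)
  qed (auto intro!: continuous_on_mult continuous_on_diff torus_C1_continuous[OF resolvent_C1] cg \<psi> c\<theta>)
  ultimately show ?thesis unfolding trig[OF g(1)] by (rule LIMSEQ_unique)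
qed

section \<open>The elliptic equation\<close>

lemma torus_bcontfun: "continuous_on UNIV (f :: 'n::finite torus \<Rightarrow> real) \<Longrightarrow> f \<in> bcontfun"
  by (simp add: bcontfun_def compact_imp_bounded[OF compact_continuous_image[OF _ compact_torus]])

text \<open>Arzela-Ascoli is applied on the closed cube to the pair of lifted resolvent and
  gradient, so one subsequence serves both. Representatives in the cube carry the limits back to the
  torus.\<close>

lemma resolvent_compact:
  fixes g :: "nat \<Rightarrow> 'n::finite torus \<Rightarrow> real"
  assumes g: "\<And>n. continuous_on UNIV (g n)" "\<And>n x. \<bar>g n x\<bar> \<le> 1"
  shows "\<exists>r u w. strict_mono (r :: nat \<Rightarrow> nat) \<and> uniform_limit UNIV (\<lambda>n. resolvent (g (r n))) u sequentially \<and>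
    uniform_limit UNIV (\<lambda>n. resolvent_grad (g (r n))) w sequentially"
proof -
  let ?C = "resolvent_grad_bound TYPE('n)" and ?K = "gauss_norm TYPE('n)"
  define W where "W = (LINT s|lborel. half_gauss_weight s)"
  have W: "W \<ge> 0" unfolding W_def by (intro Bochner_Integration.integral_nonneg weight_nonneg)
  define H where "H n y = (resolvent (g n) (torus_proj y), resolvent_grad (g n) (torus_proj y))" for n and y :: "real^'n"
  have lip: "\<bar>resolvent (g n) (torus_proj y) - resolvent (g n) (torus_proj y')\<bar> \<le> ?C * norm (y - y')" for n y y'
    using resolvent_grad_le[OF g(1) g(2)]
    by (intro torus_C1_lipschitz resolvent_C1 g) (simp add: torus_grad_resolvent[OF g(1)])
  have "\<exists>G r. continuous_on (cbox 0 1) G \<and> strict_mono (r :: nat \<Rightarrow> nat) \<and>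
      (\<forall>e>0. \<exists>N. \<forall>n x. n \<ge> N \<and> x \<in> cbox 0 1 \<longrightarrow> norm (H (r n) x - G x) < e)"
  proof (rule Arzela_Ascoli[of "cbox 0 (1::real^'n)" H "1 + ?C"])
    show "compact (cbox 0 (1::real^'n))" by (rule compact_cbox)
    show "norm (H n x) \<le> 1 + ?C" for n x
    proof -
      have "norm (H n x) \<le> \<bar>resolvent (g n) (torus_proj x)\<bar> + norm (resolvent_grad (g n) (torus_proj x))"
        unfolding H_def diff_Pair by (rule order_trans[OF norm_Pair_le]) simp
      then show ?thesis
        using resolvent_le[OF g(1) g(2), of n "torus_proj x"] resolvent_grad_le[OF g(1) g(2), of n "torus_proj x"] by linarith
    qed
    fix x :: "real^'n" and e :: real assume e: "0 < e"
    have quot: "\<exists>d>0. Z * d = e / 4" if "Z > 0" for Z :: real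
      by (rule exI[of _ "e / 4 / Z"]) (use that e in simp)
    \<comment> \<open>The scale \<eta> is fixed first, so that the part below it costs at most
      \<open>e / 4\<close>; only then is \<open>d\<close> chosen, as \<open>D\<close> grows like
      \<open>1 / \<eta>\<close>. The added ones keep the coefficients positive.\<close>
    obtain \<eta> where \<eta>: "\<eta> > 0" "2 * (?K + 1) * \<eta> = e / 4"
      using quot[of "2 * (?K + 1)"] gauss_norm_nonneg[of "TYPE('n)"] by auto
    define D where "D = 2 * ?K\<^sup>2 / \<eta> * W"
    have D: "D \<ge> 0" using \<eta>(1) W by (simp add: D_def)
    have DC: "D + ?C + 1 > 0" using D resolvent_grad_bound_nonneg[of "TYPE('n)"] by linarith
    obtain d where d: "d > 0" "(D + ?C + 1) * d = e / 4" using quot[OF DC] by blast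
    have "norm (H n x - H n y) < e" if "norm (x - y) < d" for n y
    proof -
      have "norm (H n x - H n y) \<le> \<bar>resolvent (g n) (torus_proj x) - resolvent (g n) (torus_proj y)\<bar> +
          norm (resolvent_grad (g n) (torus_proj x) - resolvent_grad (g n) (torus_proj y))"
        unfolding H_def diff_Pair by (rule order_trans[OF norm_Pair_le]) simp
      also have "\<dots> \<le> ?C * norm (x - y) + (2 * ?K * \<eta> + 2 * ?K\<^sup>2 / \<eta> * norm (x - y) * W)"
        unfolding W_def by (intro add_mono lip resolvent_grad_equicontinuous g \<eta>(1))
      also have "\<dots> = (D + ?C) * norm (x - y) + 2 * ?K * \<eta>" by (simp add: D_def algebra_simps)
      also have "\<dots> \<le> (D + ?C + 1) * d + 2 * (?K + 1) * \<eta>"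
      proof (rule add_mono)
        show "(D + ?C) * norm (x - y) \<le> (D + ?C + 1) * d"
          using that DC by (intro mult_mono) auto
        show "2 * ?K * \<eta> \<le> 2 * (?K + 1) * \<eta>" using \<eta>(1) by (intro mult_right_mono) auto
      qed
      also note d(2)
      also note \<eta>(2)
      finally show ?thesis using e by linarith
    qed
    then show "\<exists>d>0. \<forall>n y. y \<in> cbox 0 1 \<and> norm (x - y) < d \<longrightarrow> norm (H n x - H n y) < e"
      using d(1) by blast
  qed blast
  then obtain G r where r: "strict_mono (r :: nat \<Rightarrow> nat)"
    and G: "\<And>e. e > 0 \<Longrightarrow> \<exists>N. \<forall>n x. n \<ge> N \<and> x \<in> cbox 0 1 \<longrightarrow> norm (H (r n) x - G x) < e" by blast
  have "\<forall>x :: 'n torus. \<exists>y\<in>cbox 0 1. torus_proj y = x" using torus_proj_cube by (metis UNIV_I imageE)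
  then obtain c where c: "\<And>x :: 'n torus. c x \<in> cbox 0 1" "\<And>x. torus_proj (c x) = x" by metis
  have lim: "uniform_limit UNIV (\<lambda>n x. H (r n) (c x)) (\<lambda>x. G (c x)) sequentially"
  proof (rule uniform_limitI)
    fix e :: real assume "e > 0"
    with G obtain N where "\<And>n x. n \<ge> N \<Longrightarrow> x \<in> cbox 0 1 \<Longrightarrow> norm (H (r n) x - G x) < e" by blast
    then show "\<forall>\<^sub>F n in sequentially. \<forall>x\<in>UNIV. dist (H (r n) (c x)) (G (c x)) < e"
      using c(1) by (auto simp: eventually_sequentially dist_norm)
  qed
  have "uniform_limit UNIV (\<lambda>n. resolvent (g (r n))) (\<lambda>x. fst (G (c x))) sequentially"
    using bounded_linear.uniform_limit[OF bounded_linear_fst lim] by (simp add: H_def c)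
  moreover have "uniform_limit UNIV (\<lambda>n. resolvent_grad (g (r n))) (\<lambda>x. snd (G (c x))) sequentially"
    using bounded_linear.uniform_limit[OF bounded_linear_snd lim] by (simp add: H_def c)
  ultimately show ?thesis using r by blast
qed

lemma torus_integral_grad_inner:
  assumes f: "torus_C1 f"
  shows "(LINT x|torus_lborel. torus_grad f x \<bullet> Q) = 0"
proof -
  have int: "integrable torus_lborel (\<lambda>x. torus_grad f x $ i)" for i
    by (intro torus_integrable_lborel continuous_intros torus_C1_grad_continuous f)
  have "(LINT x|torus_lborel. torus_grad f x \<bullet> Q) = (\<Sum>i\<in>UNIV. (LINT x|torus_lborel. torus_grad f x $ i) * Q $ i)"
    using int by (simp add: inner_vec_def)
  then show ?thesis by (simp add: torus_integral_grad[OF f])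
qed

text \<open>The field \<open>b\<close> of the overview, written without the logarithm.\<close>

definition log_grad :: "('n::finite torus \<Rightarrow> real) \<Rightarrow> 'n torus \<Rightarrow> real^'n" where
  "log_grad \<rho> x = (1 / \<rho> x) *\<^sub>R torus_grad \<rho> x"

lemma log_grad_continuous:
  assumes "torus_C1 \<rho>" "\<And>x. \<rho> x > 0"
  shows "continuous_on UNIV (log_grad \<rho>)"
  unfolding log_grad_def[abs_def]
  by (intro continuous_intros torus_C1_continuous torus_C1_grad_continuous assms(1))
    (use assms(2) in \<open>auto simp: less_imp_neq[symmetric]\<close>)

text \<open>Testing the weak form of the equation with \<open>\<rho>\<close> gives \<open>m = 0\<close>; testing it with \<open>\<rho> \<theta>\<close> then gives the
  divergence form.\<close>

lemma resolvent_elliptic: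
  fixes \<rho> :: "'n::finite torus \<Rightarrow> real"
  assumes \<rho>: "torus_C1 \<rho>" "\<And>x. \<rho> x > 0" and g: "continuous_on UNIV g"
    and eq: "\<And>x. g x - resolvent g x = log_grad \<rho> x \<bullet> (resolvent_grad g x + Q) - m"
  shows "m = 0" and "elliptic_C1 \<rho> Q (resolvent g)"
proof -
  note cs = torus_C1_continuous[OF \<rho>(1)] torus_C1_grad_continuous[OF \<rho>(1)] resolvent_grad_continuous[OF g]
  note I = torus_integrable_lborel
  have \<rho>b: "\<rho> x * (log_grad \<rho> x \<bullet> v) = torus_grad \<rho> x \<bullet> v" for x v
    using \<rho>(2)[of x] by (simp add: log_grad_def)
  have weak: "(LINT x|torus_lborel. resolvent_grad g x \<bullet> torus_grad (\<lambda>x. \<rho> x * \<theta> x) x) =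
      (LINT x|torus_lborel. (torus_grad \<rho> x \<bullet> (resolvent_grad g x + Q)) * \<theta> x - m * (\<rho> x * \<theta> x))"
    if \<theta>: "torus_C1 \<theta>" for \<theta>
    unfolding resolvent_weak[OF g torus_C1_mult[OF \<rho>(1) \<theta>]] eq
    by (intro Bochner_Integration.integral_cong refl) (simp add: algebra_simps flip: \<rho>b)
  \<comment> \<open>For the constant test function 1 the gradient term stands on both sides, and
    \<open>torus_grad \<rho> \<bullet> Q\<close> has integral zero; what remains is \<open>m\<close>
    times the integral of \<rho>.\<close>
  have "(LINT x|torus_lborel. resolvent_grad g x \<bullet> torus_grad \<rho> x) =
      (LINT x|torus_lborel. resolvent_grad g x \<bullet> torus_grad \<rho> x + torus_grad \<rho> x \<bullet> Q - m * \<rho> x)"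
    using weak[OF torus_C1_const[of 1]] by (simp add: inner_add_right inner_commute)
  also have "\<dots> = (LINT x|torus_lborel. resolvent_grad g x \<bullet> torus_grad \<rho> x) +
      (LINT x|torus_lborel. torus_grad \<rho> x \<bullet> Q) - m * (LINT x|torus_lborel. \<rho> x)"
  proof -
    have i: "integrable torus_lborel (\<lambda>x. resolvent_grad g x \<bullet> torus_grad \<rho> x)"
      "integrable torus_lborel (\<lambda>x. torus_grad \<rho> x \<bullet> Q)" "integrable torus_lborel \<rho>"
      by (intro I continuous_intros cs)+
    then show ?thesis by simp
  qed
  finally have "m * (LINT x|torus_lborel. \<rho> x) = 0" by (simp add: torus_integral_grad_inner[OF \<rho>(1)])
  moreover have "(LINT x|torus_lborel. \<rho> x) \<noteq> 0"
  proof
    assume "(LINT x|torus_lborel. \<rho> x) = 0"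
    then have "\<rho> (torus_proj 0) = 0"
      by (rule torus_integral_nonneg_eq_0[OF cs(1) less_imp_le[OF \<rho>(2)]])
    then show False using \<rho>(2)[of "torus_proj 0"] by simp
  qed
  ultimately show m: "m = 0" by simp
  have "(LINT x|torus_lborel. (\<rho> x *\<^sub>R (torus_grad (resolvent g) x + Q)) \<bullet> torus_grad \<theta> x) = 0"
    if \<theta>: "torus_C1 \<theta>" for \<theta>
  proof -
    note ct = torus_C1_continuous[OF \<theta>] torus_C1_grad_continuous[OF \<theta>]
    let ?G = "resolvent_grad g"
    have i: "integrable torus_lborel (\<lambda>x. ?G x \<bullet> torus_grad (\<lambda>x. \<rho> x * \<theta> x) x)"
      "integrable torus_lborel (\<lambda>x. (torus_grad \<rho> x \<bullet> (?G x + Q)) * \<theta> x)"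
      "integrable torus_lborel (\<lambda>x. torus_grad (\<lambda>x. \<rho> x * \<theta> x) x \<bullet> Q)"
      by (intro I continuous_intros cs ct torus_C1_grad_continuous torus_C1_mult \<rho>(1) \<theta>)+
    \<comment> \<open>The last integral is zero and is added to bring in \<open>Q\<close>. After the
      product rule for \<open>\<rho> \<theta>\<close>, the terms with
      \<open>torus_grad \<rho>\<close> cancel and the divergence form is left.\<close>
    have "0 = (LINT x|torus_lborel. ?G x \<bullet> torus_grad (\<lambda>x. \<rho> x * \<theta> x) x) -
        (LINT x|torus_lborel. (torus_grad \<rho> x \<bullet> (?G x + Q)) * \<theta> x) +
        (LINT x|torus_lborel. torus_grad (\<lambda>x. \<rho> x * \<theta> x) x \<bullet> Q)"
      using weak[OF \<theta>] m torus_integral_grad_inner[OF torus_C1_mult[OF \<rho>(1) \<theta>]] by simp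
    also have "\<dots> = (LINT x|torus_lborel. ?G x \<bullet> torus_grad (\<lambda>x. \<rho> x * \<theta> x) x
        - (torus_grad \<rho> x \<bullet> (?G x + Q)) * \<theta> x + torus_grad (\<lambda>x. \<rho> x * \<theta> x) x \<bullet> Q)"
      using i by simp
    also have "\<dots> = (LINT x|torus_lborel. (\<rho> x *\<^sub>R (?G x + Q)) \<bullet> torus_grad \<theta> x)"
      unfolding torus_grad_mult[OF \<rho>(1) \<theta>]
      by (intro Bochner_Integration.integral_cong refl)
        (simp add: inner_add_left inner_add_right inner_commute algebra_simps)
    finally show ?thesis by (simp add: torus_grad_resolvent[OF g])
  qed
  then show "elliptic_C1 \<rho> Q (resolvent g)"
    unfolding elliptic_C1_def torus_div_free_def using resolvent_C1[OF g] by blast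
qed

text \<open>The difference of the two equations is tested with \<open>\<phi> - \<psi>\<close>, so
  the squared gradient of the difference, weighted by \<rho>, has integral zero.\<close>

lemma elliptic_C1_grad_unique:
  fixes \<rho> :: "'n::finite torus \<Rightarrow> real"
  assumes \<rho>: "torus_C1 \<rho>" "\<And>x. \<rho> x > 0" and \<phi>: "elliptic_C1 \<rho> P \<phi>" and \<psi>: "elliptic_C1 \<rho> P \<psi>"
  shows "torus_grad \<phi> x = torus_grad \<psi> x"
proof -
  have C: "torus_C1 \<phi>" "torus_C1 \<psi>" using \<phi> \<psi> by (auto simp: elliptic_C1_def)
  note cs = torus_C1_continuous[OF \<rho>(1)] C[THEN torus_C1_grad_continuous]
  let ?\<theta> = "\<lambda>x. \<phi> x - \<psi> x"
  have g: "torus_grad ?\<theta> x = torus_grad \<phi> x - torus_grad \<psi> x" for x by (rule torus_grad_diff[OF C])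
  have "(LINT x|torus_lborel. \<rho> x * (norm (torus_grad \<phi> x - torus_grad \<psi> x))\<^sup>2) =
     (LINT x|torus_lborel. (\<rho> x *\<^sub>R (torus_grad \<phi> x + P)) \<bullet> torus_grad ?\<theta> x
        - (\<rho> x *\<^sub>R (torus_grad \<psi> x + P)) \<bullet> torus_grad ?\<theta> x)"
    unfolding g power2_norm_eq_inner
    by (intro Bochner_Integration.integral_cong refl)
      (simp add: inner_add_left inner_diff_left inner_diff_right inner_commute algebra_simps)
  also have "\<dots> = (LINT x|torus_lborel. (\<rho> x *\<^sub>R (torus_grad \<phi> x + P)) \<bullet> torus_grad ?\<theta> x)
        - (LINT x|torus_lborel. (\<rho> x *\<^sub>R (torus_grad \<psi> x + P)) \<bullet> torus_grad ?\<theta> x)"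
    unfolding g by (intro Bochner_Integration.integral_diff torus_integrable_lborel continuous_intros cs)
  also have "\<dots> = 0"
    using \<phi> \<psi> torus_C1_diff[OF C] by (simp add: elliptic_C1_def torus_div_free_def)
  finally have "(LINT x|torus_lborel. \<rho> x * (norm (torus_grad \<phi> x - torus_grad \<psi> x))\<^sup>2) = 0" .
  then have "\<rho> x * (norm (torus_grad \<phi> x - torus_grad \<psi> x))\<^sup>2 = 0"
    using \<rho>(2) by (intro torus_integral_nonneg_eq_0[of "\<lambda>x. \<rho> x * (norm (torus_grad \<phi> x - torus_grad \<psi> x))\<^sup>2"] continuous_intros cs)
      (simp add: less_imp_le[OF \<rho>(2)])
  then show ?thesis using \<rho>(2)[of x] by auto
qed

lemma elliptic_C1_unique:
  fixes \<rho> :: "'n::finite torus \<Rightarrow> real"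
  assumes \<rho>: "torus_C1 \<rho>" "\<And>x. \<rho> x > 0" and \<phi>: "elliptic_C1 \<rho> P \<phi>"
  shows "elliptic_C1 \<rho> P \<psi> \<longleftrightarrow> (\<exists>c. \<forall>x. \<psi> x = \<phi> x + c)"
proof
  have C\<phi>: "torus_C1 \<phi>" using \<phi> by (simp add: elliptic_C1_def)
  {
    assume \<psi>: "elliptic_C1 \<rho> P \<psi>"
    have C\<psi>: "torus_C1 \<psi>" using \<psi> by (simp add: elliptic_C1_def)
    have "torus_grad (\<lambda>x. \<psi> x - \<phi> x) x = 0" for x
      using elliptic_C1_grad_unique[OF \<rho> \<phi> \<psi>] by (simp add: torus_grad_diff[OF C\<psi> C\<phi>])
    then obtain c where "\<And>x. \<psi> x - \<phi> x = c"
      using torus_C1_grad_zero_imp_const[OF torus_C1_diff[OF C\<psi> C\<phi>]] by blast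
    then show "\<exists>c. \<forall>x. \<psi> x = \<phi> x + c" by (intro exI[of _ c] allI) (simp add: algebra_simps)
  next
    assume "\<exists>c. \<forall>x. \<psi> x = \<phi> x + c"
    then obtain c where c: "\<psi> = (\<lambda>x. \<phi> x + c)" by auto
    have "torus_grad \<psi> = torus_grad \<phi>"
      by (rule ext) (simp add: c torus_grad_add[OF C\<phi> torus_C1_const] torus_grad_const)
    then show "elliptic_C1 \<rho> P \<psi>"
      using \<phi> torus_C1_add[OF C\<phi> torus_C1_const[of c]] by (simp add: elliptic_C1_def c)
  }
qed

theorem elliptic_C1_exists:
  fixes \<rho> :: "'n::finite torus \<Rightarrow> real"
  assumes \<rho>: "torus_C1 \<rho>" "\<And>x. \<rho> x > 0"
  shows "\<exists>\<phi>. elliptic_C1 \<rho> P \<phi>"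
proof -
  define x0 where "x0 = (torus_proj 0 :: 'n torus)"
  \<comment> \<open>The last term is the scalar of the overview, evaluated at the projection of 0.
    Without it every constant would be a fixed point of \<open>K\<close>.\<close>
  define K where "K g x = resolvent g x + log_grad \<rho> x \<bullet> resolvent_grad g x - resolvent g x0" for g x
  note cb = log_grad_continuous[OF \<rho>]
  have cK: "continuous_on UNIV (K g)" if "continuous_on UNIV g" for g
    unfolding K_def[abs_def]
    by (intro continuous_intros torus_C1_continuous[OF resolvent_C1] resolvent_grad_continuous cb that)
  \<comment> \<open>On the compact torus all continuous functions are bounded, so the type of
    bounded continuous functions is the space of continuous functions with the sup norm.\<close>
  define T where "T g = Bcontfun (K (apply_bcontfun g))" for g :: "'n torus \<Rightarrow>\<^sub>C real"
  have T: "apply_bcontfun (T g) = K (apply_bcontfun g)" for g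
    unfolding T_def by (intro Bcontfun_inverse torus_bcontfun cK continuous_on_apply_bcontfun)
  obtain B where B: "B > 0" "\<And>x. norm (log_grad \<rho> x) \<le> B" using torus_continuous_bounded[OF cb] by blast
  have lin: "bounded_linear T"
  \<comment> \<open>The 2 accounts for \<open>resolvent g x\<close> and
    \<open>resolvent g x0\<close>, the other summand for the term with
    \<open>log_grad\<close>.\<close>
  proof (rule bounded_linear_intro[where K="2 + B * resolvent_grad_bound TYPE('n)"])
    fix g h :: "'n torus \<Rightarrow>\<^sub>C real"
    show "T (g + h) = T g + T h"
      by (rule bcontfun_eqI) (simp add: T K_def resolvent_add resolvent_grad_add inner_add_right)
    show "T (c *\<^sub>R g) = c *\<^sub>R T g" for c
      by (rule bcontfun_eqI) (simp add: T K_def resolvent_cmult resolvent_grad_cmult algebra_simps)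
    show "norm (T g) \<le> norm g * (2 + B * resolvent_grad_bound TYPE('n))"
    proof (rule norm_bound)
      fix x
      have gb: "\<bar>g y\<bar> \<le> norm g" for y using norm_bounded[of g y] by simp
      have "\<bar>log_grad \<rho> x \<bullet> resolvent_grad g x\<bar> \<le> norm (log_grad \<rho> x) * norm (resolvent_grad g x)"
        by (rule Cauchy_Schwarz_ineq2)
      also have "\<dots> \<le> B * (norm g * resolvent_grad_bound TYPE('n))"
        using B by (intro mult_mono resolvent_grad_le gb continuous_on_apply_bcontfun) auto
      finally have "\<bar>log_grad \<rho> x \<bullet> resolvent_grad g x\<bar> \<le> B * (norm g * resolvent_grad_bound TYPE('n))" .
      moreover have "\<bar>resolvent g x\<bar> \<le> norm g" "\<bar>resolvent g x0\<bar> \<le> norm g"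
        by (intro resolvent_le gb continuous_on_apply_bcontfun)+
      ultimately have "\<bar>K g x\<bar> \<le> norm g + B * (norm g * resolvent_grad_bound TYPE('n)) + norm g"
        unfolding K_def by linarith
      then show "norm (apply_bcontfun (T g) x) \<le> norm g * (2 + B * resolvent_grad_bound TYPE('n))"
        by (simp add: T algebra_simps)
    qed
  qed
  have comp: "\<exists>l r. strict_mono (r :: nat \<Rightarrow> nat) \<and> (\<lambda>n. T (g (r n))) \<longlonglongrightarrow> l"
    if "\<And>n. norm (g n) \<le> 1" for g :: "nat \<Rightarrow> 'n torus \<Rightarrow>\<^sub>C real"
  proof -
    have "\<bar>g n x\<bar> \<le> 1" for n x using norm_bounded[of "g n" x] that[of n] by simp
    then obtain r u w where r: "strict_mono (r :: nat \<Rightarrow> nat)"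
      and u: "uniform_limit UNIV (\<lambda>n. resolvent (g (r n))) u sequentially"
      and w: "uniform_limit UNIV (\<lambda>n. resolvent_grad (g (r n))) w sequentially"
      using resolvent_compact[of "\<lambda>n. apply_bcontfun (g n)"] by auto
    have bd: "bounded (range f)" if "continuous_on UNIV f" for f :: "'n torus \<Rightarrow> real^'n"
      by (rule compact_imp_bounded[OF compact_continuous_image[OF that compact_torus]])
    have cw: "continuous_on UNIV w"
      by (rule uniform_limit_theorem[OF _ w])
        (auto intro!: always_eventually resolvent_grad_continuous)
    have uo: "uniform_limit UNIV (\<lambda>n x. resolvent (g (r n)) x0) (\<lambda>x. u x0) sequentially"
    proof (rule uniform_limitI)
      fix e :: real assume "e > 0"
      from uniform_limitD[OF u this]
      show "\<forall>\<^sub>F n in sequentially. \<forall>x\<in>UNIV. dist (resolvent (g (r n)) x0) (u x0) < e"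
        by eventually_elim auto
    qed
    have "uniform_limit UNIV (\<lambda>n x. resolvent (g (r n)) x + log_grad \<rho> x \<bullet> resolvent_grad (g (r n)) x - resolvent (g (r n)) x0)
        (\<lambda>x. u x + log_grad \<rho> x \<bullet> w x - u x0) sequentially"
      by (intro uniform_limit_minus uniform_limit_add u uo uniform_limit_const
          bounded_bilinear.bounded_uniform_limit[OF bounded_bilinear_inner] w bd cw cb)
    then have "uniform_limit UNIV (\<lambda>n. apply_bcontfun (T (g (r n)))) (\<lambda>x. u x + log_grad \<rho> x \<bullet> w x - u x0) sequentially"
      by (simp add: T K_def[abs_def])
    then have "\<exists>l. (\<lambda>n. T (g (r n))) \<longlonglongrightarrow> l"
      by (rule uniform_limit_bcontfunE[OF _ sequentially_bot]) blast
    with r show ?thesis by blast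
  qed
  \<comment> \<open>A fixed point solves the equation for \<open>Q = 0\<close> with
    \<open>m = resolvent g x0\<close>. So \<open>resolvent g\<close> is constant by uniqueness, and
    that constant is \<open>m = 0\<close>; the fixed-point equation then gives
    \<open>g = 0\<close>.\<close>
  have inj: "g = 0" if "T g = g" for g
  proof -
    have cg: "continuous_on UNIV (apply_bcontfun g)" by simp
    have K: "K (apply_bcontfun g) = apply_bcontfun g" using T[of g] that by simp
    have eq: "g x - resolvent g x = log_grad \<rho> x \<bullet> (resolvent_grad g x + 0) - resolvent g x0" for x
      using fun_cong[OF K, of x] by (simp add: K_def)
    have m: "resolvent g x0 = 0" and ell: "elliptic_C1 \<rho> 0 (resolvent g)"
      by (rule resolvent_elliptic[OF \<rho> cg eq])+
    have "elliptic_C1 \<rho> 0 (\<lambda>_. 0)" by (simp add: elliptic_C1_def torus_C1_const torus_div_free_def torus_grad_const)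
    from elliptic_C1_unique[OF \<rho> this, of "resolvent g"] ell
    obtain c where c: "\<And>x. resolvent g x = c" by auto
    then have r0: "resolvent g = (\<lambda>_. 0)" using m by auto
    have "resolvent_grad g x = 0" for x
      using torus_grad_resolvent[OF cg, of x] unfolding r0 by (simp add: torus_grad_const)
    then have "g x = 0" for x using eq[of x] r0 by simp
    then show ?thesis by (intro bcontfun_eqI) simp
  qed
  have cbP: "continuous_on UNIV (\<lambda>x. log_grad \<rho> x \<bullet> P)" by (intro continuous_intros cb)
  obtain g where g: "g - T g = Bcontfun (\<lambda>x. log_grad \<rho> x \<bullet> P)"
    using fredholm_injective_imp_surjective[OF lin comp inj] by blast
  have "apply_bcontfun (g - T g) x = log_grad \<rho> x \<bullet> P" for x
    unfolding g by (simp add: Bcontfun_inverse[OF torus_bcontfun[OF cbP]])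
  then have "g x - resolvent g x = log_grad \<rho> x \<bullet> (resolvent_grad g x + P) - resolvent g x0" for x
    by (simp add: T K_def inner_add_right algebra_simps)
  then have "elliptic_C1 \<rho> P (resolvent g)" by (rule resolvent_elliptic(2)[OF \<rho> continuous_on_apply_bcontfun])
  then show ?thesis by blast
qed

text \<open>If \<phi> is C2, the field is C1 and its divergence is continuous. Integration by parts
  moves the derivatives onto the field, and a continuous function orthogonal to all C1 functions
  vanishes.\<close>

lemma elliptic_C1_iff_C2:
  fixes \<rho> :: "'n::finite torus \<Rightarrow> real"
  assumes \<rho>: "torus_C1 \<rho>" and \<phi>: "torus_C2 \<phi>"
  shows "elliptic_C1 \<rho> P \<phi> \<longleftrightarrow> elliptic_C2 \<rho> P \<phi>"
proof -
  define V where "V x = \<rho> x *\<^sub>R (torus_grad \<phi> x + P)" for x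
  have C1: "torus_C1 \<phi>" "\<And>i. torus_C1 (\<lambda>x. torus_grad \<phi> x $ i)" using \<phi> by (auto simp: torus_C2_def)
  have V: "torus_C1 (\<lambda>x. V x $ i)" for i
    unfolding V_def vector_scaleR_component vector_add_component real_scaleR_def
    by (intro torus_C1_mult torus_C1_add \<rho> C1 torus_C1_const)
  have cdiv: "continuous_on UNIV (torus_div V)"
    unfolding torus_div_def[abs_def] by (intro continuous_intros torus_C1_grad_continuous V)
  have parts: "(LINT x|torus_lborel. V x \<bullet> torus_grad \<theta> x) = - (LINT x|torus_lborel. torus_div V x * \<theta> x)"
    if \<theta>: "torus_C1 \<theta>" for \<theta>
  proof -
    note cs = torus_C1_continuous[OF V] torus_C1_grad_continuous[OF V] torus_C1_continuous[OF \<theta>] torus_C1_grad_continuous[OF \<theta>]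
    have "(LINT x|torus_lborel. V x \<bullet> torus_grad \<theta> x) = (\<Sum>i\<in>UNIV. LINT x|torus_lborel. V x $ i * torus_grad \<theta> x $ i)"
      unfolding inner_vec_def inner_real_def
      by (intro Bochner_Integration.integral_sum torus_integrable_lborel continuous_intros cs)
    also have "\<dots> = - (\<Sum>i\<in>UNIV. LINT x|torus_lborel. torus_grad (\<lambda>x. V x $ i) x $ i * \<theta> x)"
      by (simp add: torus_integral_by_parts[OF V \<theta>] sum_negf)
    also have "\<dots> = - (LINT x|torus_lborel. (\<Sum>i\<in>UNIV. torus_grad (\<lambda>x. V x $ i) x $ i * \<theta> x))"
      by (subst Bochner_Integration.integral_sum) (auto intro!: torus_integrable_lborel continuous_intros cs)
    finally show ?thesis by (simp add: torus_div_def sum_distrib_right)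
  qed
  show ?thesis
  proof
    assume "elliptic_C1 \<rho> P \<phi>"
    then have "(LINT x|torus_lborel. torus_div V x * \<theta> x) = 0" if "torus_C1 \<theta>" for \<theta>
      using parts[OF that] that by (simp add: elliptic_C1_def torus_div_free_def V_def)
    then have "torus_div V x = 0" for x by (rule torus_orthogonal_C1_imp_0[OF cdiv])
    then show "elliptic_C2 \<rho> P \<phi>" using \<phi> by (simp add: elliptic_C2_def V_def[abs_def])
  next
    assume "elliptic_C2 \<rho> P \<phi>"
    then have "torus_div V x = 0" for x by (simp add: elliptic_C2_def V_def[abs_def])
    then show "elliptic_C1 \<rho> P \<phi>"
      using parts C1 by (simp add: elliptic_C1_def torus_div_free_def V_def)
  qed
qed

text \<open>With Dirac fibres the monad laws collapse the double bind to the image under the graph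
  map.\<close>

lemma fibred_measure_return:
  fixes v :: "'n::finite torus \<Rightarrow> real^'n"
  assumes M [simp, measurable_cong]: "sets M = sets borel" and v [measurable]: "v \<in> borel_measurable borel"
  shows "fibred_measure M (\<lambda>x. return borel (v x)) = distr M borel (\<lambda>x. (x, v x))"
proof -
  have pair: "(\<lambda>p. (x, p)) \<in> borel \<rightarrow>\<^sub>M (borel :: ('n torus \<times> (real^'n)) measure)" for x
    by (intro borel_measurable_continuous_onI continuous_intros)
  have "return borel (v x) \<bind> (\<lambda>p. return borel (x, p)) = return borel (x, v x)" for x
    by (subst bind_return[where N=borel]) (auto intro!: measurable_compose[OF pair return_measurable])
  then have "fibred_measure M (\<lambda>x. return borel (v x)) = M \<bind> (\<lambda>x. return borel (x, v x))"
    by (simp add: fibred_measure_def)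
  also have "\<dots> = distr M borel (\<lambda>x. (x, v x))"
  proof (rule bind_return_distr')
    have "(\<lambda>x. (x, v x)) \<in> borel \<rightarrow>\<^sub>M (borel :: ('n torus \<times> (real^'n)) measure)"
      unfolding borel_prod[symmetric, where 'a="'n torus" and 'b="real^'n"] by measurable
    then show "(\<lambda>x. (x, v x)) \<in> M \<rightarrow>\<^sub>M borel" by (simp cong: measurable_cong_sets)
    show "space M \<noteq> {}" using sets_eq_imp_space_eq[OF M] by simp
  qed
  finally show ?thesis .
qed

text \<open>The density \<rho> turns the divergence-free condition into orthogonality to gradients
  in L2 of \<mu>, and the constant sequence \<phi> serves as the approximating sequence of
  gradients.\<close>

lemma (in torus_measure) elliptic_flow:
  assumes \<rho>: "torus_C1 \<rho>" "\<And>x. \<rho> x > 0" and dens: "\<mu> = density torus_lborel (\<lambda>x. ennreal (\<rho> x))"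
    and \<phi>: "elliptic_C1 \<rho> P \<phi>"
  shows "flow P (\<lambda>x. P + torus_grad \<phi> x)"
proof -
  have C: "torus_C1 \<phi>" using \<phi> by (simp add: elliptic_C1_def)
  have [measurable]: "torus_grad \<phi> \<in> borel_measurable borel" by (rule torus_grad_measurable[OF C])
  have \<rho>m [measurable]: "\<rho> \<in> borel_measurable borel" by (rule torus_measurable_continuous[OF torus_C1_continuous[OF \<rho>(1)]])
  have "(LINT x|\<mu>. (P + torus_grad \<phi> x) \<bullet> torus_grad \<theta> x) = 0" if \<theta>: "torus_C1 \<theta>" for \<theta>
  proof -
    have [measurable]: "torus_grad \<theta> \<in> borel_measurable borel" by (rule torus_grad_measurable[OF \<theta>])
    have "(LINT x|\<mu>. (P + torus_grad \<phi> x) \<bullet> torus_grad \<theta> x) =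
        (LINT x|torus_lborel. \<rho> x *\<^sub>R ((P + torus_grad \<phi> x) \<bullet> torus_grad \<theta> x))"
      unfolding dens by (rule integral_density) (use \<rho>(2) in \<open>auto intro: less_imp_le\<close>)
    also have "\<dots> = (LINT x|torus_lborel. (\<rho> x *\<^sub>R (torus_grad \<phi> x + P)) \<bullet> torus_grad \<theta> x)"
      by (simp add: add.commute)
    also have "\<dots> = 0" using \<phi> \<theta> by (simp add: elliptic_C1_def torus_div_free_def)
    finally show ?thesis .
  qed
  moreover have "integrable \<mu> (\<lambda>x. (norm (P + torus_grad \<phi> x))\<^sup>2)"
    using integrable_norm2_torus_grad[OF C, of P] by (simp add: add.commute)
  ultimately show ?thesis
    unfolding flow_def using C by (intro conjI exI[of _ "\<lambda>_. \<phi>"]) (auto simp: add.commute)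
qed

theorem theorem4p1:
  fixes \<mu> :: "('n::finite) torus measure" and P :: "real^'n"
  assumes "\<mu> \<in> borel_prob"
  shows "(\<exists>!\<nu>. weak_solution \<mu> P \<nu>) \<and>
    (\<forall>\<nu>. weak_solution \<mu> P \<nu> \<longrightarrow>
      F \<mu> P = - (LINT (x, p)|\<nu>. (norm p)\<^sup>2 / 2 - p \<bullet> P)) \<and>
    (\<forall>J. Fstar \<mu> J = ereal (1 / 2) * (INF \<nu>\<in>\<Lambda>_mean \<mu> J. ereal (LINT (x, p)|\<nu>. (norm p)\<^sup>2))) \<and>
    (\<forall>J \<nu>. J \<in> subgradient (F \<mu>) P \<and> weak_solution \<mu> P \<nu> \<longrightarrow>
      \<nu> \<in> \<Lambda>_mean \<mu> J \<and>
      ereal (LINT (x, p)|\<nu>. (norm p)\<^sup>2)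
        = (INF \<xi>\<in>\<Lambda>_mean \<mu> J. ereal (LINT (x, p)|\<xi>. (norm p)\<^sup>2))) \<and>
    (\<forall>\<rho>. torus_C1 \<rho> \<and> (\<forall>x. \<rho> x > 0) \<and> \<mu> = density torus_lborel (\<lambda>x. ennreal (\<rho> x)) \<longrightarrow>
      (\<exists>\<phi>. elliptic_C1 \<rho> P \<phi>) \<and>
      (\<forall>\<phi> \<psi>. elliptic_C1 \<rho> P \<phi> \<longrightarrow>
         (elliptic_C1 \<rho> P \<psi> \<longleftrightarrow> (\<exists>c. \<forall>x. \<psi> x = \<phi> x + c))) \<and>
      (\<forall>\<phi>. torus_C2 \<phi> \<longrightarrow> (elliptic_C1 \<rho> P \<phi> \<longleftrightarrow> elliptic_C2 \<rho> P \<phi>)) \<and>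
      (\<forall>\<nu> \<phi>. weak_solution \<mu> P \<nu> \<and> elliptic_C1 \<rho> P \<phi> \<longrightarrow>
         \<nu> = fibred_measure (density torus_lborel (\<lambda>x. ennreal (\<rho> x)))
               (\<lambda>x. return borel (P + torus_grad \<phi> x))))"
proof -
  interpret torus_measure \<mu> by (rule torus_measure.intro) (rule assms)
  have ws: "weak_solution \<mu> P \<nu> \<longleftrightarrow> \<nu> = graph_measure (the_flow P)" for \<nu>
    by (rule weak_solution_iff[OF flow_the_flow])
  have F: "F \<mu> P = - (LINT z|\<nu>. (norm (snd z))\<^sup>2 / 2 - snd z \<bullet> P)" if "weak_solution \<mu> P \<nu>" for \<nu>
    using that unfolding ws by (simp add: graph_measure_value[OF flow_the_flow] F_eq_flow[OF flow_the_flow])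
  \<comment> \<open>Since \<open>P + torus_grad \<phi>\<close> is a flow,
    \<open>weak_solution_iff\<close> identifies \<nu> with its graph measure.\<close>
  have repr: "\<nu> = fibred_measure (density torus_lborel (\<lambda>x. ennreal (\<rho> x))) (\<lambda>x. return borel (P + torus_grad \<phi> x))"
    if \<rho>: "torus_C1 \<rho>" "\<And>x. \<rho> x > 0" and dens: "\<mu> = density torus_lborel (\<lambda>x. ennreal (\<rho> x))"
      and \<nu>: "weak_solution \<mu> P \<nu>" and \<phi>: "elliptic_C1 \<rho> P \<phi>" for \<rho> \<nu> \<phi>
  proof -
    have flow: "flow P (\<lambda>x. P + torus_grad \<phi> x)" by (rule elliptic_flow[OF \<rho> dens \<phi>])
    show ?thesis
      using \<nu> unfolding weak_solution_iff[OF flow] dens[symmetric] graph_measure_def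
      by (simp add: fibred_measure_return[OF sets_mu flow_measurable[OF flow]])
  qed
  show ?thesis
    unfolding split_beta'
  proof (intro conjI allI impI)
    show "\<exists>!\<nu>. weak_solution \<mu> P \<nu>" by (simp add: ws)
  next
    fix \<nu> assume "weak_solution \<mu> P \<nu>"
    then show "F \<mu> P = - (LINT z|\<nu>. (norm (snd z))\<^sup>2 / 2 - snd z \<bullet> P)" by (rule F)
  next
    fix J
    show "Fstar \<mu> J = ereal (1 / 2) * (INF \<nu>\<in>\<Lambda>_mean \<mu> J. ereal (LINT z|\<nu>. (norm (snd z))\<^sup>2))"
      by (rule Fstar_eq)
  next
    fix J \<nu> assume "J \<in> subgradient (F \<mu>) P \<and> weak_solution \<mu> P \<nu>"
    then have *: "J \<in> subgradient (F \<mu>) P" "weak_solution \<mu> P \<nu>" by auto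
    show "\<nu> \<in> \<Lambda>_mean \<mu> J" by (rule subgradient_attained(1)[OF *])
    show "ereal (LINT z|\<nu>. (norm (snd z))\<^sup>2) = (INF \<xi>\<in>\<Lambda>_mean \<mu> J. ereal (LINT z|\<xi>. (norm (snd z))\<^sup>2))"
      by (rule subgradient_attained(2)[OF *])
  next
    fix \<rho> assume "torus_C1 \<rho> \<and> (\<forall>x. \<rho> x > 0) \<and> \<mu> = density torus_lborel (\<lambda>x. ennreal (\<rho> x))"
    then have \<rho>: "torus_C1 \<rho>" "\<And>x. \<rho> x > 0" and dens: "\<mu> = density torus_lborel (\<lambda>x. ennreal (\<rho> x))" by auto
    show "\<exists>\<phi>. elliptic_C1 \<rho> P \<phi>" by (rule elliptic_C1_exists[OF \<rho>])
    show "elliptic_C1 \<rho> P \<psi> \<longleftrightarrow> (\<exists>c. \<forall>x. \<psi> x = \<phi> x + c)" if "elliptic_C1 \<rho> P \<phi>" for \<phi> \<psi>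
      by (rule elliptic_C1_unique[OF \<rho> that])
    show "elliptic_C1 \<rho> P \<phi> \<longleftrightarrow> elliptic_C2 \<rho> P \<phi>" if "torus_C2 \<phi>" for \<phi>
      by (rule elliptic_C1_iff_C2[OF \<rho>(1) that])
    fix \<nu> \<phi> assume "weak_solution \<mu> P \<nu> \<and> elliptic_C1 \<rho> P \<phi>"
    then show "\<nu> = fibred_measure (density torus_lborel (\<lambda>x. ennreal (\<rho> x))) (\<lambda>x. return borel (P + torus_grad \<phi> x))"
      using repr[OF \<rho> dens] by blast
  qed
qed

end
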